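(* Let $\mathcal V$ be a Poisson vertex algebra (PVA) and $M$ a PVA module over $\mathcal V$. Regard the space of Kähler differentials $\Omega(\mathcal V)$ as a Lie conformal algebroid (LCAd) over $\mathcal V$ and $M$ as a module over the LCAd $\Omega(\mathcal V)$ (as recalled in the context). Then there is an isomorphism of complexes $$\Phi:(\Gamma^\bullet(\mathcal V,M),d_{\mathrm{PVA}})\ \xrightarrow{\ \sim\ }\ (C^\bullet(\Omega(\mathcal V),M),d_{\mathrm{LCAd}})$$ from the variational PVA cohomology complex of $\mathcal V$ with coefficients in $M$ to the LCAd cohomology complex of $\Omega(\mathcal V)$ with coefficients in $M$. Explicitly, $\Phi$ maps a $k$-cochain $\gamma\in\Gamma^k(\mathcal V,M)$ to the $k$-cochain $\Phi(\gamma)\in C^k(\Omega(\mathcal V),M)$ defined by $$\Phi(\gamma)_{\lambda_1,\dots,\lambda_k}(a_1du_1,\dots,a_kdu_k)=\big(\big|_{x_1=\partial}a_1\big)\cdots\big(\big|_{x_k=\partial}a_k\big)\,\gamma_{\lambda_1+x_1,\dots,\lambda_k+x_k}(u_1,\dots,u_k)$$ for all $a_1,u_1,\dots,a_k,u_k\in\mathcal V$.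
   Context: Everything is over a field $\mathbb F$ of characteristic $0$. A differential algebra $A$ is a commutative associative unital algebra with a derivation $\partial$; $A[\partial]$ is the associative algebra of differential operators $a(\partial)=\sum_i a_i\partial^i$ (product = composition), with symbol $a(x)=\sum_ia_ix^i$ and adjoint symbol $a^*(\lambda)=\sum_i(-\lambda-\partial)^i(a_i)\in A[\lambda]$. Substitution convention: in an expression containing a factor $\big(\big|_{x=\partial}f\big)$, expand the whole expression in powers of the commuting indeterminate $x$ and replace each $x^n$ by $\partial^n$ acting only on what is inside that parenthesis (on coefficients, if $f$ is a polynomial). E.g. $a(\lambda+x)\big(\big|_{x=\partial}b\big)c=c\sum_ia_i(\lambda+\partial)^i(b)$ and $\big(\big|_{x=\partial}a\big)\phi_{\lambda+x}=\sum_n\frac1{n!}(\partial^na)\frac{d^n}{d\lambda^n}\phi_\lambda$. For $\theta_\lambda$ linear, $\theta_\lambda(a(x))=\sum_i\theta_\lambda(a_i)x^i$. Conformal derivations: $\mathrm{CDer}(A)$ is the space of linear maps $\phi_\lambda:A\to A[\lambda]$ with $\phi_\lambda(\partial a)=(\partial+\lambda)\phi_\lambda(a)$ and $\phi_\lambda(ab)=\phi_\lambda(a)b+a\phi_\lambda(b)$; it is a left $A[\partial]$-module by $(a(\partial)\phi)_\lambda=\big(\big|_{x=\partial}a^*(\lambda)\big)\phi_{\lambda+x}$. A Lie conformal algebra (LCA) is an $\mathbb F[\partial]$-module $E$ with a bilinear $\lambda$-bracket $[\cdot_\lambda\cdot]:E\otimes E\to E[\lambda]$ with: $[\partial u_\lambda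 v]=-\lambda[u_\lambda v]$, $[u_\lambda\partial v]=(\partial+\lambda)[u_\lambda v]$; $[v_\lambda u]=-\big(\big|_{x=\partial}[u_{-\lambda-x}v]\big)$; $[u_\lambda[v_\mu w]]-[v_\mu[u_\lambda w]]=[[u_\lambda v]_{\lambda+\mu}w]$. An LCAd over $A$ is a left $A[\partial]$-module $E$ with a left $A[\partial]$-module homomorphism $\theta:E\to\mathrm{CDer}(A)$ (anchor) and an LCA $\lambda$-bracket such that (i) $[u_\lambda a(\partial)v]=a(\lambda+x)\big(\big|_{x=\partial}[u_\lambda v]\big)+\theta(u)_\lambda(a(x))\big(\big|_{x=\partial}v\big)$, (ii) $\theta([u_\lambda v])_\mu(a)=\theta(u)_\lambda(\theta(v)_{\mu-\lambda}(a))-\theta(v)_{\mu-\lambda}(\theta(u)_\lambda(a))$. A module over the LCAd $E$ is a left $A[\partial]$-module $M$ with a bilinear $\lambda$-action $E\times M\to M[\lambda]$, $(u,m)\mapsto u_\lambda m$, such that (i) $u_\lambda(a(\partial)m)=a(\lambda+x)\big(\big|_{x=\partial}u_\lambda m\big)+\theta(u)_\lambda(a(x))\big(\big|_{x=\partial}m\big)$; (ii) $(a(\partial)u)_\lambda m=\big(\big|_{x=\partial}a^*(\lambda)\big)(u_{\lambda+x}m)$; (iii) $[u_\lambda v]_\mu m=u_\lambda(v_{\mu-\lambda}m)-v_{\mu-\lambda}(u_\lambda m)$. LCAd complex: $C^k(E,M)$, $k\ge0$, is the space of linear maps $\varphi_{\lambda_1,\dots,\lambda_k}:E^{\otimes k}\to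 M[\lambda_1,\dots,\lambda_k]/\langle\partial+\lambda_1+\dots+\lambda_k\rangle$ (quotient by the image of the operator $\partial+\lambda_1+\dots+\lambda_k$) such that $\varphi_{\lambda_1,\dots,\lambda_k}(a_1(\partial)u_1,\dots,a_k(\partial)u_k)=\big(\big|_{x_1=\partial}a_1^*(\lambda_1)\big)\cdots\big(\big|_{x_k=\partial}a_k^*(\lambda_k)\big)\varphi_{\lambda_1+x_1,\dots,\lambda_k+x_k}(u_1,\dots,u_k)$ and $\varphi_{\lambda_1,\dots,\lambda_k}(u_1,\dots,u_k)=\mathrm{sign}(\pi)\varphi_{\lambda_{\pi(1)},\dots,\lambda_{\pi(k)}}(u_{\pi(1)},\dots,u_{\pi(k)})$ for all $\pi\in S_k$. The differential is $$(d\varphi)_{\lambda_1,\dots,\lambda_{k+1}}(u_1,\dots,u_{k+1})=\sum_{i}(-1)^{i+1}{u_i}_{\lambda_i}\big(\varphi_{\lambda_1,\overset{i}{\check\dots},\lambda_{k+1}}(u_1,\overset{i}{\check\dots},u_{k+1})\big)+\sum_{i<j}(-1)^{i+j}\varphi_{\lambda_i+\lambda_j,\lambda_1,\overset{i}{\check\dots}\overset{j}{\check\dots},\lambda_{k+1}}\big([{u_i}_{\lambda_i}u_j],u_1,\overset{i}{\check\dots}\overset{j}{\check\dots},u_{k+1}\big),$$ where $\overset{i}{\check\dots}$ means the $i$-th entry is omitted. A PVA is a differential algebra $\mathcal V$ with an LCA $\lambda$-bracket $\{\cdot_\lambda\cdot\}$ on the $\mathbb F[\partial]$-module $\mathcal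 V$ satisfying $\{f_\lambda gh\}=g\{f_\lambda h\}+h\{f_\lambda g\}$. A module over the PVA $\mathcal V$ is a left $\mathcal V[\partial]$-module $M$ (action of $f\in\mathcal V$ denoted $f\cdot m$) with a bilinear $\lambda$-action $f_\lambda m\in M[\lambda]$ of the LCA $\mathcal V$, i.e. $(\partial f)_\lambda m=-\lambda f_\lambda m$, $f_\lambda(\partial m)=(\partial+\lambda)(f_\lambda m)$, $f_\lambda(g_\mu m)-g_\mu(f_\lambda m)=\{f_\lambda g\}_{\lambda+\mu}m$, such that $f_\lambda(g\cdot m)=\{f_\lambda g\}\cdot m+g\cdot(f_\lambda m)$ and $(fg)_\lambda m=\big(\big|_{x=\partial}f\big)\cdot(g_{\lambda+x}m)+\big(\big|_{x=\partial}g\big)\cdot(f_{\lambda+x}m)$. Variational PVA complex: $\Gamma^k(\mathcal V,M)$ is the space of linear maps $\gamma_{\lambda_1,\dots,\lambda_k}:\mathcal V^{\otimes k}\to M[\lambda_1,\dots,\lambda_k]/\langle\partial+\lambda_1+\dots+\lambda_k\rangle$ satisfying, for each $i$: $\gamma_{\lambda_1,\dots,\lambda_k}(a_1,\dots,\partial a_i,\dots,a_k)=-\lambda_i\gamma_{\lambda_1,\dots,\lambda_k}(a_1,\dots,a_k)$; $\gamma_{\lambda_1,\dots,\lambda_k}(a_1,\dots,b_ic_i,\dots,a_k)=\big(\big|_{x=\partial}b_i\big)\gamma_{\lambda_1,\dots,\lambda_i+x,\dots,\lambda_k}(a_1,\dots,c_i,\dots,a_k)+\big(\big|_{x=\partial}c_i\big)\gamma_{\lambda_1,\dots,\lambda_i+x,\dots,\lambda_k}(a_1,\dots,b_i,\dots,a_k)$;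 and the skewsymmetry $\gamma_{\lambda_1,\dots,\lambda_k}(a_1,\dots,a_k)=\mathrm{sign}(\pi)\gamma_{\lambda_{\pi(1)},\dots,\lambda_{\pi(k)}}(a_{\pi(1)},\dots,a_{\pi(k)})$ for all $\pi\in S_k$. Its differential $d_{\mathrm{PVA}}$ is $$(d_{\mathrm{PVA}}\gamma)_{\lambda_1,\dots,\lambda_{k+1}}(a_1,\dots,a_{k+1})=\sum_{i}(-1)^{i+1}{a_i}_{\lambda_i}\big(\gamma_{\lambda_1,\overset{i}{\check\dots},\lambda_{k+1}}(a_1,\overset{i}{\check\dots},a_{k+1})\big)+\sum_{i<j}(-1)^{i+j}\gamma_{\lambda_i+\lambda_j,\lambda_1,\overset{i}{\check\dots}\overset{j}{\check\dots},\lambda_{k+1}}\big(\{{a_i}_{\lambda_i}a_j\},a_1,\overset{i}{\check\dots}\overset{j}{\check\dots},a_{k+1}\big),$$ with $a_i\in\mathcal V$ and the $\lambda$-action of $\mathcal V$ on $M$. Kähler differentials: $\Omega(\mathcal V)$ is the $\mathcal V$-module generated by symbols $df$, $f\in\mathcal V$, modulo linearity of $d$ and $d(fg)=fdg+gdf$; it is a left $\mathcal V[\partial]$-module by $\partial(fdg)=(\partial f)dg+fd(\partial g)$. LCAd structure on $\Omega(\mathcal V)$: the anchor is the left $\mathcal V[\partial]$-module homomorphism with $\theta(df)_\lambda(g)=\{f_\lambda g\}$, and the $\lambda$-bracket is the unique LCAd $\lambda$-bracket with $[df_\lambda dg]=d(\{f_\lambda g\})$ ($d$ acting on coefficients). The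 PVA module $M$ is a module over the LCAd $\Omega(\mathcal V)$ via $(f\,dg)_\lambda m=\big(\big|_{x=\partial}f\big)\cdot(g_{\lambda+x}m)$. *)

theory Defs
  imports
    "HOL-Library.Poly_Mapping"
    "HOL-Library.FuncSet"
    "HOL-Computational_Algebra.Polynomial"
    "HOL-Combinatorics.Permutations"
begin

section \<open>Polynomials with coefficients in a module\<close>

text \<open>
  \<open>M[\<lambda>]\<close> is the library type \<open>'m poly\<close>; \<open>M[\<lambda>\<^sub>0, \<lambda>\<^sub>1, \<dots>]\<close> is the type \<open>'m mpol\<close>, mapping monomials
  (exponent vectors) to coefficients.  Variables are numbered from \<open>0\<close>, so the \<open>\<lambda>\<^sub>i\<close> of the usual
  notation \<open>\<lambda>\<^sub>1, \<dots>, \<lambda>\<^sub>k\<close> is variable \<open>i - 1\<close>; likewise for the arguments of cochains.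
\<close>

type_synonym 'm mpol = "(nat \<Rightarrow>\<^sub>0 nat) \<Rightarrow>\<^sub>0 'm"

definition mpols :: "nat \<Rightarrow> 'm::ab_group_add mpol set" where
  "mpols k = {p. \<forall>m \<in> Poly_Mapping.keys p. Poly_Mapping.keys m \<subseteq> {..<k}}"

definition mon_mult :: "(nat \<Rightarrow>\<^sub>0 nat) \<Rightarrow> 'm::ab_group_add mpol \<Rightarrow> 'm mpol" where
  "mon_mult n p = (\<Sum>m \<in> Poly_Mapping.keys p. Poly_Mapping.single (n + m) (Poly_Mapping.lookup p m))"

definition var :: "nat \<Rightarrow> 'm::ab_group_add mpol \<Rightarrow> 'm mpol" where
  "var i = mon_mult (Poly_Mapping.single i 1)"

text \<open>
  Substitutions are given by operators: an element of \<open>\<int>[\<lambda>\<^sub>0, \<lambda>\<^sub>1, \<dots>]\<close> to be substituted for a variable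
  is represented by the operator of multiplication by it.
  \<open>plug L P\<close> is \<open>P(\<lambda>)\<close> with \<open>\<lambda> := L\<close>; \<open>msub [L\<^sub>0, \<dots>, L\<^sub>k\<^sub>-\<^sub>1] p\<close> is \<open>p\<close> with \<open>\<lambda>\<^sub>i := L\<^sub>i\<close>, for
  \<open>p \<in> mpols k\<close> and commuting \<open>L\<^sub>i\<close>.
\<close>

definition plug :: "('m mpol \<Rightarrow> 'm mpol) \<Rightarrow> 'm::ab_group_add poly \<Rightarrow> 'm mpol" where
  "plug L P = (\<Sum>n\<le>degree P. (L ^^ n) (Poly_Mapping.single 0 (coeff P n)))"

definition msub :: "('m mpol \<Rightarrow> 'm mpol) list \<Rightarrow> 'm::ab_group_add mpol \<Rightarrow> 'm mpol" where
  "msub Ls p = (\<Sum>m \<in> Poly_Mapping.keys p.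
     fold (\<lambda>i. (Ls ! i) ^^ Poly_Mapping.lookup m i) [0..<length Ls] (Poly_Mapping.single 0 (Poly_Mapping.lookup p m)))"

text \<open>The extension of an additive map \<open>f\<close> to polynomials, linear over the variables.\<close>

definition mext :: "('m \<Rightarrow> 'n mpol) \<Rightarrow> 'm::ab_group_add mpol \<Rightarrow> 'n::ab_group_add mpol" where
  "mext f p = (\<Sum>m \<in> Poly_Mapping.keys p. mon_mult m (f (Poly_Mapping.lookup p m)))"

text \<open>\<open>P(- \<lambda> - \<partial>)\<close>, with \<open>\<partial>\<close> acting on the coefficients of \<open>P\<close>.  For \<open>P = a(x)\<close> the symbol of a
  differential operator this is the adjoint symbol \<open>a\<^sup>*(\<lambda>)\<close>.\<close>

definition pneg :: "('m \<Rightarrow> 'm) \<Rightarrow> 'm::ab_group_add poly \<Rightarrow> 'm poly" where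
  "pneg D P = (\<Sum>n\<le>degree P. ((\<lambda>Q. - pCons 0 Q - map_poly D Q) ^^ n) [:coeff P n:])"

text \<open>\<open>dop act D a m\<close> is \<open>a(\<partial>) m\<close>, the differential operator being given by its symbol \<open>a\<close>.\<close>

definition dop :: "('v::comm_ring_1 \<Rightarrow> 'm \<Rightarrow> 'm) \<Rightarrow> ('m \<Rightarrow> 'm) \<Rightarrow> 'v poly \<Rightarrow> 'm::ab_group_add \<Rightarrow> 'm" where
  "dop act D a m = (\<Sum>i\<le>degree a. act (coeff a i) ((D ^^ i) m))"

text \<open>
  \<open>shift_act \<partial> act i b p\<close> is \<open>(|\<^sub>x\<^sub>=\<^sub>\<partial> b(\<lambda>\<^sub>i)) p(\<dots>, \<lambda>\<^sub>i + x, \<dots>)\<close>: writing \<open>b = \<Sum>\<^sub>n b\<^sub>n \<lambda>\<^sub>i\<^sup>n\<close>, the power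
  \<open>\<lambda>\<^sub>i\<^sup>e\<close> occurring in a monomial of \<open>p\<close> becomes \<open>\<Sum>\<^sub>n \<Sum>\<^sub>j (e choose j) (\<partial>\<^sup>j b\<^sub>n) \<lambda>\<^sub>i\<^sup>e\<^sup>-\<^sup>j\<^sup>+\<^sup>n\<close>.
\<close>

definition shift_act ::
  "('v \<Rightarrow> 'v) \<Rightarrow> ('v::comm_ring_1 \<Rightarrow> 'm \<Rightarrow> 'm) \<Rightarrow> nat \<Rightarrow> 'v poly \<Rightarrow> 'm::ab_group_add mpol \<Rightarrow> 'm mpol" where
  "shift_act del act i b p =
     (\<Sum>m \<in> Poly_Mapping.keys p. \<Sum>n\<le>degree b. \<Sum>j\<le>Poly_Mapping.lookup m i.
        Poly_Mapping.single (m - Poly_Mapping.single i j + Poly_Mapping.single i n)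
          (act (of_nat (Poly_Mapping.lookup m i choose j) * (del ^^ j) (coeff b n)) (Poly_Mapping.lookup p m)))"

definition shift_acts ::
  "('v \<Rightarrow> 'v) \<Rightarrow> ('v::comm_ring_1 \<Rightarrow> 'm \<Rightarrow> 'm) \<Rightarrow> 'v poly list \<Rightarrow> 'm::ab_group_add mpol \<Rightarrow> 'm mpol" where
  "shift_acts del act bs = fold (\<lambda>i. shift_act del act i (bs ! i)) [0..<length bs]"


section \<open>Differential algebras and Lie conformal algebras\<close>

locale diff_algebra = alg: vector_space s
  for s :: "'f::field_char_0 \<Rightarrow> 'v::comm_ring_1 \<Rightarrow> 'v" +
  fixes del :: "'v \<Rightarrow> 'v"
  assumes scale_mult: "s c (a * b) = s c a * b"
    and del_linear: "Vector_Spaces.linear s s del"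
    and del_mult: "del (a * b) = del a * b + a * del b"

text \<open>
  A left module over \<open>A[\<partial>]\<close> is an \<open>A\<close>-module with an operator \<open>D\<close> (the action of \<open>\<partial>\<close>) obeying the
  commutation relation \<open>\<partial> \<circ> a = \<partial>(a) + a \<circ> \<partial>\<close> of \<open>A[\<partial>]\<close>; the action of \<open>a(\<partial>)\<close> is \<open>dop act D a\<close>.
  The field acts through \<open>A\<close>.
\<close>

locale diff_module = diff_algebra s del + mdl: module act
  for s :: "'f::field_char_0 \<Rightarrow> 'v::comm_ring_1 \<Rightarrow> 'v"
    and del :: "'v \<Rightarrow> 'v"
    and act :: "'v \<Rightarrow> 'm::ab_group_add \<Rightarrow> 'm" +
  fixes D :: "'m \<Rightarrow> 'm"
  assumes D_add: "D (m + n) = D m + D n"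
    and D_act: "D (act a m) = act (del a) m + act a (D m)"

definition fscale ::
  "('f \<Rightarrow> 'v \<Rightarrow> 'v) \<Rightarrow> ('v::comm_ring_1 \<Rightarrow> 'm \<Rightarrow> 'm) \<Rightarrow> 'f \<Rightarrow> 'm \<Rightarrow> 'm" where
  "fscale s act c m = act (s c 1) m"

definition lin_to_poly ::
  "('f::field \<Rightarrow> 'm::ab_group_add \<Rightarrow> 'm) \<Rightarrow> ('f \<Rightarrow> 'n::ab_group_add \<Rightarrow> 'n) \<Rightarrow> ('m \<Rightarrow> 'n poly) \<Rightarrow> bool" where
  "lin_to_poly s s' = Vector_Spaces.linear s (\<lambda>c. map_poly (s' c))"

text \<open>In identities with several variables, \<open>\<lambda>\<close> is \<open>var 0\<close> and \<open>\<mu>\<close> is \<open>var 1\<close>.\<close>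

locale lie_conformal_algebra = vec: vector_space s
  for s :: "'f::field_char_0 \<Rightarrow> 'e::ab_group_add \<Rightarrow> 'e" +
  fixes D :: "'e \<Rightarrow> 'e" and br :: "'e \<Rightarrow> 'e \<Rightarrow> 'e poly"
  assumes D_linear: "Vector_Spaces.linear s s D"
    and br_linear_left: "lin_to_poly s s (\<lambda>u. br u v)"
    and br_linear_right: "lin_to_poly s s (\<lambda>v. br u v)"
    and br_D_left: "br (D u) v = - pCons 0 (br u v)"
    and br_D_right: "br u (D v) = map_poly D (br u v) + pCons 0 (br u v)"
    and br_skew: "br v u = - pneg D (br u v)"
    and br_jacobi:
      "mext (\<lambda>z. plug (var 0) (br u z)) (plug (var 1) (br v w))
       - mext (\<lambda>z. plug (var 1) (br v z)) (plug (var 0) (br u w))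
       = mext (\<lambda>z. plug (\<lambda>p. var 0 p + var 1 p) (br z w)) (plug (var 0) (br u v))"


section \<open>Lie conformal algebroids and their modules\<close>

definition conformal_derivation ::
  "('f::field \<Rightarrow> 'v::comm_ring_1 \<Rightarrow> 'v) \<Rightarrow> ('v \<Rightarrow> 'v) \<Rightarrow> ('v \<Rightarrow> 'v poly) \<Rightarrow> bool" where
  "conformal_derivation s del \<phi> \<longleftrightarrow>
     lin_to_poly s s \<phi> \<and>
     (\<forall>a. \<phi> (del a) = map_poly del (\<phi> a) + pCons 0 (\<phi> a)) \<and>
     (\<forall>a b. \<phi> (a * b) = smult b (\<phi> a) + smult a (\<phi> b))"

text \<open>
  \<open>leibniz_dop act D a P T\<close> is the right-hand side
  \<open>a(\<lambda>+x) (|\<^sub>x\<^sub>=\<^sub>\<partial> P) + T(a(x)) (|\<^sub>x\<^sub>=\<^sub>\<partial> m) = \<Sum>\<^sub>i a\<^sub>i (\<lambda>+\<partial>)\<^sup>i P + \<Sum>\<^sub>i T(a\<^sub>i) \<partial>\<^sup>i m\<close>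
  of the Leibniz rules for \<open>\<lambda>\<close>-brackets and \<open>\<lambda>\<close>-actions.
\<close>

definition leibniz_dop ::
  "('v::comm_ring_1 \<Rightarrow> 'm \<Rightarrow> 'm) \<Rightarrow> ('m \<Rightarrow> 'm) \<Rightarrow> 'v poly \<Rightarrow> 'm poly \<Rightarrow> ('v \<Rightarrow> 'v poly) \<Rightarrow> 'm::ab_group_add \<Rightarrow> 'm poly" where
  "leibniz_dop act D a P T m =
     (\<Sum>i\<le>degree a. map_poly (act (coeff a i)) (((\<lambda>Q. pCons 0 Q + map_poly D Q) ^^ i) P))
     + (\<Sum>i\<le>degree a. map_poly (\<lambda>f. act f ((D ^^ i) m)) (T (coeff a i)))"

locale lie_conformal_algebroid =
  diff_module s del act D + lca: lie_conformal_algebra "fscale s act" D br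
  for s :: "'f::field_char_0 \<Rightarrow> 'v::comm_ring_1 \<Rightarrow> 'v"
    and del :: "'v \<Rightarrow> 'v"
    and act :: "'v \<Rightarrow> 'e::ab_group_add \<Rightarrow> 'e"
    and D :: "'e \<Rightarrow> 'e"
    and br :: "'e \<Rightarrow> 'e \<Rightarrow> 'e poly" +
  fixes anchor :: "'e \<Rightarrow> 'v \<Rightarrow> 'v poly"
  assumes anchor_cder: "conformal_derivation s del (anchor u)"
    and anchor_add: "anchor (u + v) b = anchor u b + anchor v b"
    and anchor_dop:
      "plug (var 0) (anchor (dop act D a u) b)
       = shift_act del (*) 0 (pneg del a) (plug (var 0) (anchor u b))"
    and br_dop: "br u (dop act D a v) = leibniz_dop act D a (br u v) (anchor u) v"
    and anchor_br:
      "mext (\<lambda>z. plug (var 1) (anchor z b)) (plug (var 0) (br u v))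
       = mext (\<lambda>c. plug (var 0) (anchor u c)) (plug (\<lambda>p. var 1 p - var 0 p) (anchor v b))
         - mext (\<lambda>c. plug (\<lambda>p. var 1 p - var 0 p) (anchor v c)) (plug (var 0) (anchor u b))"

locale lcad_module =
  lie_conformal_algebroid s del actE DE br anchor + M: diff_module s del actM DM
  for s :: "'f::field_char_0 \<Rightarrow> 'v::comm_ring_1 \<Rightarrow> 'v"
    and del :: "'v \<Rightarrow> 'v"
    and actE :: "'v \<Rightarrow> 'e::ab_group_add \<Rightarrow> 'e"
    and DE :: "'e \<Rightarrow> 'e"
    and br :: "'e \<Rightarrow> 'e \<Rightarrow> 'e poly"
    and anchor :: "'e \<Rightarrow> 'v \<Rightarrow> 'v poly"
    and actM :: "'v \<Rightarrow> 'm::ab_group_add \<Rightarrow> 'm"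
    and DM :: "'m \<Rightarrow> 'm" +
  fixes lam :: "'e \<Rightarrow> 'm \<Rightarrow> 'm poly"
  assumes lam_linear_left: "lin_to_poly (fscale s actE) (fscale s actM) (\<lambda>u. lam u m)"
    and lam_linear_right: "lin_to_poly (fscale s actM) (fscale s actM) (\<lambda>m. lam u m)"
    and lam_dop_right: "lam u (dop actM DM a m) = leibniz_dop actM DM a (lam u m) (anchor u) m"
    and lam_dop_left:
      "plug (var 0) (lam (dop actE DE a u) m)
       = shift_act del actM 0 (pneg del a) (plug (var 0) (lam u m))"
    and lam_br:
      "mext (\<lambda>z. plug (var 1) (lam z m)) (plug (var 0) (br u v))
       = mext (\<lambda>n. plug (var 0) (lam u n)) (plug (\<lambda>p. var 1 p - var 0 p) (lam v m))
         - mext (\<lambda>n. plug (\<lambda>p. var 1 p - var 0 p) (lam v n)) (plug (var 0) (lam u m))"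


section \<open>Poisson vertex algebras and their modules\<close>

locale poisson_vertex_algebra =
  diff_algebra s del + lca: lie_conformal_algebra s del br
  for s :: "'f::field_char_0 \<Rightarrow> 'v::comm_ring_1 \<Rightarrow> 'v"
    and del :: "'v \<Rightarrow> 'v"
    and br :: "'v \<Rightarrow> 'v \<Rightarrow> 'v poly" +
  assumes br_mult: "br f (g * h) = smult g (br f h) + smult h (br f g)"

locale pva_module =
  poisson_vertex_algebra s del br + M: diff_module s del act D
  for s :: "'f::field_char_0 \<Rightarrow> 'v::comm_ring_1 \<Rightarrow> 'v"
    and del :: "'v \<Rightarrow> 'v"
    and br :: "'v \<Rightarrow> 'v \<Rightarrow> 'v poly"
    and act :: "'v \<Rightarrow> 'm::ab_group_add \<Rightarrow> 'm"
    and D :: "'m \<Rightarrow> 'm" +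
  fixes lam :: "'v \<Rightarrow> 'm \<Rightarrow> 'm poly"
  assumes lam_linear_left: "lin_to_poly s (fscale s act) (\<lambda>f. lam f m)"
    and lam_linear_right: "lin_to_poly (fscale s act) (fscale s act) (\<lambda>m. lam f m)"
    and lam_D_left: "lam (del f) m = - pCons 0 (lam f m)"
    and lam_D_right: "lam f (D m) = map_poly D (lam f m) + pCons 0 (lam f m)"
    and lam_br:
      "mext (\<lambda>n. plug (var 0) (lam f n)) (plug (var 1) (lam g m))
       - mext (\<lambda>n. plug (var 1) (lam g n)) (plug (var 0) (lam f m))
       = mext (\<lambda>z. plug (\<lambda>p. var 0 p + var 1 p) (lam z m)) (plug (var 0) (br f g))"
    and lam_act: "lam f (act g m) = map_poly (\<lambda>h. act h m) (br f g) + map_poly (act g) (lam f m)"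
    and lam_mult:
      "plug (var 0) (lam (f * g) m)
       = shift_act del act 0 [:f:] (plug (var 0) (lam g m))
         + shift_act del act 0 [:g:] (plug (var 0) (lam f m))"


section \<open>Kaehler differentials\<close>

text \<open>
  The free \<open>V\<close>-module on the symbols \<open>df\<close>, \<open>f \<in> V\<close>, is \<open>'v \<Rightarrow>\<^sub>0 'v\<close>, where \<open>single f a\<close> stands for \<open>a df\<close>.
  \<open>\<Omega>(V)\<close> is any \<open>V\<close>-module presented by these generators and the relations \<open>kaehler_rels\<close>.
\<close>

definition kaehler_rels :: "('f \<Rightarrow> 'v \<Rightarrow> 'v) \<Rightarrow> ('v::comm_ring_1 \<Rightarrow>\<^sub>0 'v) set" where
  "kaehler_rels s =
     {Poly_Mapping.single (f + g) 1 - Poly_Mapping.single f 1 - Poly_Mapping.single g 1 | f g. True}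
     \<union> {Poly_Mapping.single (s c f) 1 - Poly_Mapping.single f (s c 1) | c f. True}
     \<union> {Poly_Mapping.single (f * g) 1 - Poly_Mapping.single g f - Poly_Mapping.single f g | f g. True}"

definition free_comb ::
  "('v::comm_ring_1 \<Rightarrow> 'w \<Rightarrow> 'w) \<Rightarrow> ('v \<Rightarrow> 'w) \<Rightarrow> ('v \<Rightarrow>\<^sub>0 'v) \<Rightarrow> 'w::ab_group_add" where
  "free_comb act d x = (\<Sum>f \<in> Poly_Mapping.keys x. act (Poly_Mapping.lookup x f) (d f))"

locale kaehler_differentials = diff_module s del act D
  for s :: "'f::field_char_0 \<Rightarrow> 'v::comm_ring_1 \<Rightarrow> 'v"
    and del :: "'v \<Rightarrow> 'v"
    and act :: "'v \<Rightarrow> 'w::ab_group_add \<Rightarrow> 'w"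
    and D :: "'w \<Rightarrow> 'w" +
  fixes d :: "'v \<Rightarrow> 'w"
  assumes generators: "surj (free_comb act d)"
    and relations: "{x. free_comb act d x = 0}
          = module.span (\<lambda>a. Poly_Mapping.map ((*) a)) (kaehler_rels s)"
    and D_d: "D (act f (d g)) = act (del f) (d g) + act f (d (del g))"


section \<open>Cochains\<close>

text \<open>
  The quotient \<open>M[\<lambda>\<^sub>0, \<dots>, \<lambda>\<^sub>k\<^sub>-\<^sub>1] / \<langle>\<partial> + \<lambda>\<^sub>0 + \<dots> + \<lambda>\<^sub>k\<^sub>-\<^sub>1\<rangle>\<close> is the set of classes of \<open>red_rel D k\<close>;
  cochains take values in these classes, as functions on argument lists of length \<open>k\<close>.
\<close>

definition total_der :: "('m \<Rightarrow> 'm) \<Rightarrow> nat \<Rightarrow> 'm::ab_group_add mpol \<Rightarrow> 'm mpol" where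
  "total_der D k p = Poly_Mapping.map D p + (\<Sum>i<k. var i p)"

definition red_rel :: "('m \<Rightarrow> 'm) \<Rightarrow> nat \<Rightarrow> ('m::ab_group_add mpol \<times> 'm mpol) set" where
  "red_rel D k = {(p, q). p \<in> mpols k \<and> q \<in> mpols k \<and> (\<exists>r \<in> mpols k. p - q = total_der D k r)}"

definition cls :: "('m \<Rightarrow> 'm) \<Rightarrow> nat \<Rightarrow> 'm::ab_group_add mpol \<Rightarrow> 'm mpol set" where
  "cls D k p = red_rel D k `` {p}"

definition rep :: "'a set \<Rightarrow> 'a" where
  "rep X = (SOME p. p \<in> X)"

type_synonym ('u, 'm) cochain = "'u list \<Rightarrow> 'm mpol set"

definition multilinear_maps ::
  "('f \<Rightarrow> 'u \<Rightarrow> 'u) \<Rightarrow> ('f \<Rightarrow> 'm \<Rightarrow> 'm) \<Rightarrow> ('m \<Rightarrow> 'm) \<Rightarrow> nat \<Rightarrow>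
   ('u::ab_group_add, 'm::ab_group_add) cochain set" where
  "multilinear_maps sU sM D k =
     {\<phi> \<in> {us. length us = k} \<rightarrow>\<^sub>E mpols k // red_rel D k.
        \<forall>us i. length us = k \<and> i < k \<longrightarrow>
          (\<forall>x y. \<forall>p \<in> \<phi> (us[i := x]). \<forall>q \<in> \<phi> (us[i := y]). p + q \<in> \<phi> (us[i := x + y])) \<and>
          (\<forall>c x. \<forall>p \<in> \<phi> (us[i := x]). Poly_Mapping.map (sM c) p \<in> \<phi> (us[i := sU c x]))}"

definition alt :: "nat \<Rightarrow> 'a::ab_group_add \<Rightarrow> 'a" where
  "alt n x = (if even n then x else - x)"

definition skew_symmetric :: "nat \<Rightarrow> ('u, 'm::ab_group_add) cochain \<Rightarrow> bool" where
  "skew_symmetric k \<phi> \<longleftrightarrow>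
     (\<forall>\<pi> us. \<pi> permutes {..<k} \<and> length us = k \<longrightarrow>
        (\<forall>p \<in> \<phi> (permute_list \<pi> us).
           (let q = msub (map (\<lambda>i. var (\<pi> i)) [0..<k]) p
            in if evenperm \<pi> then q else - q) \<in> \<phi> us))"

definition lcad_cochains ::
  "('f \<Rightarrow> 'v \<Rightarrow> 'v) \<Rightarrow> ('v \<Rightarrow> 'v) \<Rightarrow> ('v::comm_ring_1 \<Rightarrow> 'e \<Rightarrow> 'e) \<Rightarrow> ('e \<Rightarrow> 'e) \<Rightarrow>
   ('v \<Rightarrow> 'm \<Rightarrow> 'm) \<Rightarrow> ('m \<Rightarrow> 'm) \<Rightarrow> nat \<Rightarrow> ('e::ab_group_add, 'm::ab_group_add) cochain set" where
  "lcad_cochains s del actE DE actM DM k =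
     {\<phi> \<in> multilinear_maps (fscale s actE) (fscale s actM) DM k.
        (\<forall>as us. length as = k \<and> length us = k \<longrightarrow>
           (\<forall>p \<in> \<phi> us. shift_acts del actM (map (pneg del) as) p \<in> \<phi> (map2 (dop actE DE) as us))) \<and>
        skew_symmetric k \<phi>}"

definition pva_cochains ::
  "('f \<Rightarrow> 'v \<Rightarrow> 'v) \<Rightarrow> ('v::comm_ring_1 \<Rightarrow> 'v) \<Rightarrow> ('v \<Rightarrow> 'm \<Rightarrow> 'm) \<Rightarrow> ('m \<Rightarrow> 'm) \<Rightarrow> nat \<Rightarrow>
   ('v, 'm::ab_group_add) cochain set" where
  "pva_cochains s del act D k =
     {\<gamma> \<in> multilinear_maps s (fscale s act) D k.
        (\<forall>us i. length us = k \<and> i < k \<longrightarrow>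
           (\<forall>p \<in> \<gamma> us. - var i p \<in> \<gamma> (us[i := del (us ! i)])) \<and>
           (\<forall>b c. \<forall>p \<in> \<gamma> (us[i := c]). \<forall>q \<in> \<gamma> (us[i := b]).
              shift_act del act i [:b:] p + shift_act del act i [:c:] q \<in> \<gamma> (us[i := b * c]))) \<and>
        skew_symmetric k \<gamma>}"

definition omit :: "nat \<Rightarrow> 'a list \<Rightarrow> 'a list" where
  "omit i xs = take i xs @ drop (Suc i) xs"

text \<open>
  The common formula for both differentials.  It is evaluated on representatives of the values of
  \<open>\<phi>\<close>; the class of the result does not depend on their choice.  With indices starting at \<open>0\<close>
  the signs \<open>(-1)\<^sup>i\<^sup>+\<^sup>1\<close> and \<open>(-1)\<^sup>i\<^sup>+\<^sup>j\<close> become \<open>(-1)\<^sup>i\<close> and \<open>(-1)\<^sup>i\<^sup>+\<^sup>j\<close>.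
\<close>

definition cochain_diff ::
  "('u \<Rightarrow> 'm \<Rightarrow> 'm poly) \<Rightarrow> ('u \<Rightarrow> 'u \<Rightarrow> 'u::ab_group_add poly) \<Rightarrow> ('m \<Rightarrow> 'm) \<Rightarrow> nat \<Rightarrow>
   ('u, 'm::ab_group_add) cochain \<Rightarrow> ('u, 'm) cochain" where
  "cochain_diff lam br D k \<phi> = (\<lambda>us \<in> {us. length us = Suc k}.
     let vs = map var [0..<Suc k] in
     cls D (Suc k)
       ((\<Sum>i<Suc k. alt i
           (mext (\<lambda>m. plug (var i) (lam (us ! i) m))
              (msub (omit i vs) (rep (\<phi> (omit i us))))))
        + (\<Sum>j<Suc k. \<Sum>i<j. alt (i + j)
             (\<Sum>n\<le>degree (br (us ! i) (us ! j)).
                (var i ^^ n)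
                  (msub ((\<lambda>p. var i p + var j p) # omit i (omit j vs))
                     (rep (\<phi> (coeff (br (us ! i) (us ! j)) n # omit i (omit j us)))))))))"

definition cochain_add ::
  "('m \<Rightarrow> 'm) \<Rightarrow> nat \<Rightarrow> ('u, 'm::ab_group_add) cochain \<Rightarrow> ('u, 'm) cochain \<Rightarrow> ('u, 'm) cochain" where
  "cochain_add D k \<phi> \<psi> = (\<lambda>us \<in> {us. length us = k}. cls D k (rep (\<phi> us) + rep (\<psi> us)))"

definition cochain_scale ::
  "('f \<Rightarrow> 'm \<Rightarrow> 'm) \<Rightarrow> ('m \<Rightarrow> 'm) \<Rightarrow> nat \<Rightarrow> 'f \<Rightarrow> ('u, 'm::ab_group_add) cochain \<Rightarrow> ('u, 'm) cochain" where
  "cochain_scale sM D k c \<phi> = (\<lambda>us \<in> {us. length us = k}. cls D k (Poly_Mapping.map (sM c) (rep (\<phi> us))))"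

text \<open>
  Isomorphisms of complexes: linear bijections in each degree commuting with the differentials, the
  latter being required to map cochains to cochains.  The vector space operations on cochains are
  those of the target quotients, computed on representatives.
\<close>

definition complex_iso ::
  "('f \<Rightarrow> 'm \<Rightarrow> 'm) \<Rightarrow> ('m \<Rightarrow> 'm) \<Rightarrow>
   (nat \<Rightarrow> ('u, 'm::ab_group_add) cochain set) \<Rightarrow> (nat \<Rightarrow> ('u, 'm) cochain \<Rightarrow> ('u, 'm) cochain) \<Rightarrow>
   (nat \<Rightarrow> ('w, 'm) cochain set) \<Rightarrow> (nat \<Rightarrow> ('w, 'm) cochain \<Rightarrow> ('w, 'm) cochain) \<Rightarrow>
   (nat \<Rightarrow> ('u, 'm) cochain \<Rightarrow> ('w, 'm) cochain) \<Rightarrow> bool" where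
  "complex_iso sM D A dA B dB \<Phi> \<longleftrightarrow>
     (\<forall>k.
        dA k \<in> A k \<rightarrow> A (Suc k) \<and>
        dB k \<in> B k \<rightarrow> B (Suc k) \<and>
        bij_betw (\<Phi> k) (A k) (B k) \<and>
        (\<forall>\<gamma> \<in> A k. \<forall>\<gamma>' \<in> A k. \<Phi> k (cochain_add D k \<gamma> \<gamma>') = cochain_add D k (\<Phi> k \<gamma>) (\<Phi> k \<gamma>')) \<and>
        (\<forall>c. \<forall>\<gamma> \<in> A k. \<Phi> k (cochain_scale sM D k c \<gamma>) = cochain_scale sM D k c (\<Phi> k \<gamma>)) \<and>
        (\<forall>\<gamma> \<in> A k. \<Phi> (Suc k) (dA k \<gamma>) = dB k (\<Phi> k \<gamma>)))"

end

theory Submission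
  imports Defs
begin

text \<open>
  On the polynomials \<open>M[\<lambda>\<^sub>0, \<lambda>\<^sub>1, \<dots>]\<close> the shifted multiplications
  \<open>p \<mapsto> (|\<^sub>x\<^sub>=\<^sub>\<partial> a) p(\<dots>, \<lambda>\<^sub>i + x, \<dots>)\<close> and \<open>- \<lambda>\<^sub>i\<close> form an action of the differential operators, one for every \<open>i\<close>,
  and these actions commute with each other and with \<open>\<partial> + \<lambda>\<^sub>0 + \<dots> + \<lambda>\<^sub>k\<^sub>-\<^sub>1\<close>.  An LCAd cochain is an alternating
  map which is linear over differential operators in each argument, and a PVA cochain is an alternating map which is a
  derivation commuting with \<open>\<partial>\<close> in each argument.  By the universal property of Kaehler differentials, applied to
  one argument after the other, restriction along \<open>d\<close> is a bijection from the former to the latter; \<open>\<Phi>\<close> is its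
  inverse.  Restriction obviously intertwines the formulas for the two differentials, so the only real computation is that
  the LCAd differential of a cochain is linear over differential operators; since it is alternating, it suffices to
  look at the last argument, where the anchor terms from the action and from the bracket cancel.  That the PVA
  differential maps cochains to cochains then follows by transport of structure.
\<close>

text \<open>Values of cochains are classes, and the formula for the differential picks
  representatives with \<open>rep\<close>, so the axioms of a cochain hold for its representatives
  only modulo the image of \<open>total_der\<close>. The proof therefore works with
  polynomial-valued functions that satisfy the axioms up to the congruence \<open>cg\<close>
  (\<open>good\<close>, \<open>derivations\<close>). This is felt most in the bracket term: it is a
  sum over the coefficients of a bracket, cut off at the degree, whose summand at the coefficient 0
  is congruent to 0 without being 0, so that even changing the cutoff is a congruence. The summands
  live in different quotients before they are added. Substituting \<open>Ls\<close> for the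
  variables turns \<open>total_der\<close> into \<open>QL Ls\<close>. In a bracket term the
  substituends again add up to all variables; in an action term sesquilinearity supplies the missing
  variable. Arguments are carried in pairs with their variables, so that permuting arguments and
  variables together is one permutation of a list, and alternation can be checked on adjacent
  swaps.\<close>

abbreviation (input) "single \<equiv> Poly_Mapping.single"
abbreviation (input) "lookup \<equiv> Poly_Mapping.lookup"
abbreviation (input) "keys \<equiv> Poly_Mapping.keys"

section \<open>Additive maps and sums over coefficients\<close>

lemma additive_comp: "additive f \<Longrightarrow> additive g \<Longrightarrow> additive (\<lambda>x. f (g x))"
  by (simp add: additive_def)

lemma additive_plus: "additive f \<Longrightarrow> additive g \<Longrightarrow> additive (\<lambda>x. f x + g x)"
  by (simp add: additive_def algebra_simps)

lemma additive_minus: "additive f \<Longrightarrow> additive g \<Longrightarrow> additive (\<lambda>x. f x - g x)"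
  by (simp add: additive_def algebra_simps)

lemma additive_uminus: "additive f \<Longrightarrow> additive (\<lambda>x. - f x)"
  by (simp add: additive_def)

lemma additive_id: "additive (\<lambda>x. x)"
  by (simp add: additive_def)

lemma additive_0: "additive (\<lambda>x. 0)"
  by (simp add: additive_def)

lemma additive_sum: "(\<And>i. i \<in> I \<Longrightarrow> additive (f i)) \<Longrightarrow> additive (\<lambda>x. \<Sum>i\<in>I. f i x)"
  by (simp add: additive_def sum.distrib)

lemma additive_funpow: "additive (f :: 'a \<Rightarrow> 'a::ab_group_add) \<Longrightarrow> additive (f ^^ n)"
  by (induction n) (auto simp: additive_def)

lemma additive_single: "additive (single m)"
  by (simp add: additive_def single_add)

lemma additive_map_poly_mapping:
  fixes f :: "'b::ab_group_add \<Rightarrow> 'c::ab_group_add"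
  assumes "additive f"
  shows "additive (Poly_Mapping.map f :: ('a \<Rightarrow>\<^sub>0 'b) \<Rightarrow> _)"
proof
  fix p q :: "'a \<Rightarrow>\<^sub>0 'b"
  have "lookup (Poly_Mapping.map f r) m = f (lookup r m)" for r and m :: 'a
    by (simp add: Poly_Mapping.map.rep_eq when_def additive.zero[OF assms])
  then show "Poly_Mapping.map f (p + q) = Poly_Mapping.map f p + Poly_Mapping.map f q"
    by (intro poly_mapping_eqI) (simp add: additive.add[OF assms] lookup_add)
qed

lemma additive_map_poly: "additive f \<Longrightarrow> additive (map_poly f)"
  by (simp add: additive_def poly_eq_iff coeff_map_poly additive.zero additive.add)

text \<open>Common shape of \<open>mon_mult\<close>, \<open>mext\<close>, \<open>msub\<close>,
  \<open>shift_act\<close> and \<open>free_comb\<close>. All of them sum over \<open>keys p\<close>,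
  a set that is not additive in \<open>p\<close>; additivity is proved once, for this shape.\<close>

definition lsum :: "('k \<Rightarrow> 'a \<Rightarrow> 'b) \<Rightarrow> ('k \<Rightarrow>\<^sub>0 'a::zero) \<Rightarrow> 'b::comm_monoid_add" where
  "lsum F p = (\<Sum>m\<in>keys p. F m (lookup p m))"

lemma lsum_superset:
  assumes "\<And>m. F m 0 = 0" "finite A" "keys p \<subseteq> A"
  shows "lsum F p = (\<Sum>m\<in>A. F m (lookup p m))"
  unfolding lsum_def using assms by (intro sum.mono_neutral_left) (auto simp: in_keys_iff)

text \<open>Both key sets are enlarged to their union; an additive \<open>F m\<close> vanishes at 0,
  so the added keys contribute nothing.\<close>

lemma additive_lsum:
  fixes F :: "'k \<Rightarrow> 'a::ab_group_add \<Rightarrow> 'b::ab_group_add"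
  assumes "\<And>m. additive (F m)"
  shows "additive (lsum F)"
proof
  fix p q :: "'k \<Rightarrow>\<^sub>0 'a"
  let ?A = "keys p \<union> keys q"
  have 0: "F m 0 = 0" for m
    using assms by (rule additive.zero)
  have "lsum F (p + q) = (\<Sum>m\<in>?A. F m (lookup (p + q) m))"
    using keys_add[of p q] by (intro lsum_superset) (auto simp: 0)
  also have "\<dots> = (\<Sum>m\<in>?A. F m (lookup p m)) + (\<Sum>m\<in>?A. F m (lookup q m))"
    by (simp add: lookup_add additive.add[OF assms] sum.distrib)
  also have "\<dots> = lsum F p + lsum F q"
    using lsum_superset[of F ?A p, OF 0] lsum_superset[of F ?A q, OF 0] by simp
  finally show "lsum F (p + q) = lsum F p + lsum F q" .
qed

lemma lsum_single: "F m 0 = 0 \<Longrightarrow> lsum F (single m a) = F m a"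
  by (simp add: lsum_def)

lemma poly_mapping_sum_single:
  fixes p :: "'k \<Rightarrow>\<^sub>0 'a::comm_monoid_add"
  shows "(\<Sum>m\<in>keys p. single m (lookup p m)) = p"
  by (rule poly_mapping_eqI)
    (simp add: lookup_sum lookup_single when_def in_keys_iff sum.delta')

lemma poly_mapping_additive_induct [case_names single add]:
  fixes p :: "'k \<Rightarrow>\<^sub>0 'a::comm_monoid_add"
  assumes "\<And>m a. P (single m a)" "\<And>p q. P p \<Longrightarrow> P q \<Longrightarrow> P (p + q)"
  shows "P p"
proof -
  have "P (\<Sum>m\<in>A. single m (lookup p m))" if "finite A" for A
    using that by induction (use assms(1)[of _ 0] in \<open>auto intro: assms\<close>)
  from this[of "keys p"] show ?thesis
    by (simp add: poly_mapping_sum_single)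
qed

lemma additive_eq_singles:
  assumes "additive f" "additive g"
    and "\<And>m a. f (single m a) = g (single m a)"
  shows "f p = g p"
  by (induction p rule: poly_mapping_additive_induct) (simp_all add: assms additive.add)

section \<open>Polynomials in several variables\<close>

lemma mon_mult_lsum: "mon_mult n = lsum (\<lambda>m. single (n + m))"
  by (simp add: fun_eq_iff mon_mult_def lsum_def)

lemma additive_mon_mult: "additive (mon_mult n)"
  unfolding mon_mult_lsum by (intro additive_lsum additive_single)

lemma mon_mult_single [simp]:
  "mon_mult n (single m a) = single (n + m) a"
  by (simp add: mon_mult_lsum lsum_single)

lemma additive_var: "additive (var i)"
  unfolding var_def by (rule additive_mon_mult)

lemmas var_add = additive.add[OF additive_var]
lemmas var_zero [simp] = additive.zero[OF additive_var]
lemmas var_uminus = additive.minus[OF additive_var]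
lemmas var_diff = additive.diff[OF additive_var]
lemmas var_sum = additive.sum[OF additive_var]

lemma var_single [simp]:
  "var i (single m a) = single (single i 1 + m) a"
  by (simp add: var_def)

lemma var_mon_mult: "mon_mult n (var i p) = var i (mon_mult n p)"
  by (rule additive_eq_singles[of "\<lambda>p. mon_mult n (var i p)" "\<lambda>p. var i (mon_mult n p)"])
    (simp_all add: additive_comp[OF additive_mon_mult] additive_comp[OF additive_var] additive_mon_mult additive_var ac_simps)

lemma var_commute: "var i (var j p) = var j (var i p)"
  unfolding var_def[of j] by (simp add: var_mon_mult)

lemma var_power_single:
  "(var i ^^ n) (single m a) = single (single i n + m) a"
  by (induction n) (simp_all add: single_add[symmetric] flip: add.assoc)

text \<open>Induction on the total degree. The set \<open>I\<close> bounds the variables, so that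
  arbitrary polynomials and those in finitely many variables are served by one rule.\<close>

lemma single_monomial_induct [case_names const var]:
  assumes "P (single 0 a)"
    and "\<And>i m. keys m \<subseteq> I \<Longrightarrow> i \<in> I \<Longrightarrow> P (single m a) \<Longrightarrow> P (var i (single m a))"
    and "keys m \<subseteq> I"
  shows "P (single m a)"
proof -
  define n where "n = (\<Sum>i\<in>keys m. lookup m i)"
  then show ?thesis
    using assms(3)
  proof (induction n arbitrary: m)
    case 0
    then have "m = 0"
      by (intro poly_mapping_eqI) (auto simp: in_keys_iff)
    then show ?case using assms(1) by simp
  next
    case (Suc n)
    then have "\<exists>i. i \<in> keys m"
      by (metis all_not_in_conv nat.distinct(1) sum.empty)
    then obtain i where i: "i \<in> keys m" ..
    define m' where "m' = m - single i 1"
    have lookup_m': "lookup m' j = lookup m j - (if j = i then 1 else 0)" for j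
      by (simp add: m'_def lookup_minus lookup_single when_def)
    have m: "m = single i 1 + m'"
      using i by (intro poly_mapping_eqI) (auto simp: lookup_add lookup_single when_def lookup_m' in_keys_iff)
    have keys: "keys m' \<subseteq> keys m"
      by (auto simp: in_keys_iff lookup_m')
    have "(\<Sum>j\<in>keys m'. lookup m' j) = (\<Sum>j\<in>keys m. lookup m' j)"
      using keys by (intro sum.mono_neutral_left) (auto simp: in_keys_iff)
    also have "\<dots> = (\<Sum>j\<in>keys m. lookup m j) - 1"
    proof -
      have "lookup m i \<noteq> 0" using i by (simp add: in_keys_iff)
      then show ?thesis
        using i by (simp add: sum.remove[of _ i, OF _ i] lookup_m')
    qed
    finally have "P (single m' a)"
      using Suc.prems keys by (intro Suc.IH) auto
    then have "P (var i (single m' a))"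
      using i keys Suc.prems by (intro assms(2)) auto
    then show ?case by (simp add: m)
  qed
qed

text \<open>An additive operator is determined by its values on constants and its commutation rule
  with each \<open>var i\<close>, so most later identities avoid exponent vectors.\<close>

lemma mpol_induct [case_names const var add]:
  fixes p :: "'m::ab_group_add mpol"
  assumes "\<And>a. P (single 0 a)"
    and "\<And>i p. P p \<Longrightarrow> P (var i p)"
    and "\<And>p q. P p \<Longrightarrow> P q \<Longrightarrow> P (p + q)"
  shows "P p"
proof (induction p rule: poly_mapping_additive_induct)
  case (single m a)
  show ?case
    by (rule single_monomial_induct[where I = UNIV]) (simp_all add: assms del: var_single)
qed (rule assms)

lemma mpols_zero [simp]: "0 \<in> mpols k"
  by (simp add: mpols_def)

lemma mpols_add: "p \<in> mpols k \<Longrightarrow> q \<in> mpols k \<Longrightarrow> p + q \<in> mpols k"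
  unfolding mpols_def using keys_add[of p q] by blast

lemma mpols_uminus: "p \<in> mpols k \<Longrightarrow> - p \<in> mpols k"
  by (simp add: mpols_def in_keys_iff)

lemma mpols_diff: "p \<in> mpols k \<Longrightarrow> q \<in> mpols k \<Longrightarrow> p - q \<in> mpols k"
  using mpols_add[of p k "- q"] by (simp add: mpols_uminus)

lemma mpols_sum: "(\<And>i. i \<in> I \<Longrightarrow> f i \<in> mpols k) \<Longrightarrow> sum f I \<in> mpols k"
  by (induction I rule: infinite_finite_induct) (simp_all add: mpols_add)

lemma mpols_const: "single 0 a \<in> mpols k"
  by (simp add: mpols_def)

lemma mpols_single: "keys m \<subseteq> {..<k} \<Longrightarrow> single m a \<in> mpols k"
  by (simp add: mpols_def)

text \<open>The bound \<open>i < k\<close> in the variable case is what \<open>msub_var\<close>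
  requires, since \<open>msub\<close> only knows the variables below the length of its list.\<close>

lemma mpols_induct [consumes 1, case_names const var add]:
  fixes p :: "'m::ab_group_add mpol"
  assumes "p \<in> mpols k"
    and "\<And>a. P (single 0 a)"
    and "\<And>i p. i < k \<Longrightarrow> p \<in> mpols k \<Longrightarrow> P p \<Longrightarrow> P (var i p)"
    and "\<And>p q. p \<in> mpols k \<Longrightarrow> q \<in> mpols k \<Longrightarrow> P p \<Longrightarrow> P q \<Longrightarrow> P (p + q)"
  shows "P p"
proof -
  have single: "P (single m a)" if "keys m \<subseteq> {..<k}" for m a
    using that
  proof (rule single_monomial_induct[where I = "{..<k}", rotated 2])
    show "P (single 0 a)" by (rule assms(2))
  next
    fix i :: nat and m :: "nat \<Rightarrow>\<^sub>0 nat"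
    assume "keys m \<subseteq> {..<k}" "i \<in> {..<k}" "P (single m a)"
    then show "P (var i (single m a))"
      by (intro assms(3)) (auto intro: mpols_single)
  qed
  have "P (\<Sum>m\<in>A. single m (lookup p m))"
    if "finite A" "A \<subseteq> keys p" for A
    using that
  proof induction
    case empty
    then show ?case using assms(2)[of 0] by simp
  next
    case (insert m A)
    then have "keys m \<subseteq> {..<k}" "\<forall>m\<in>A. keys m \<subseteq> {..<k}"
      using assms(1) by (auto simp: mpols_def)
    then show ?case
      using insert by (auto intro!: assms(4) mpols_single mpols_sum single)
  qed
  from this[of "keys p"] show ?thesis
    by (simp add: poly_mapping_sum_single)
qed

lemma mpols_var: "p \<in> mpols k \<Longrightarrow> i < k \<Longrightarrow> var i p \<in> mpols k"
proof -
  assume p: "p \<in> mpols k" and i: "i < k"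
  show ?thesis
    unfolding var_def mon_mult_def
  proof (intro mpols_sum mpols_single)
    fix m assume "m \<in> keys p"
    with p have "keys m \<subseteq> {..<k}" by (auto simp: mpols_def)
    then show "keys (single i 1 + m) \<subseteq> {..<k}"
      using keys_add[of "single i 1" m] i by auto
  qed
qed

subsection \<open>Polynomial combinations\<close>

text \<open>\<open>v\<close> stands for multiplication by the substituted variable, \<open>H\<close>
  for the value at a coefficient. This covers \<open>plug\<close>, \<open>pneg\<close>,
  \<open>shift_act\<close> and the bracket sum of the differential. \<open>H\<close> is arbitrary
  because in the bracket sum it is additive only up to congruence.\<close>

definition psum :: "('b \<Rightarrow> 'b) \<Rightarrow> ('a \<Rightarrow> 'b) \<Rightarrow> 'a::zero poly \<Rightarrow> 'b::comm_monoid_add" where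
  "psum v H P = (\<Sum>n\<le>degree P. (v ^^ n) (H (coeff P n)))"

lemma plug_psum: "plug L = psum L (single 0)"
  by (simp add: fun_eq_iff plug_def psum_def)

lemma pneg_psum: "pneg D = psum (\<lambda>Q. - pCons 0 Q - map_poly D Q) (\<lambda>c. [:c:])"
  by (simp add: fun_eq_iff pneg_def psum_def)

lemma psum_const [simp]: "psum v H [:a:] = H a"
  by (simp add: psum_def)

lemma psum_zero [simp]: "psum v H 0 = H 0"
  by (simp add: psum_def)

text \<open>Horner's scheme. The condition on \<open>H 0\<close> concerns \<open>P = 0\<close>,
  where the sum still has its term of degree 0.\<close>

lemma psum_pCons:
  assumes "additive v" "H 0 = 0"
  shows "psum v H (pCons a P) = H a + v (psum v H P)"
proof (cases "P = 0")
  case True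
  then show ?thesis by (simp add: assms additive.zero[OF assms(1)])
next
  case False
  then show ?thesis
    unfolding psum_def
    by (subst degree_pCons_eq, simp, subst sum.atMost_Suc_shift)
      (simp add: additive.sum[OF assms(1)])
qed

lemma psum_bound:
  assumes "additive v" "H 0 = 0" "degree P \<le> N"
  shows "psum v H P = (\<Sum>n\<le>N. (v ^^ n) (H (coeff P n)))"
  unfolding psum_def using assms additive.zero[OF additive_funpow[OF assms(1)]]
  by (intro sum.mono_neutral_left) (auto simp: coeff_eq_0)

lemma additive_psum:
  fixes H :: "'a::ab_group_add \<Rightarrow> 'b::ab_group_add"
  assumes "additive v" "additive H"
  shows "additive (psum v H)"
proof
  fix P Q :: "'a poly"
  have H0: "H 0 = 0" using assms(2) by (rule additive.zero)
  let ?N = "max (degree P) (degree Q)"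
  have "psum v H (P + Q) = (\<Sum>n\<le>?N. (v ^^ n) (H (coeff (P + Q) n)))"
    using degree_add_le_max[of P Q] by (intro psum_bound assms H0)
  then show "psum v H (P + Q) = psum v H P + psum v H Q"
    by (simp add: psum_bound[OF assms(1), of H P ?N] psum_bound[OF assms(1), of H Q ?N] H0
        additive.add[OF assms(2)] additive.add[OF additive_funpow[OF assms(1)]] sum.distrib)
qed

lemma pneg_pCons:
  assumes "additive D"
  shows "pneg D (pCons a b) = [:a:] + (- pCons 0 (pneg D b) - map_poly D (pneg D b))"
  unfolding pneg_psum
  by (rule psum_pCons) (simp_all add: additive_def additive.add[OF additive_map_poly[OF assms]])

lemma additive_plug: "additive L \<Longrightarrow> additive (plug L)"
  unfolding plug_psum by (intro additive_psum additive_single)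

lemma plug_pCons: "additive L \<Longrightarrow> plug L (pCons a P) = single 0 a + L (plug L P)"
  unfolding plug_psum by (rule psum_pCons) simp_all

lemma plug_zero [simp]: "plug L 0 = 0"
  by (simp add: plug_psum)

lemma lookup_plug_var: "lookup (plug (var i) P) (single i n) = coeff P n"
proof -
  have "lookup (plug (var i) P) (single i n)
      = (\<Sum>k\<le>degree P. (coeff P k when single i k = single i n))"
    by (simp add: plug_def var_power_single lookup_sum lookup_single)
  also have "\<dots> = (\<Sum>k\<le>degree P. if k = n then coeff P k else 0)"
    by (intro sum.cong refl) (auto simp: when_def dest: arg_cong[where f = "\<lambda>m. lookup m i"])
  finally show ?thesis by (auto simp: coeff_eq_0)
qed

text \<open>Brings identities stated after plugging in a variable back to one-variable polynomials;
  the coefficients are read off at the powers of \<open>var i\<close>.\<close>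

lemma plug_var_inject: "plug (var i) P = plug (var i) Q \<Longrightarrow> P = Q"
  by (metis lookup_plug_var poly_eqI)

lemma mpols_funpow_var: "p \<in> mpols k \<Longrightarrow> i < k \<Longrightarrow> (var i ^^ n) p \<in> mpols k"
  by (induction n) (simp_all add: mpols_var)

lemma mpols_plug_var: "i < k \<Longrightarrow> plug (var i) P \<in> mpols k"
  unfolding plug_def by (intro mpols_sum mpols_funpow_var mpols_const)

lemma mext_lsum: "mext f = lsum (\<lambda>m c. mon_mult m (f c))"
  by (simp add: fun_eq_iff mext_def lsum_def)

lemma additive_mext: "additive f \<Longrightarrow> additive (mext f)"
  unfolding mext_lsum by (intro additive_lsum additive_comp[OF additive_mon_mult])

lemma mext_single:
  "additive f \<Longrightarrow> mext f (single m a) = mon_mult m (f a)"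
  unfolding mext_lsum by (simp add: lsum_single additive.zero additive.zero[OF additive_mon_mult])

lemma mon_mult_0 [simp]: "mon_mult 0 p = p"
  by (simp add: mon_mult_def poly_mapping_sum_single)

lemma mext_const: "additive f \<Longrightarrow> mext f (single 0 a) = f a"
  by (simp add: mext_single)

lemma mon_mult_mon_mult: "mon_mult n (mon_mult m p) = mon_mult (n + m) p"
  by (rule additive_eq_singles[of "\<lambda>p. mon_mult n (mon_mult m p)" "\<lambda>p. mon_mult (n + m) p"])
    (simp_all add: additive_comp[OF additive_mon_mult] additive_mon_mult ac_simps)

lemma mext_var: "additive f \<Longrightarrow> mext f (var i p) = var i (mext f p)"
  by (rule additive_eq_singles[of "\<lambda>p. mext f (var i p)" "\<lambda>p. var i (mext f p)"])
    (simp_all add: additive_comp[OF additive_mext] additive_comp[OF additive_mon_mult] additive_mext additive_mon_mult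
      mext_single var_def mon_mult_mon_mult)

lemma mpols_mext:
  assumes "p \<in> mpols k" "additive f" "\<And>a. f a \<in> mpols k"
  shows "mext f p \<in> mpols k"
  using assms(1)
  by (induction rule: mpols_induct)
    (simp_all add: assms mext_const mext_var mpols_var mpols_add additive.add[OF additive_mext])

subsection \<open>Coefficientwise operators\<close>

lemma map_var:
  assumes "additive f"
  shows "Poly_Mapping.map f (var i p) = var i (Poly_Mapping.map f p)"
  by (rule additive_eq_singles[of "\<lambda>p. Poly_Mapping.map f (var i p)" "\<lambda>p. var i (Poly_Mapping.map f p)"])
    (simp_all add: additive_comp[OF additive_map_poly_mapping] additive_comp[OF additive_var]
      additive_map_poly_mapping additive_var assms map_single additive.zero[OF assms])

subsection \<open>Linear substitutions\<close>

text \<open>The substituends in the differential are \<open>var i\<close> and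
  \<open>var i + var j\<close>. Sums of variables commute with each other and with additive
  coefficientwise operators, which makes \<open>msub\<close> multiplicative and compatible with
  \<open>total_der\<close>.\<close>

inductive_set lin :: "('m::ab_group_add mpol \<Rightarrow> 'm mpol) set" where
  lin_var: "var i \<in> lin"
| lin_add: "L \<in> lin \<Longrightarrow> L' \<in> lin \<Longrightarrow> (\<lambda>p. L p + L' p) \<in> lin"

lemma additive_lin: "L \<in> lin \<Longrightarrow> additive L"
  by (induction rule: lin.induct) (auto intro: additive_var additive_plus)

lemma lin_commute_var: "L \<in> lin \<Longrightarrow> L (var i p) = var i (L p)"
  by (induction rule: lin.induct) (auto simp: var_commute var_add)

lemma lin_commute: "L \<in> lin \<Longrightarrow> L' \<in> lin \<Longrightarrow> L (L' p) = L' (L p)"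
  by (induction rule: lin.induct) (auto simp: lin_commute_var additive.add[OF additive_lin])

lemma lin_commute_map: "L \<in> lin \<Longrightarrow> additive f \<Longrightarrow> L (Poly_Mapping.map f p) = Poly_Mapping.map f (L p)"
  by (induction rule: lin.induct) (auto simp: map_var additive.add[OF additive_map_poly_mapping])

lemma image_var_lin [simp]: "var ` A \<subseteq> lin" "(\<lambda>x. var (f x)) ` B \<subseteq> lin"
  by (auto intro: lin_var)

definition msub_mon :: "('m mpol \<Rightarrow> 'm mpol) list \<Rightarrow> (nat \<Rightarrow>\<^sub>0 nat) \<Rightarrow> 'm mpol \<Rightarrow> 'm::ab_group_add mpol" where
  "msub_mon Ls m = fold (\<lambda>i. (Ls ! i) ^^ lookup m i) [0..<length Ls]"

lemma msub_lsum: "msub Ls = lsum (\<lambda>m c. msub_mon Ls m (single 0 c))"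
  by (simp add: fun_eq_iff msub_def lsum_def msub_mon_def)

lemma additive_fold: "(\<And>i. i \<in> set xs \<Longrightarrow> additive (A i)) \<Longrightarrow> additive (fold A xs)"
proof (induction xs)
  case (Cons i xs)
  then have "additive (\<lambda>p. fold A xs (A i p))"
    by (intro additive_comp[of "fold A xs" "A i"]) auto
  then show ?case by (simp add: comp_def)
qed (simp add: id_def additive_id)

lemma additive_msub_mon: "set Ls \<subseteq> lin \<Longrightarrow> additive (msub_mon Ls m)"
  unfolding msub_mon_def by (intro additive_fold additive_funpow additive_lin) (auto simp: subset_iff)

lemma additive_msub: "set Ls \<subseteq> lin \<Longrightarrow> additive (msub Ls)"
  unfolding msub_lsum by (intro additive_lsum additive_comp[OF additive_msub_mon] additive_single)

lemma msub_single: "set Ls \<subseteq> lin \<Longrightarrow>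
    msub Ls (single m a) = msub_mon Ls m (single 0 a)"
  by (simp add: msub_lsum lsum_single additive.zero[OF additive_msub_mon])

lemma funpow_commute:
  assumes "\<And>p. f (g p) = g (f p)"
  shows "f ((g ^^ n) p) = (g ^^ n) (f p)"
  by (induction n arbitrary: p) (simp_all add: assms)

lemma fold_commute_op:
  assumes "\<And>i p. i \<in> set xs \<Longrightarrow> f (A i p) = A i (f p)"
  shows "f (fold A xs p) = fold A xs (f p)"
  using assms by (induction xs arbitrary: p) simp_all

lemma msub_mon_commute:
  assumes "\<And>L p. L \<in> set Ls \<Longrightarrow> f (L p) = L (f p)"
  shows "f (msub_mon Ls m p) = msub_mon Ls m (f p)"
  unfolding msub_mon_def by (intro fold_commute_op funpow_commute assms) auto

lemma msub_mon_0 [simp]: "msub_mon Ls 0 p = p"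
proof -
  have "fold (\<lambda>i. (Ls ! i) ^^ 0) xs p = p" for xs
    by (induction xs) simp_all
  then show ?thesis by (simp add: msub_mon_def)
qed

text \<open>The operators in the list commute, so an extra factor can be pulled out of the product
  from the place of its index; distinctness of the indices ensures that it is pulled out
  once.\<close>

lemma msub_mon_Suc:
  assumes "set Ls \<subseteq> lin" "i < length Ls"
  shows "msub_mon Ls (single i 1 + m) p = (Ls ! i) (msub_mon Ls m p)"
proof -
  define e where "e = lookup m"
  have "fold (\<lambda>j. (Ls ! j) ^^ (if j = i then Suc (e j) else e j)) xs p
      = (if i \<in> set xs then (Ls ! i) (fold (\<lambda>j. (Ls ! j) ^^ e j) xs p) else fold (\<lambda>j. (Ls ! j) ^^ e j) xs p)"
    if "distinct xs" "set xs \<subseteq> {..<length Ls}" for xs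
    using that
  proof (induction xs arbitrary: p)
    case (Cons j xs)
    have comm: "(Ls ! i) (fold (\<lambda>j. (Ls ! j) ^^ e j) xs q) = fold (\<lambda>j. (Ls ! j) ^^ e j) xs ((Ls ! i) q)" for q
      using Cons.prems assms by (intro fold_commute_op funpow_commute lin_commute) (auto simp: subset_iff)
    show ?case
      using Cons by (auto simp: comm)
  qed simp
  moreover have "lookup (single i 1 + m) j = (if j = i then Suc (e j) else e j)" for j
    by (simp add: e_def lookup_add lookup_single when_def)
  ultimately show ?thesis
    using assms by (simp add: msub_mon_def atLeast0LessThan del: funpow.simps flip: e_def)
qed

lemma msub_const [simp]: "set Ls \<subseteq> lin \<Longrightarrow> msub Ls (single 0 a) = single 0 a"
  by (simp add: msub_single)

lemma msub_var:
  assumes "set Ls \<subseteq> lin" "i < length Ls"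
  shows "msub Ls (var i p) = (Ls ! i) (msub Ls p)"
proof (rule additive_eq_singles[of "\<lambda>p. msub Ls (var i p)" "\<lambda>p. (Ls ! i) (msub Ls p)"])
  show "additive (\<lambda>p. (Ls ! i) (msub Ls p))"
    using assms by (intro additive_comp[OF additive_lin additive_msub]) auto
qed (simp_all add: additive_comp[OF additive_msub] additive_var assms msub_single msub_mon_Suc[simplified])

lemma msub_map:
  assumes "set Ls \<subseteq> lin" "additive f"
  shows "msub Ls (Poly_Mapping.map f p) = Poly_Mapping.map f (msub Ls p)"
proof (rule additive_eq_singles[of "\<lambda>p. msub Ls (Poly_Mapping.map f p)" "\<lambda>p. Poly_Mapping.map f (msub Ls p)"])
  fix m a
  have f0: "f 0 = 0" using assms(2) by (rule additive.zero)
  have "Poly_Mapping.map f (msub_mon Ls m (single 0 a))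
      = msub_mon Ls m (Poly_Mapping.map f (single 0 a))"
    using assms by (intro msub_mon_commute) (auto simp: lin_commute_map)
  then show "msub Ls (Poly_Mapping.map f (single m a)) = Poly_Mapping.map f (msub Ls (single m a))"
    by (simp add: msub_single assms map_single f0)
qed (simp_all add: additive_comp[OF additive_msub] additive_comp[OF additive_map_poly_mapping]
    additive_map_poly_mapping additive_msub assms)

text \<open>Holds for every \<open>p\<close>, because \<open>msub\<close> reads only the exponents
  with index below \<open>length Ls\<close>. In particular \<open>msub\<close> can truncate a
  polynomial into \<open>mpols k\<close>.\<close>

lemma mpols_msub_all:
  assumes "set Ls \<subseteq> lin" "\<And>L p. L \<in> set Ls \<Longrightarrow> p \<in> mpols k \<Longrightarrow> L p \<in> mpols k"
  shows "msub Ls p \<in> mpols k"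
proof (induction p rule: poly_mapping_additive_induct)
  case (single m a)
  have pow: "((Ls ! i) ^^ n) p \<in> mpols k" if "i < length Ls" "p \<in> mpols k" for i n p
    using that by (induction n) (simp_all add: assms)
  have "fold (\<lambda>i. (Ls ! i) ^^ lookup m i) xs p \<in> mpols k"
    if "set xs \<subseteq> {..<length Ls}" "p \<in> mpols k" for xs p
    using that by (induction xs arbitrary: p) (simp_all add: pow)
  then show ?case
    by (simp add: msub_single assms msub_mon_def mpols_const atLeast0LessThan)
next
  case (add p q)
  then show ?case by (simp add: additive.add[OF additive_msub[OF assms(1)]] mpols_add)
qed

lemma msub_id:
  assumes "p \<in> mpols k"
  shows "msub (map var [0..<k]) p = p"
  using assms
proof (induction rule: mpols_induct)
  case (var i p)
  then show ?case by (subst msub_var) (auto intro: lin_var)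
qed (simp_all add: additive.add[OF additive_msub])

text \<open>Both sides are additive in \<open>p\<close> and agree on constants; \<open>eq\<close> is
  the compatibility that carries the agreement past a variable.\<close>

lemma msub_comp:
  assumes p: "p \<in> mpols (length Ls)" and lin: "set Ls \<subseteq> lin" "set Ls' \<subseteq> lin" "set Rs \<subseteq> lin"
    and len: "length Ls' = length Ls"
    and eq: "\<And>l q. l < length Ls \<Longrightarrow> msub Rs ((Ls ! l) q) = (Ls' ! l) (msub Rs q)"
  shows "msub Rs (msub Ls p) = msub Ls' p"
  using p
  by (induction rule: mpols_induct)
    (simp_all add: lin len eq msub_var additive.add[OF additive_msub])

lemma msub_msub:
  assumes "p \<in> mpols k" "length Ls = k" "set Ls \<subseteq> lin" "f ` {..<k} \<subseteq> {..<k}"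
  shows "msub Ls (msub (map (\<lambda>i. var (f i)) [0..<k]) p) = msub (map (\<lambda>i. Ls ! f i) [0..<k]) p"
  using assms by (intro msub_comp) (auto simp: msub_var image_subset_iff intro: lin_var)

section \<open>Congruence modulo the image of an operator\<close>

text \<open>The witness \<open>r\<close> ranges over all arguments of \<open>Q\<close>, without a
  bound on variables, which makes transport by operators immediate. \<open>red_rel_iff\<close> shows
  that on \<open>mpols k\<close> the relation is the one used for cochains.\<close>

definition cg :: "('a \<Rightarrow> 'b) \<Rightarrow> 'b \<Rightarrow> 'b::ab_group_add \<Rightarrow> bool" where
  "cg Q p q \<longleftrightarrow> (\<exists>r. p - q = Q r)"

lemma cg_refl [simp]: "additive Q \<Longrightarrow> cg Q p p"
  by (metis additive.zero cg_def diff_self)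

lemma cg_sym: "additive Q \<Longrightarrow> cg Q p q \<Longrightarrow> cg Q q p"
  unfolding cg_def
proof (elim exE)
  fix r assume "additive Q" "p - q = Q r"
  then have "q - p = Q (- r)"
    by (simp add: additive.minus) (metis minus_diff_eq)
  then show "\<exists>r. q - p = Q r" ..
qed

lemma cg_trans: "additive Q \<Longrightarrow> cg Q p q \<Longrightarrow> cg Q q t \<Longrightarrow> cg Q p t"
  unfolding cg_def
proof (elim exE)
  fix r r' assume "additive Q" "p - q = Q r" "q - t = Q r'"
  then have "p - t = Q (r + r')"
    by (simp add: additive.add flip: \<open>p - q = Q r\<close> \<open>q - t = Q r'\<close>)
  then show "\<exists>r. p - t = Q r" ..
qed

lemma cg_add: "additive Q \<Longrightarrow> cg Q p q \<Longrightarrow> cg Q p' q' \<Longrightarrow> cg Q (p + p') (q + q')"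
  unfolding cg_def
proof (elim exE)
  fix r r' assume "additive Q" "p - q = Q r" "p' - q' = Q r'"
  then have "(p + p') - (q + q') = Q (r + r')"
    by (simp add: additive.add flip: \<open>p - q = Q r\<close> \<open>p' - q' = Q r'\<close>)
  then show "\<exists>r. (p + p') - (q + q') = Q r" ..
qed

lemma cg_uminus: "additive Q \<Longrightarrow> cg Q p q \<Longrightarrow> cg Q (- p) (- q)"
  unfolding cg_def
proof (elim exE)
  fix r assume "additive Q" "p - q = Q r"
  then have "- p - - q = Q (- r)"
    by (simp add: additive.minus flip: \<open>p - q = Q r\<close>)
  then show "\<exists>r. - p - - q = Q r" ..
qed

lemma cg_diff: "additive Q \<Longrightarrow> cg Q p q \<Longrightarrow> cg Q p' q' \<Longrightarrow> cg Q (p - p') (q - q')"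
  using cg_add[of Q p q "- p'" "- q'"] cg_uminus[of Q p' q'] by simp

lemma cg_sum: "additive Q \<Longrightarrow> (\<And>i. i \<in> I \<Longrightarrow> cg Q (f i) (g i)) \<Longrightarrow> cg Q (sum f I) (sum g I)"
  by (induction I rule: infinite_finite_induct) (simp_all add: cg_add)

text \<open>An operator that intertwines two quotient operators descends to the quotients.
  Congruences are moved through \<open>var\<close>, \<open>S\<close>, \<open>msub\<close> and
  \<open>Lop\<close> in this way.\<close>

lemma cg_apply: "additive X \<Longrightarrow> (\<And>r. X (Q r) = Q' (X r)) \<Longrightarrow> cg Q p q \<Longrightarrow> cg Q' (X p) (X q)"
  unfolding cg_def by (metis additive.diff)

lemma additive_alt: "additive (alt n)"
  by (simp add: additive_def alt_def)

lemma alt_Suc: "alt (Suc n) x = - alt n x"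
  by (simp add: alt_def)

lemma alt_0 [simp]: "alt 0 x = x"
  by (simp add: alt_def)

lemma alt_alt: "alt m (alt n x) = alt (m + n) x"
  by (simp add: alt_def)

lemma alt_uminus: "alt n (- x) = - alt n x"
  by (simp add: alt_def)

lemma additive_commute_alt: "additive X \<Longrightarrow> X (alt n p) = alt n (X p)"
  by (simp add: alt_def additive.minus)

lemma cg_alt: "additive Q \<Longrightarrow> cg Q p q \<Longrightarrow> cg Q (alt n p) (alt n q)"
  by (simp add: alt_def cg_uminus)

text \<open>The representative chosen for the value at 0 is merely congruent to 0, so Horner's rule
  survives only up to congruence. For \<open>P = 0\<close> the two sides differ by
  \<open>v (H 0)\<close>.\<close>

lemma psum_cg_pCons:
  assumes Q: "additive Q" and v: "additive v" "\<And>r. v (Q r) = Q (v r)"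
    and H0: "cg Q (H 0) 0"
  shows "cg Q (psum v H (pCons a P)) (H a + v (psum v H P))"
proof (cases "P = 0")
  case True
  have "cg Q (v (H 0)) (v 0)" by (rule cg_apply[of v Q Q, OF v H0])
  then have "cg Q (v 0) (v (H 0))" by (rule cg_sym[OF Q])
  from cg_add[OF Q cg_refl[OF Q, of "H a"] this] have "cg Q (H a) (H a + v (H 0))"
    by (simp add: additive.zero[OF v(1)])
  with True show ?thesis by simp
next
  case False
  have "psum v H (pCons a P) = H a + v (psum v H P)"
    unfolding psum_def using False
    by (subst degree_pCons_eq, simp, subst sum.atMost_Suc_shift)
      (simp add: additive.sum[OF v(1)])
  then show ?thesis using Q by simp
qed

text \<open>Horner induction on \<open>P\<close>, splitting off the constant coefficient of
  \<open>R\<close> at each step. That \<open>H 0\<close> is congruent to 0 follows from additivity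
  at \<open>0 + 0\<close>.\<close>

lemma psum_cg_add:
  assumes Q: "additive Q" and v: "additive v" "\<And>r. v (Q r) = Q (v r)"
    and H: "\<And>a b. cg Q (H (a + b)) (H a + H b)"
  shows "cg Q (psum v H (P + R)) (psum v H P + psum v H R)"
proof -
  have H0: "cg Q (H 0) 0"
    using cg_uminus[OF Q cg_diff[OF Q H[of 0 0] cg_refl[OF Q, of "H 0"]]] cg_sym[OF Q] cg_uminus[OF Q, of 0 "H 0"]
      cg_diff[OF Q H[of 0 0] cg_refl[OF Q, of "H 0"]] by simp
  note [trans] = cg_trans[OF Q]
  note pC = psum_cg_pCons[of Q v H, OF Q v H0]
  show ?thesis
  proof (induction P arbitrary: R)
    case 0
    have "cg Q (0 + psum v H R) (H 0 + psum v H R)"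
      by (intro cg_add Q cg_refl cg_sym[OF Q H0])
    then show ?case by simp
  next
    case (pCons a P)
    obtain b R' where R: "R = pCons b R'" by (cases R)
    have "cg Q (psum v H (pCons a P + R)) (H (a + b) + v (psum v H (P + R')))"
      using pC[of "a + b" "P + R'"] by (simp add: R)
    also  have "cg Q \<dots> ((H a + H b) + (v (psum v H P + psum v H R')))"
      by (intro cg_add Q H cg_apply[of v Q Q, OF v] pCons.IH)
    also have "\<dots> = (H a + v (psum v H P)) + (H b + v (psum v H R'))"
      by (simp add: additive.add[OF v(1)])
    also  have "cg Q \<dots> (psum v H (pCons a P) + psum v H R)"
      unfolding R by (rule cg_sym[OF Q cg_add[OF Q pC pC]])
    finally  show ?case .
  qed
qed

lemma psum_cong_cg:
  assumes Q: "additive Q" and v: "additive v" "\<And>r. v (Q r) = Q (v r)"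
    and H: "\<And>n. n \<le> degree P \<Longrightarrow> cg Q (H (coeff P n)) (H' (coeff P n))"
  shows "cg Q (psum v H P) (psum v H' P)"
proof -
  have "cg Q ((v ^^ n) p) ((v ^^ n) q)" if "cg Q p q" for n p q
    using that by (induction n) (auto intro: cg_apply[of v Q Q, OF v])
  then show ?thesis unfolding psum_def by (intro cg_sum Q) (auto intro: H)
qed

lemma psum_cg_bound:
  assumes Q: "additive Q" and v: "additive v" "\<And>r. v (Q r) = Q (v r)"
    and H0: "cg Q (H 0) 0" and N: "degree P \<le> N"
  shows "cg Q (\<Sum>n\<le>N. (v ^^ n) (H (coeff P n))) (psum v H P)"
proof -
  have pow: "cg Q ((v ^^ n) p) ((v ^^ n) q)" if "cg Q p q" for n p q
    using that by (induction n) (auto intro: cg_apply[of v Q Q, OF v])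
  have "cg Q (\<Sum>n\<le>N. (v ^^ n) (H (coeff P n))) (\<Sum>n\<le>N. if n \<le> degree P then (v ^^ n) (H (coeff P n)) else 0)"
  proof (intro cg_sum Q)
    fix n
    have "cg Q ((v ^^ n) (H 0)) 0"
      using pow[OF H0, of n] by (simp add: additive.zero[OF additive_funpow[OF v(1)]])
    then show "cg Q ((v ^^ n) (H (coeff P n))) (if n \<le> degree P then (v ^^ n) (H (coeff P n)) else 0)"
      by (auto simp: Q coeff_eq_0)
  qed
  also have "(\<Sum>n\<le>N. if n \<le> degree P then (v ^^ n) (H (coeff P n)) else 0) = psum v H P"
    unfolding psum_def using N by (intro sum.mono_neutral_cong_right) auto
  finally show ?thesis .
qed

section \<open>Twisted module structures on polynomials\<close>

context diff_algebra
begin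

lemma additive_del: "additive del"
  using del_linear
  by (simp add: additive_def Vector_Spaces.linear_def module_hom_def module_hom_axioms_def)

lemmas del_add = additive.add[OF additive_del]
  and del_zero [simp] = additive.zero[OF additive_del]

lemma del_one [simp]: "del 1 = 0"
  using del_mult[of 1 1] by simp

lemma del_scale: "del (s c a) = s c (del a)"
  using del_linear
  by (simp add: Vector_Spaces.linear_def module_hom_def module_hom_axioms_def)

lemma del_scale_one [simp]: "del (s c 1) = 0"
  by (simp add: del_scale)

end

context diff_module
begin

abbreviation S :: "nat \<Rightarrow> 'v \<Rightarrow> 'm mpol \<Rightarrow> 'm mpol" where
  "S i a \<equiv> shift_act del act i [:a:]"

abbreviation eqv :: "nat \<Rightarrow> 'm mpol \<Rightarrow> 'm mpol \<Rightarrow> bool" where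
  "eqv k \<equiv> cg (total_der D k)"

abbreviation DD :: "'m mpol \<Rightarrow> 'm mpol" where
  "DD \<equiv> Poly_Mapping.map D"

lemma additive_D: "additive D"
  by (simp add: additive_def D_add)

lemma additive_act: "additive (act a)"
  by (simp add: additive_def mdl.scale_right_distrib)

lemma additive_DD: "additive (DD :: 'm mpol \<Rightarrow> _)"
  by (intro additive_map_poly_mapping additive_D)

lemma shift_act_lsum:
  "shift_act del act i b = lsum (\<lambda>m c. \<Sum>n\<le>degree b. \<Sum>j\<le>lookup m i.
        single (m - single i j + single i n)
          (act (of_nat (lookup m i choose j) * (del ^^ j) (coeff b n)) c))"
  by (simp add: fun_eq_iff shift_act_def lsum_def)

lemma additive_shift_act: "additive (shift_act del act i b)"
  unfolding shift_act_lsum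
  by (intro additive_lsum additive_sum additive_comp[OF additive_single additive_act])

lemma shift_act_single:
  "shift_act del act i b (single m c) = (\<Sum>n\<le>degree b. \<Sum>j\<le>lookup m i.
        single (m - single i j + single i n)
          (act (of_nat (lookup m i choose j) * (del ^^ j) (coeff b n)) c))"
  by (simp add: shift_act_lsum lsum_single)

lemma S_single:
  "S i a (single m c) = (\<Sum>j\<le>lookup m i.
        single (m - single i j)
          (act (of_nat (lookup m i choose j) * (del ^^ j) a) c))"
  by (simp add: shift_act_single)

text \<open>Reduces a general symbol to powers of \<open>var i\<close> and the operators
  \<open>S i a\<close>, the shifted multiplications by single elements.\<close>

lemma shift_act_psum: "shift_act del act i b p = psum (var i) (\<lambda>a. S i a p) b"
  unfolding psum_def
proof (rule additive_eq_singles[of "shift_act del act i b" "\<lambda>p. \<Sum>n\<le>degree b. (var i ^^ n) (S i (coeff b n) p)"])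
  show "additive (\<lambda>p. \<Sum>n\<le>degree b. (var i ^^ n) (S i (coeff b n) p))"
    by (intro additive_sum additive_comp[OF additive_funpow[OF additive_var] additive_shift_act])
next
  fix m :: "nat \<Rightarrow>\<^sub>0 nat" and c :: 'm
  show "shift_act del act i b (single m c)
      = (\<Sum>n\<le>degree b. (var i ^^ n) (S i (coeff b n) (single m c)))"
    by (simp add: shift_act_single S_single additive.sum[OF additive_funpow[OF additive_var]]
        var_power_single add.commute)
qed (rule additive_shift_act)

lemma shift_act_zero [simp]: "shift_act del act i 0 p = 0"
proof -
  have "(del ^^ n) 0 = 0" for n by (induction n) simp_all
  then show ?thesis by (simp add: shift_act_def)
qed

lemma S_const [simp]: "S i a (single 0 c) = single 0 (act a c)"
  by (simp add: S_single)

lemma S_var_other: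
  assumes "i \<noteq> j"
  shows "S i a (var j p) = var j (S i a p)"
proof (rule additive_eq_singles[of "\<lambda>p. S i a (var j p)" "\<lambda>p. var j (S i a p)"])
  fix m :: "nat \<Rightarrow>\<^sub>0 nat" and c :: 'm
  have "lookup (single j 1 + m) i = lookup m i"
    using assms by (simp add: lookup_add lookup_single when_def)
  moreover have "single j 1 + m - single i k
      = single j 1 + (m - single i k)" for k
    using assms by (intro poly_mapping_eqI) (auto simp: lookup_add lookup_single lookup_minus when_def)
  ultimately show "S i a (var j (single m c)) = var j (S i a (single m c))"
    by (simp add: S_single var_sum del: One_nat_def)
qed (simp_all add: additive_comp[OF additive_var] additive_comp[OF additive_shift_act] additive_var additive_shift_act)

text \<open>Pascal's rule for the binomial coefficients in \<open>S_single\<close>. This is the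
  relation that makes \<open>S i\<close> and \<open>- var i\<close> obey the commutation law between
  elements and \<open>\<partial>\<close> in the algebra of differential operators.\<close>

lemma S_var_same: "S i a (var i p) = var i (S i a p) + S i (del a) p"
proof (rule additive_eq_singles[of "\<lambda>p. S i a (var i p)" "\<lambda>p. var i (S i a p) + S i (del a) p"])
  fix m :: "nat \<Rightarrow>\<^sub>0 nat" and c :: 'm
  define e where "e = lookup m i"
  let ?m = "single i 1 + m"
  let ?t = "\<lambda>n j. act (of_nat n * (del ^^ j) a) c"
  have m0: "?m - single i (Suc j) = m - single i j" for j
    by (intro poly_mapping_eqI) (auto simp: lookup_add lookup_single lookup_minus when_def)
  \<comment> \<open>Subtraction of exponents truncates at 0, so \<open>j < e\<close> is needed to
    recover the exponent.\<close>
  have m1: "single i 1 + (m - single i (Suc j)) = m - single i j" if "j < e" for j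
    using that by (intro poly_mapping_eqI) (auto simp: lookup_add lookup_single lookup_minus when_def e_def)
  have "var i (S i a (single m c))
      = (\<Sum>j\<le>e. single (single i 1 + (m - single i j)) (?t (e choose j) j))"
    by (simp add: S_single var_sum e_def)
  also have "\<dots> = (\<Sum>j<Suc e. single (single i 1 + (m - single i j)) (?t (e choose j) j))"
    by (simp add: lessThan_Suc_atMost)
  also have "\<dots> = single ?m (?t 1 0)
      + (\<Sum>j<e. single (m - single i j) (?t (e choose Suc j) (Suc j)))"
    unfolding sum.lessThan_Suc_shift by (simp add: m1 del: One_nat_def)
  \<comment> \<open>The added term \<open>j = e\<close> has the coefficient
    \<open>e choose Suc e = 0\<close>.\<close>
  also have "(\<Sum>j<e. single (m - single i j) (?t (e choose Suc j) (Suc j)))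
      = (\<Sum>j\<le>e. single (m - single i j) (?t (e choose Suc j) (Suc j)))"
    by (intro sum.mono_neutral_left) (auto simp: not_less le_eq_less_or_eq binomial_eq_0)
  finally have *: "var i (S i a (single m c)) = single ?m (?t 1 0) + \<dots>" .
  have "S i a (var i (single m c))
      = (\<Sum>j\<le>Suc e. single (?m - single i j) (?t (Suc e choose j) j))"
    by (simp add: S_single lookup_add e_def)
  also have "\<dots> = single ?m (?t 1 0)
      + (\<Sum>j\<le>e. single (m - single i j) (?t (Suc e choose Suc j) (Suc j)))"
    unfolding sum.atMost_Suc_shift m0 by simp
  \<comment> \<open>Pascal's rule: the first part will be \<open>S i (del a)\<close>, the second
    already occurs in the expansion of \<open>var i (S i a (single m c))\<close>.\<close>
  also have "(\<Sum>j\<le>e. single (m - single i j) (?t (Suc e choose Suc j) (Suc j)))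
      = (\<Sum>j\<le>e. single (m - single i j) (?t (e choose j) (Suc j)))
        + (\<Sum>j\<le>e. single (m - single i j) (?t (e choose Suc j) (Suc j)))"
    by (simp add: sum.distrib distrib_right mdl.scale_left_distrib single_add)
  also have "(\<Sum>j\<le>e. single (m - single i j) (?t (e choose j) (Suc j)))
      = S i (del a) (single m c)"
    by (simp add: S_single e_def funpow_swap1)
  finally show "S i a (var i (single m c))
      = var i (S i a (single m c)) + S i (del a) (single m c)"
    unfolding * by (simp add: ac_simps)
qed (simp_all add: additive_comp[OF additive_var] additive_comp[OF additive_shift_act] additive_plus additive_var additive_shift_act)

lemmas S_padd = additive.add[OF additive_shift_act]
  and S_pzero = additive.zero[OF additive_shift_act]
  and S_puminus = additive.minus[OF additive_shift_act]

text \<open>With \<open>S_const\<close> and additivity this determines \<open>S\<close>; the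
  algebraic laws below follow by induction on the polynomial with the coefficients
  generalized.\<close>

lemma S_var: "S i a (var j p) = var j (S i a p) + (if i = j then S i (del a) p else 0)"
  by (simp add: S_var_same S_var_other)

lemma S_add: "S i (a + b) p = S i a p + S i b p"
  by (induction p arbitrary: a b rule: mpol_induct)
    (auto simp: S_var S_padd mdl.scale_left_distrib single_add var_add del_add )

lemma additive_S_coeff: "additive (\<lambda>a. S i a p)"
  by (simp add: additive_def S_add)

lemma S_one [simp]: "S i 1 p = p"
  by (induction p rule: mpol_induct) (auto simp: S_var S_padd)

lemma S_mult: "S i (a * b) p = S i a (S i b p)"
  by (induction p arbitrary: a b rule: mpol_induct)
    (auto simp: S_var S_padd S_add del_mult S_pzero)

lemma S_S: "S i a (S j b p) = S j b (S i a p)"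
proof (cases "i = j")
  case True
  then show ?thesis by (simp add: mult.commute flip: S_mult)
next
  case False
  then show ?thesis
    by (induction p arbitrary: a b rule: mpol_induct)
      (auto simp: S_var S_padd S_pzero mult.commute)
qed

lemma DD_const: "DD (single 0 c) = single 0 (D c)"
  by (simp add: map_single additive.zero[OF additive_D])

lemma DD_var: "DD (var i p) = var i (DD p)"
  by (rule map_var[OF additive_D])

lemma DD_S: "DD (S i a p) = S i (del a) p + S i a (DD p)"
  by (induction p arbitrary: a rule: mpol_induct)
    (auto simp: S_var S_padd DD_const DD_var D_act single_add var_add additive.add[OF additive_DD]
      additive.zero[OF additive_DD])

text \<open>Applies to scalars, which \<open>del\<close> kills: they act coefficientwise whatever
  slot \<open>i\<close> is used.\<close>

lemma S_const_coeff: "del a = 0 \<Longrightarrow> S i a p = Poly_Mapping.map (act a) p"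
  by (induction p rule: mpol_induct)
    (auto simp: S_var S_padd map_single map_var[OF additive_act] additive.add[OF additive_map_poly_mapping[OF additive_act]])

lemma mpols_S: "p \<in> mpols k \<Longrightarrow> S i a p \<in> mpols k"
  by (induction arbitrary: a rule: mpols_induct) (auto simp: S_var S_padd mpols_const mpols_add mpols_var)

lemma pneg_const [simp]: "pneg del [:a:] = [:a:]"
  by (simp add: pneg_def)

lemma shift_act_pCons: "shift_act del act i (pCons a b) p = S i a p + var i (shift_act del act i b p)"
  using psum_pCons[OF additive_var, of "\<lambda>a. S i a p" i a b] by (simp flip: shift_act_psum)

lemma shift_act_add: "shift_act del act i (b + c) p = shift_act del act i b p + shift_act del act i c p"
  using additive.add[OF additive_psum[OF additive_var additive_S_coeff], of i i p b c] by (simp flip: shift_act_psum)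

lemma shift_act_uminus: "shift_act del act i (- b) p = - shift_act del act i b p"
  using additive.minus[OF additive_psum[OF additive_var additive_S_coeff], of i i p b] by (simp flip: shift_act_psum)

text \<open>Reversing the order of \<open>S i\<close> and \<open>var i\<close> costs a derivative of
  the coefficient, which is the term \<open>map_poly del b\<close>. The symbol on the left is one
  step of the recursion that defines \<open>pneg\<close>.\<close>

lemma shift_act_neg:
  "shift_act del act i (- pCons 0 b - map_poly del b) p = shift_act del act i b (- var i p)"
proof (induction b)
  case (pCons a b)
  have "- pCons 0 (pCons a b) - map_poly del (pCons a b)
      = - [:del a:] + pCons 0 (- [:a:] + (- pCons 0 b - map_poly del b))"
    by (simp add: map_poly_pCons)
  then have "shift_act del act i (- pCons 0 (pCons a b) - map_poly del (pCons a b)) p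
      = - S i (del a) p - var i (S i a p) + var i (shift_act del act i (- pCons 0 b - map_poly del b) p)"
    by (simp only: shift_act_add shift_act_uminus shift_act_pCons[of i 0] shift_act_zero pCons_0_0)
      (simp add: var_add var_uminus var_diff)
  also have "\<dots> = shift_act del act i (pCons a b) (- var i p)"
    unfolding pCons.IH by (simp add: shift_act_pCons[of i a b] S_puminus S_var_same var_uminus)
  finally show ?case .
qed simp

text \<open>On polynomials, \<open>S i\<close> and \<open>- var i\<close> define an action of differential operators, and the adjoint symbol is
  what this action substitutes.\<close>

lemma shift_act_pneg_pCons:
  "shift_act del act i (pneg del (pCons a b)) p = S i a p + shift_act del act i (pneg del b) (- var i p)"
  unfolding pneg_pCons[OF additive_del] by (simp only: shift_act_add shift_act_neg)

lemma dop_pCons: "dop act D (pCons a b) u = act a u + dop act D b (D u)"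
proof (cases "b = 0")
  case False
  then show ?thesis
    unfolding dop_def by (subst degree_pCons_eq, simp, subst sum.atMost_Suc_shift) (simp add: funpow_swap1)
qed (simp add: dop_def)

lemma dop_0 [simp]: "dop act D 0 u = 0"
  by (simp add: dop_def)

lemma dop_const [simp]: "dop act D [:a:] u = act a u"
  by (simp add: dop_def)

lemma dop_X: "dop act D [:0, 1:] u = D u"
  by (simp add: dop_pCons)

section \<open>The quotient by the total derivative and its behaviour under substitution\<close>

lemma additive_total_der [simp]: "additive (total_der D k)"
  unfolding total_der_def by (intro additive_plus additive_DD additive_sum additive_var)

lemma total_der_var: "total_der D k (var j p) = var j (total_der D k p)"
  by (simp add: total_der_def DD_var var_add var_sum var_commute[of _ j])

text \<open>A term \<open>S i (del a)\<close> arises on both sides: on the left from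
  \<open>D\<close> acting on the new coefficients, on the right from moving \<open>S i a\<close>
  past \<open>var i\<close>. The latter needs \<open>var i\<close> among the summands, hence
  \<open>i < k\<close>.\<close>

lemma total_der_S: "i < k \<Longrightarrow> total_der D k (S i a p) = S i a (total_der D k p)"
  by (simp add: total_der_def DD_S S_padd additive.sum[OF additive_shift_act] S_var sum.distrib)
    
text \<open>\<open>D\<close> plus the sum of the substituends: what \<open>total_der\<close> becomes
  when \<open>Ls\<close> is substituted for the variables.\<close>

definition QL :: "('m mpol \<Rightarrow> 'm mpol) list \<Rightarrow> 'm mpol \<Rightarrow> 'm mpol" where
  "QL Ls p = DD p + (\<Sum>L\<leftarrow>Ls. L p)"

lemma QL_Cons: "QL (L # Ls) p = L p + QL Ls p"
  by (simp add: QL_def ac_simps)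

lemma QL_mset: "mset Ls = mset Ls' \<Longrightarrow> QL Ls = QL Ls'"
  by (simp add: QL_def fun_eq_iff) (metis mset_map sum_mset_sum_list)

lemma total_der_QL: "total_der D k = QL (map var [0..<k])"
  by (simp add: fun_eq_iff total_der_def QL_def interv_sum_list_conv_sum_set_nat comp_def atLeast0LessThan)

lemma msub_total_der:
  assumes "set Ls \<subseteq> lin"
  shows "msub Ls (total_der D (length Ls) p) = QL Ls (msub Ls p)"
proof -
  have "msub Ls (total_der D (length Ls) p) = DD (msub Ls p) + (\<Sum>i<length Ls. (Ls ! i) (msub Ls p))"
    by (simp add: total_der_def additive.add[OF additive_msub] additive.sum[OF additive_msub] assms msub_map additive_D msub_var)
  also have "\<dots> = QL Ls (msub Ls p)"
    by (simp add: QL_def sum_list_sum_nth atLeast0LessThan)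
  finally show ?thesis .
qed

lemma msub_cg:
  assumes "set Ls \<subseteq> lin" "cg (total_der D (length Ls)) p q"
  shows "cg (QL Ls) (msub Ls p) (msub Ls q)"
  using assms(2) by (rule cg_apply[of "msub Ls" _ "QL Ls", OF additive_msub[OF assms(1)] msub_total_der[OF assms(1)]])

text \<open>Substituting each of the first \<open>k\<close> variables for itself maps any witness
  into \<open>mpols k\<close> and fixes \<open>p - q\<close>.\<close>

lemma red_rel_iff: "(p, q) \<in> red_rel D k \<longleftrightarrow> p \<in> mpols k \<and> q \<in> mpols k \<and> eqv k p q"
proof -
  have "\<exists>r\<in>mpols k. p - q = total_der D k r" if "p \<in> mpols k" "q \<in> mpols k" "p - q = total_der D k r" for r
  proof
    show "msub (map var [0..<k]) r \<in> mpols k"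
      by (rule mpols_msub_all) (auto intro: mpols_var)
    have "msub (map var [0..<k]) (p - q) = msub (map var [0..<k]) (total_der D k r)"
      using that by simp
    then show "p - q = total_der D k (msub (map var [0..<k]) r)"
      using that(1,2) msub_total_der[of "map var [0..<k]" r] by (simp add: msub_id mpols_diff flip: total_der_QL)
  qed
  then show ?thesis by (auto simp: red_rel_def cg_def)
qed

lemma mem_cls: "p \<in> mpols k \<Longrightarrow> q \<in> cls D k p \<longleftrightarrow> q \<in> mpols k \<and> eqv k p q"
  by (auto simp: cls_def red_rel_iff)

lemma cls_eq_iff: "p \<in> mpols k \<Longrightarrow> q \<in> mpols k \<Longrightarrow> cls D k p = cls D k q \<longleftrightarrow> eqv k p q"
  by (auto simp: set_eq_iff mem_cls intro: cg_trans[OF additive_total_der] cg_sym[OF additive_total_der])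

lemma quotient_iff: "X \<in> mpols k // red_rel D k \<longleftrightarrow> (\<exists>p\<in>mpols k. X = cls D k p)"
  by (auto simp: quotient_def cls_def)

lemma rep_cls:
  assumes "p \<in> mpols k"
  shows "rep (cls D k p) \<in> mpols k" "eqv k p (rep (cls D k p))"
proof -
  have "p \<in> cls D k p" using assms by (simp add: mem_cls)
  then have "rep (cls D k p) \<in> cls D k p" unfolding rep_def by (rule someI)
  then show "rep (cls D k p) \<in> mpols k" "eqv k p (rep (cls D k p))"
    using assms by (simp_all add: mem_cls)
qed

lemma cls_rep: "X \<in> mpols k // red_rel D k \<Longrightarrow> cls D k (rep X) = X"
  unfolding quotient_iff using rep_cls cg_sym[OF additive_total_der] by (metis cls_eq_iff)

lemma rep_mem: "X \<in> mpols k // red_rel D k \<Longrightarrow> rep X \<in> mpols k"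
  using rep_cls by (auto simp: quotient_iff)

end

section \<open>Alternating sums over the entries of a list\<close>

text \<open>Recursion on the list, rather than a sum over indices, lets swaps of neighbours and
  appending an entry be proved by list induction. \<open>T\<close> receives the chosen entry and the
  remaining list; \<open>asum_index\<close> is the link with the formula of the
  differential.\<close>

fun asum :: "('a \<Rightarrow> 'a list \<Rightarrow> 'b::ab_group_add) \<Rightarrow> 'a list \<Rightarrow> 'b" where
  "asum T [] = 0"
| "asum T (x # xs) = T x xs - asum (\<lambda>y ys. T y (x # ys)) xs"

fun asum2 :: "('a \<Rightarrow> 'a \<Rightarrow> 'a list \<Rightarrow> 'b::ab_group_add) \<Rightarrow> 'a list \<Rightarrow> 'b" where
  "asum2 B [] = 0"
| "asum2 B (x # xs) = asum2 (\<lambda>y z zs. B y z (x # zs)) xs - asum (B x) xs"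

lemma omit_0 [simp]: "omit 0 (x # xs) = xs"
  by (simp add: omit_def)

lemma omit_Suc [simp]: "omit (Suc i) (x # xs) = x # omit i xs"
  by (simp add: omit_def)

lemma omit_map: "omit i (map f xs) = map f (omit i xs)"
  by (simp add: omit_def take_map drop_map)

lemma asum_index: "asum T xs = (\<Sum>i<length xs. alt i (T (xs ! i) (omit i xs)))"
  by (induction xs arbitrary: T)
    (simp_all add: sum.lessThan_Suc_shift alt_Suc sum_negf del: sum.lessThan_Suc)

lemma asum2_index:
  "asum2 B xs = (\<Sum>j<length xs. \<Sum>i<j. alt (i + j) (B (xs ! i) (xs ! j) (omit i (omit j xs))))"
  by (induction xs arbitrary: B)
    (simp_all add: asum_index sum.lessThan_Suc_shift alt_Suc sum_negf sum_subtractf alt_uminus del: sum.lessThan_Suc)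

lemma asum_append1:
  "asum T (xs @ [z]) = asum (\<lambda>y ys. T y (ys @ [z])) xs + alt (length xs) (T z xs)"
  by (induction xs arbitrary: T) (simp_all add: alt_Suc)

text \<open>A pair that ends in the new entry carries the extra sign \<open>alt (length xs)\<close>,
  whereas in \<open>asum_append1\<close> the terms that keep the new entry in the remaining list
  have their old signs. This discrepancy later cancels the anchor terms.\<close>

lemma asum2_append1:
  "asum2 B (xs @ [z]) = asum2 (\<lambda>x y ws. B x y (ws @ [z])) xs + alt (length xs) (asum (\<lambda>x ws. B x z ws) xs)"
  by (induction xs arbitrary: B)
    (simp_all add: alt_Suc asum_append1 additive.diff[OF additive_alt])

lemma asum_add: "asum (\<lambda>x xs. T x xs + T' x xs) xs = asum T xs + asum T' xs"
  by (induction xs arbitrary: T T') simp_all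

lemma asum_uminus: "asum (\<lambda>x xs. - T x xs) xs = - asum T xs"
  by (induction xs arbitrary: T) simp_all

lemma asum_hom: "additive X \<Longrightarrow> X (asum T xs) = asum (\<lambda>x xs. X (T x xs)) xs"
  by (induction xs arbitrary: T) (simp_all add: additive.zero additive.diff)

lemma asum2_hom: "additive X \<Longrightarrow> X (asum2 B xs) = asum2 (\<lambda>x y xs. X (B x y xs)) xs"
  by (induction xs arbitrary: B) (simp_all add: additive.zero additive.diff asum_hom)

lemma asum_map: "asum T (map f xs) = asum (\<lambda>x xs. T (f x) (map f xs)) xs"
  by (induction xs arbitrary: T) simp_all

lemma asum2_map: "asum2 B (map f xs) = asum2 (\<lambda>x y xs. B (f x) (f y) (map f xs)) xs"
  by (induction xs arbitrary: B) (simp_all add: asum_map)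

lemma asum2_add: "asum2 (\<lambda>x y xs. B x y xs + B' x y xs) xs = asum2 B xs + asum2 B' xs"
  by (induction xs arbitrary: B B') (simp_all add: asum_add)

text \<open>The hypothesis is restricted to splittings of the multiset of \<open>xs\<close>, because
  a term fits the quotient by \<open>Q\<close> only when the right variables occur in it.\<close>

lemma asum_cong_cg:
  assumes Q: "additive Q"
  shows "(\<And>x ys. mset (x # ys) = mset xs \<Longrightarrow> cg Q (T x ys) (T' x ys)) \<Longrightarrow> cg Q (asum T xs) (asum T' xs)"
proof (induction xs arbitrary: T T')
  case (Cons x xs)
  show ?case
    unfolding asum.simps by (intro cg_diff Q Cons.IH Cons.prems) simp_all
qed (use Q in simp)

lemma asum2_cong_cg:
  assumes Q: "additive Q"
  shows "(\<And>x y ys. mset (x # y # ys) = mset xs \<Longrightarrow> cg Q (B x y ys) (B' x y ys)) \<Longrightarrow> cg Q (asum2 B xs) (asum2 B' xs)"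
proof (induction xs arbitrary: B B')
  case (Cons x xs)
  show ?case
    unfolding asum2.simps by (intro cg_diff Q Cons.IH asum_cong_cg Cons.prems) (simp_all add: add_mset_commute)
qed (use Q in simp)

text \<open>Congruence modulo the zero operator is equality.\<close>

lemma asum_cong: "(\<And>x ys. mset (x # ys) = mset xs \<Longrightarrow> T x ys = T' x ys) \<Longrightarrow> asum T xs = asum T' xs"
  using asum_cong_cg[OF additive_0, of xs T T'] by (simp add: cg_def)

lemma asum2_cong: "(\<And>x y ys. mset (x # y # ys) = mset xs \<Longrightarrow> B x y ys = B' x y ys) \<Longrightarrow> asum2 B xs = asum2 B' xs"
  using asum2_cong_cg[OF additive_0, of xs B B'] by (simp add: cg_def)

text \<open>The terms that pick \<open>a\<close> or \<open>b\<close> are exchanged, with opposite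
  signs because the picked position moves by one; in the other terms the swap happens inside the
  remaining list.\<close>

lemma asum_swap:
  assumes Q: "additive Q"
    and "\<And>x ys a b zs. mset (x # ys @ a # b # zs) = M \<Longrightarrow> cg Q (T x (ys @ a # b # zs)) (- T x (ys @ b # a # zs))"
    and "mset (ys @ a # b # zs) = M"
  shows "cg Q (asum T (ys @ a # b # zs)) (- asum T (ys @ b # a # zs))"
  using assms(2,3)
proof (induction ys arbitrary: T M)
  case Nil
  have "cg Q (asum (\<lambda>z ws. T z (a # b # ws)) zs) (asum (\<lambda>z ws. - T z (b # a # ws)) zs)"
  proof (intro asum_cong_cg Q)
    fix x ws assume "mset (x # ws) = mset zs"
    from this[symmetric] show "cg Q (T x (a # b # ws)) (- T x (b # a # ws))"
      using Nil(2) by (intro Nil(1)[of x "[]", simplified]) (simp add: add_mset_commute)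
  qed
  from cg_add[OF Q cg_refl[OF Q, of "T a (b # zs) - T b (a # zs)"] this]
  show ?case by (simp add: asum_uminus algebra_simps)
next
  case (Cons y ys)
  have M: "M = add_mset y (mset (ys @ a # b # zs))" using Cons.prems(2) by simp
  have "cg Q (asum (\<lambda>z ws. T z (y # ws)) (ys @ a # b # zs)) (- asum (\<lambda>z ws. T z (y # ws)) (ys @ b # a # zs))"
  proof (intro Cons.IH[OF _ refl])
    fix x ys' a' b' zs' assume *: "mset (x # ys' @ a' # b' # zs') = mset (ys @ a # b # zs)"
    show "cg Q (T x (y # ys' @ a' # b' # zs')) (- T x (y # ys' @ b' # a' # zs'))"
      by (intro Cons.prems(1)[of x "y # ys'", simplified])
        (simp only: M *[symmetric], simp add: add_mset_commute)
  qed
  moreover have "cg Q (T y (ys @ a # b # zs)) (- T y (ys @ b # a # zs))"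
    using Cons.prems(2) by (intro Cons.prems(1)) auto
  ultimately have "cg Q (asum T ((y # ys) @ a # b # zs))
      (- T y (ys @ b # a # zs) - - asum (\<lambda>z ws. T z (y # ws)) (ys @ b # a # zs))"
    unfolding append_Cons asum.simps by (intro cg_diff Q)
  then show ?case by (simp add: algebra_simps)
qed

text \<open>Pairs with exactly one of \<open>a\<close>, \<open>b\<close> are exchanged with opposite
  signs, pairs with neither have the swap in the remaining list, and the pair of both is reversed,
  which is where antisymmetry of \<open>B\<close> enters.\<close>

lemma asum2_swap:
  assumes Q: "additive Q"
    and "\<And>x y ys a b zs. mset (x # y # ys @ a # b # zs) = M \<Longrightarrow> cg Q (B x y (ys @ a # b # zs)) (- B x y (ys @ b # a # zs))"
    and "\<And>x y ys. mset (x # y # ys) = M \<Longrightarrow> cg Q (B x y ys) (- B y x ys)"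
    and "mset (ys @ a # b # zs) = M"
  shows "cg Q (asum2 B (ys @ a # b # zs)) (- asum2 B (ys @ b # a # zs))"
  using assms(2-4)
proof (induction ys arbitrary: B M)
  case Nil
  have "cg Q (asum2 (\<lambda>x y ws. B x y (a # b # ws)) zs) (- asum2 (\<lambda>x y ws. B x y (b # a # ws)) zs)"
    unfolding asum2_hom[OF additive_uminus[OF additive_id], of "\<lambda>x y ws. B x y (b # a # ws)"]
  proof (intro asum2_cong_cg Q)
    fix x y ws assume "mset (x # y # ws) = mset zs"
    from this[symmetric] show "cg Q (B x y (a # b # ws)) (- B x y (b # a # ws))"
      using Nil(3) by (intro Nil(1)[of x y "[]", simplified]) (simp add: add_mset_commute)
  qed
  moreover have "cg Q (B a b zs) (- B b a zs)"
    using Nil(3) by (intro Nil(2)) simp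
  ultimately have "cg Q (asum2 (\<lambda>x y ws. B x y (a # b # ws)) zs - B a b zs
       + (asum (\<lambda>y ys. B a y (b # ys)) zs - asum (\<lambda>y ys. B b y (a # ys)) zs))
     (- asum2 (\<lambda>x y ws. B x y (b # a # ws)) zs - - B b a zs
       + (asum (\<lambda>y ys. B a y (b # ys)) zs - asum (\<lambda>y ys. B b y (a # ys)) zs))"
    by (intro cg_add[OF Q _ cg_refl[OF Q]] cg_diff Q)
  then show ?case by (simp add: algebra_simps)
next
  case (Cons y ys)
  have M: "M = add_mset y (mset (ys @ a # b # zs))" using Cons.prems(3) by simp
  have "cg Q (asum2 (\<lambda>z w ws. B z w (y # ws)) (ys @ a # b # zs)) (- asum2 (\<lambda>z w ws. B z w (y # ws)) (ys @ b # a # zs))"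
  proof (intro Cons.IH[OF _ _ refl])
    fix x z ys' a' b' zs' assume *: "mset (x # z # ys' @ a' # b' # zs') = mset (ys @ a # b # zs)"
    show "cg Q (B x z (y # ys' @ a' # b' # zs')) (- B x z (y # ys' @ b' # a' # zs'))"
      by (intro Cons.prems(1)[of x z "y # ys'", simplified])
        (simp only: M *[symmetric], simp add: add_mset_commute)
  next
    fix x z ys' assume *: "mset (x # z # ys') = mset (ys @ a # b # zs)"
    show "cg Q (B x z (y # ys')) (- B z x (y # ys'))"
      by (intro Cons.prems(2)) (simp only: M *[symmetric], simp add: add_mset_commute)
  qed
  moreover have "cg Q (asum (B y) (ys @ a # b # zs)) (- asum (B y) (ys @ b # a # zs))"
  proof (intro asum_swap[OF Q _ refl])
    fix x ys' a' b' zs' assume *: "mset (x # ys' @ a' # b' # zs') = mset (ys @ a # b # zs)"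
    show "cg Q (B y x (ys' @ a' # b' # zs')) (- B y x (ys' @ b' # a' # zs'))"
      by (intro Cons.prems(1)) (simp only: M *[symmetric], simp add: add_mset_commute)
  qed
  ultimately have "cg Q (asum2 B ((y # ys) @ a # b # zs))
      (- asum2 (\<lambda>z w ws. B z w (y # ws)) (ys @ b # a # zs) - - asum (B y) (ys @ b # a # zs))"
    unfolding append_Cons asum2.simps by (intro cg_diff Q)
  then show ?case by (simp add: algebra_simps)
qed

subsection \<open>Functions alternating under adjacent swaps\<close>

text \<open>Stated for arrangements of one multiset \<open>M\<close>: in the differential the
  entries carry variables, and the operator \<open>Q\<close> depends on which variables occur.
  \<open>alternating_permute\<close> passes from adjacent swaps to all permutations.\<close>

definition alternating :: "('b \<Rightarrow> 'b) \<Rightarrow> 'a multiset \<Rightarrow> ('a list \<Rightarrow> 'b::ab_group_add) \<Rightarrow> bool" where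
  "alternating Q M G \<longleftrightarrow> (\<forall>ys a b zs. mset (ys @ a # b # zs) = M \<longrightarrow> cg Q (G (ys @ a # b # zs)) (- G (ys @ b # a # zs)))"

lemma alternatingD:
  "alternating Q M G \<Longrightarrow> mset (ys @ a # b # zs) = M \<Longrightarrow> cg Q (G (ys @ a # b # zs)) (- G (ys @ b # a # zs))"
  by (auto simp: alternating_def)

lemma alternating_move:
  assumes Q: "additive Q" and G: "alternating Q M G"
  shows "mset (ys @ a # bs @ zs) = M \<Longrightarrow> cg Q (G (ys @ a # bs @ zs)) (alt (length bs) (G (ys @ bs @ a # zs)))"
proof (induction bs arbitrary: ys)
  case (Cons b bs)
  note [trans] = cg_trans[OF Q]
  have "cg Q (G (ys @ a # b # bs @ zs)) (- G (ys @ b # a # bs @ zs))"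
    using Cons.prems by (intro alternatingD[OF G]) auto
  also have "cg Q \<dots> (- alt (length bs) (G ((ys @ [b]) @ bs @ a # zs)))"
    using Cons.IH[of "ys @ [b]"] Cons.prems by (intro cg_uminus[OF Q]) auto
  finally show ?case by (simp add: alt_Suc)
qed (use Q in simp)

text \<open>Moving \<open>a\<close> to the right past \<open>bs\<close> and \<open>b\<close>, then
  \<open>b\<close> back to the left past \<open>bs\<close>, takes an odd number of adjacent
  swaps.\<close>

lemma alternating_transpose:
  assumes Q: "additive Q" and G: "alternating Q M G"
    and M: "mset (ys @ a # bs @ b # zs) = M"
  shows "cg Q (G (ys @ a # bs @ b # zs)) (- G (ys @ b # bs @ a # zs))"
proof -
  note [trans] = cg_trans[OF Q]
  let ?n = "length bs"
  have "cg Q (G (ys @ a # bs @ b # zs)) (alt (length (bs @ [b])) (G (ys @ bs @ b # a # zs)))"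
    using alternating_move[OF Q G, of ys a "bs @ [b]" zs] M by simp
  also have "cg Q (alt (length (bs @ [b])) (G (ys @ bs @ b # a # zs)))
      (alt (length (bs @ [b])) (alt ?n (G (ys @ b # bs @ a # zs))))"
    using cg_sym[OF Q cg_alt[OF Q alternating_move[OF Q G, of ys b bs "a # zs"], of ?n]] M
    by (intro cg_alt[OF Q]) (simp add: alt_alt alt_def[of "_ + _"] union_ac add_mset_commute)
  finally show ?thesis by (simp add: alt_alt alt_def split: if_splits)
qed

text \<open>Induction over products of transpositions; each one changes both the parity and the
  sign.\<close>

lemma alternating_permute:
  assumes Q: "additive Q" and G: "alternating Q M G"
    and \<pi>: "\<pi> permutes {..<length xs}" and M: "mset xs = M"
  shows "cg Q (G xs) (if evenperm \<pi> then G (permute_list \<pi> xs) else - G (permute_list \<pi> xs))"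
  using finite_lessThan \<pi>
proof (induction rule: permutes_rev_induct)
  case id
  then show ?case using Q by simp
next
  case (swap a b \<pi>)
  note [trans] = cg_trans[OF Q]
  \<comment> \<open>For \<open>a < b\<close> both lists are cut at the two positions, so that
    \<open>alternating_transpose\<close> applies; the other order follows from the symmetry of
    \<open>transpose\<close>.\<close>
  have *: "cg Q (G (permute_list \<pi> xs)) (- G (permute_list (\<pi> \<circ> transpose a b) xs))" if "a < b" "b < length xs" for a b
  proof -
    define ys where "ys = permute_list \<pi> xs"
    have len: "length ys = length xs" by (simp add: ys_def)
    have "permute_list (\<pi> \<circ> transpose a b) xs = permute_list (transpose a b) ys"
      unfolding ys_def using that swap by (intro permute_list_compose permutes_swap_id) auto
    also have "\<dots> = take a ys @ ys ! b # take (b - Suc a) (drop (Suc a) ys) @ ys ! a # drop (Suc b) ys"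
      using that len by (intro nth_equalityI)
        (auto simp: permute_list_def nth_append nth_Cons' transpose_def min_def)
    finally have 1: "permute_list (\<pi> \<circ> transpose a b) xs = \<dots>" .
    have 2: "ys = take a ys @ ys ! a # take (b - Suc a) (drop (Suc a) ys) @ ys ! b # drop (Suc b) ys"
      using that len by (intro nth_equalityI)
        (auto simp: nth_append nth_Cons' min_def, (intro arg_cong[where f = "(!) ys"], linarith)+)
    have "mset ys = M" unfolding ys_def using swap M by simp
    then show ?thesis
      unfolding 1 unfolding ys_def[symmetric]
      using 2 alternating_transpose[OF Q G, of "take a ys" "ys ! a" "take (b - Suc a) (drop (Suc a) ys)" "ys ! b" "drop (Suc b) ys"]
      by simp
  qed
  have **: "cg Q (G (permute_list \<pi> xs)) (- G (permute_list (\<pi> \<circ> transpose a b) xs))"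
    using swap *[of a b] *[of b a] by (cases a b rule: linorder_cases) (auto simp: transpose_commute)
  have ev: "evenperm (\<pi> \<circ> transpose a b) \<longleftrightarrow> \<not> evenperm \<pi>"
    using swap permutation_permutes[of \<pi>] by (auto simp: evenperm_comp permutation_swap_id evenperm_swap)
  have "cg Q (G xs) (if evenperm \<pi> then G (permute_list \<pi> xs) else - G (permute_list \<pi> xs))"
    by (rule swap.IH)
  also have "cg Q \<dots> (if evenperm (\<pi> \<circ> transpose a b) then G (permute_list (\<pi> \<circ> transpose a b) xs) else - G (permute_list (\<pi> \<circ> transpose a b) xs))"
    using ** cg_uminus[OF Q **] by (simp add: ev)
  finally show ?case .
qed

section \<open>Cochains in terms of representatives\<close>

lemma mset_map_permutes:
  assumes "\<pi> permutes {..<k}"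
  shows "mset (map \<pi> [0..<k]) = mset [0..<k]"
proof -
  have "map \<pi> [0..<k] = permute_list \<pi> [0..<k]"
    using permutes_in_image[OF assms] by (intro nth_equalityI) (auto simp: permute_list_def)
  then show ?thesis using assms by simp
qed

context diff_module
begin

lemma mem_quotient:
  assumes "X \<in> mpols k // red_rel D k"
  shows "q \<in> X \<longleftrightarrow> q \<in> mpols k \<and> eqv k (rep X) q"
  using assms mem_cls[OF rep_mem[OF assms], of q] by (simp add: cls_rep)

lemma rep_in: "X \<in> mpols k // red_rel D k \<Longrightarrow> rep X \<in> X"
  by (simp add: mem_quotient rep_mem)

lemma total_der_shift_act:
  "i < k \<Longrightarrow> total_der D k (shift_act del act i b p) = shift_act del act i b (total_der D k p)"
proof (induction b)
  case 0
  then show ?case by (simp add: additive.zero[OF additive_total_der])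
next
  case (pCons a b)
  then show ?case
    by (simp add: shift_act_pCons[of i a b] additive.add[OF additive_total_der] total_der_S total_der_var)
qed

lemma cg_shift_act:
  "i < k \<Longrightarrow> eqv k p q \<Longrightarrow> eqv k (shift_act del act i b p) (shift_act del act i b q)"
  by (rule cg_apply[of "shift_act del act i b", OF additive_shift_act]) (simp_all add: total_der_shift_act)

lemma cg_var: "eqv k p q \<Longrightarrow> eqv k (var i p) (var i q)"
  by (rule cg_apply[of "var i", OF additive_var]) (simp_all add: total_der_var)

lemma mpols_shift_act: "p \<in> mpols k \<Longrightarrow> i < k \<Longrightarrow> shift_act del act i b p \<in> mpols k"
proof (induction b)
  case (pCons a b)
  then show ?case
    by (simp add: shift_act_pCons[of i a b] mpols_add mpols_S mpols_var)
qed simp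

lemma shift_act_pneg_X: "shift_act del act i (pneg del [:0, 1:]) p = - var i p"
  by (subst shift_act_pneg_pCons) (simp add: S_puminus)

text \<open>The symbol 1 acts as the identity, so a list of symbols that is 1 except in place
  \<open>i\<close> isolates a single slot of the LCAd cochain condition.\<close>

lemma shift_acts_single:
  assumes "i < k"
  shows "shift_acts del act (map (pneg del) ((replicate k [:1:])[i := b])) p = shift_act del act i (pneg del b) p"
proof -
  have "fold (\<lambda>j. shift_act del act j (map (pneg del) ((replicate k [:1:])[i := b]) ! j)) xs p
      = (if i \<in> set xs then shift_act del act i (pneg del b) p else p)"
    if "distinct xs" "set xs \<subseteq> {..<k}" for xs
    using that by (induction xs arbitrary: p) (auto simp: assms nth_list_update)
  then show ?thesis using assms by (simp add: shift_acts_def atLeast0LessThan)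
qed

definition skew :: "nat \<Rightarrow> ('a list \<Rightarrow> 'm mpol) \<Rightarrow> bool" where
  "skew k f \<longleftrightarrow> (\<forall>\<pi> us. \<pi> permutes {..<k} \<longrightarrow> length us = k \<longrightarrow>
     eqv k (f us) (let q = msub (map (\<lambda>i. var (\<pi> i)) [0..<k]) (f (permute_list \<pi> us)) in if evenperm \<pi> then q else - q))"

text \<open>The sum of all variables is symmetric; this lets a permutation of the variables act on
  the quotient.\<close>

lemma total_der_permutes:
  assumes "\<pi> permutes {..<k}"
  shows "total_der D k = QL (map (\<lambda>i. var (\<pi> i)) [0..<k])"
proof -
  have "mset (map (\<lambda>i. var (\<pi> i)) [0..<k]) = mset (map var [0..<k])"
    using arg_cong[OF mset_map_permutes[OF assms], of "image_mset var"]
    by (simp add: comp_def multiset.map_comp)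
  then show ?thesis unfolding total_der_QL by (rule QL_mset[symmetric])
qed

lemma cg_msub_permutes:
  assumes "\<pi> permutes {..<k}" "eqv k p q"
  shows "eqv k (msub (map (\<lambda>i. var (\<pi> i)) [0..<k]) p) (msub (map (\<lambda>i. var (\<pi> i)) [0..<k]) q)"
  using msub_cg[of "map (\<lambda>i. var (\<pi> i)) [0..<k]" p q] assms by (simp flip: total_der_permutes)

lemma mpols_msub_permutes:
  assumes "\<pi> permutes {..<k}"
  shows "msub (map (\<lambda>i. var (\<pi> i)) [0..<k]) (p :: 'm mpol) \<in> mpols k"
proof (rule mpols_msub_all)
  fix L :: "'m mpol \<Rightarrow> 'm mpol" and p :: "'m mpol" assume L: "L \<in> set (map (\<lambda>i. var (\<pi> i)) [0..<k])" and p: "p \<in> mpols k"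
  then obtain i where "i < k" "L = var (\<pi> i)" by auto
  then show "L p \<in> mpols k"
    using p permutes_in_image[OF assms, of i] by (simp add: mpols_var)
qed simp

text \<open>A permutation of the variables respects the congruence, so testing one representative of
  each value is the same as testing all of them.\<close>

lemma skew_symmetric_iff:
  assumes \<phi>: "\<And>us. length us = k \<Longrightarrow> \<phi> us \<in> mpols k // red_rel D k"
    and f: "\<And>us. length us = k \<Longrightarrow> f us \<in> \<phi> us"
  shows "skew_symmetric k \<phi> \<longleftrightarrow> skew k f"
proof
  note sym = cg_sym[OF additive_total_der] and tr = cg_trans[OF additive_total_der]
  have fm: "eqv k (f us) q \<longleftrightarrow> q \<in> \<phi> us" if "length us = k" "q \<in> mpols k" for us q
    using mem_quotient[OF \<phi>[OF that(1)]] f[OF that(1)] that(2) by (metis sym tr)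
  have msub_mem: "(let q = msub (map (\<lambda>i. var (\<pi> i)) [0..<k]) p in if evenperm \<pi> then q else - q) \<in> mpols k"
    if "\<pi> permutes {..<k}" for \<pi> and p :: "'m mpol"
    by (auto simp: Let_def intro!: mpols_uminus mpols_msub_permutes that)
  {
    assume "skew_symmetric k \<phi>"
    then show "skew k f"
      unfolding skew_def skew_symmetric_def using f fm msub_mem by simp
  next
    assume skew: "skew k f"
    show "skew_symmetric k \<phi>"
      unfolding skew_symmetric_def
    proof (intro allI impI ballI, elim conjE)
      fix \<pi> us p assume \<pi>: "\<pi> permutes {..<k}" and us: "length us = k" and p: "p \<in> \<phi> (permute_list \<pi> us)"
      let ?m = "\<lambda>p. let q = msub (map (\<lambda>i. var (\<pi> i)) [0..<k]) p in if evenperm \<pi> then q else - q"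
      have "eqv k (f (permute_list \<pi> us)) p"
        using fm[of "permute_list \<pi> us" p] p us mem_quotient[OF \<phi>[of "permute_list \<pi> us"]] by simp
      then have "eqv k (?m (f (permute_list \<pi> us))) (?m p)"
        using cg_msub_permutes[OF \<pi>] cg_uminus[OF additive_total_der] by (auto simp: Let_def)
      moreover have "eqv k (f us) (?m (f (permute_list \<pi> us)))"
        using skew \<pi> us unfolding skew_def by blast
      ultimately have "eqv k (f us) (?m p)" by (rule tr[rotated])
      then show "?m p \<in> \<phi> us" using fm[OF us msub_mem[OF \<pi>]] by simp
    qed
  }
qed

end

section \<open>LCAd cochains as functions that are linear over differential operators up to
  congruence\<close>

locale cochain_modules = E: diff_module s del actE DE + M: diff_module s del actM DM
  for s :: "'f::field_char_0 \<Rightarrow> 'v::comm_ring_1 \<Rightarrow> 'v"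
    and del :: "'v \<Rightarrow> 'v"
    and actE :: "'v \<Rightarrow> 'e::ab_group_add \<Rightarrow> 'e"
    and DE :: "'e \<Rightarrow> 'e"
    and actM :: "'v \<Rightarrow> 'm::ab_group_add \<Rightarrow> 'm"
    and DM :: "'m \<Rightarrow> 'm"
begin

text \<open>Linearity over differential operators is asked for on generators, one slot at a time;
  scalars act through the algebra. Values are compared up to congruence, so that a choice of
  representatives of a cochain qualifies.\<close>

definition good :: "nat \<Rightarrow> ('e list \<Rightarrow> 'm mpol) \<Rightarrow> bool" where
  "good k f \<longleftrightarrow>
     (\<forall>us. length us = k \<longrightarrow> f us \<in> mpols k) \<and>
     (\<forall>us i x y. length us = k \<longrightarrow> i < k \<longrightarrow>
        M.eqv k (f (us[i := x + y])) (f (us[i := x]) + f (us[i := y]))) \<and>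
     (\<forall>us i a x. length us = k \<longrightarrow> i < k \<longrightarrow>
        M.eqv k (f (us[i := actE a x])) (M.S i a (f (us[i := x])))) \<and>
     (\<forall>us i x. length us = k \<longrightarrow> i < k \<longrightarrow>
        M.eqv k (f (us[i := DE x])) (- var i (f (us[i := x])))) \<and>
     M.skew k f"

lemma
  assumes "good k f" "length us = k"
  shows good_mem: "f us \<in> mpols k"
    and good_add: "i < k \<Longrightarrow> M.eqv k (f (us[i := x + y])) (f (us[i := x]) + f (us[i := y]))"
    and good_act: "i < k \<Longrightarrow> M.eqv k (f (us[i := actE a x])) (M.S i a (f (us[i := x])))"
    and good_D: "i < k \<Longrightarrow> M.eqv k (f (us[i := DE x])) (- var i (f (us[i := x])))"
    and good_skew: "\<pi> permutes {..<k} \<Longrightarrow>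
     M.eqv k (f us) (let q = msub (map (\<lambda>i. var (\<pi> i)) [0..<k]) (f (permute_list \<pi> us)) in if evenperm \<pi> then q else - q)"
  using assms by (simp_all add: good_def M.skew_def)

text \<open>Induction on the symbol in the form of \<open>dop_pCons\<close>, moving one
  \<open>DE\<close> at a time into the argument; \<open>shift_act_pneg_pCons\<close> is the same
  recursion on polynomials.\<close>

lemma good_dop:
  assumes f: "good k f" and us: "length us = k" "i < k"
  shows "M.eqv k (f (us[i := dop actE DE b x])) (shift_act del actM i (pneg del b) (f (us[i := x])))"
proof (induction b arbitrary: x)
  case 0
  have "pneg del 0 = 0" by (simp add: pneg_def)
  \<comment> \<open>The argument 0 is written as the element 0 acting on \<open>x\<close>.\<close>
  moreover have "M.eqv k (f (us[i := 0])) 0"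
    using good_act[OF f us, of 0 x] by simp
  ultimately show ?case by simp
next
  case (pCons a b)
  note T = M.additive_total_der
  note [trans] = cg_trans[OF T]
  have "M.eqv k (f (us[i := actE a x + dop actE DE b (DE x)]))
     (f (us[i := actE a x]) + f (us[i := dop actE DE b (DE x)]))"
    by (rule good_add[OF f us])
  also have "M.eqv k \<dots> (M.S i a (f (us[i := x])) + shift_act del actM i (pneg del b) (f (us[i := DE x])))"
    by (intro cg_add T good_act[OF f us] pCons.IH)
  also have "M.eqv k \<dots> (M.S i a (f (us[i := x])) + shift_act del actM i (pneg del b) (- var i (f (us[i := x]))))"
    by (intro cg_add T cg_refl M.cg_shift_act us good_D[OF f us])
  finally show ?case by (simp only: E.dop_pCons M.shift_act_pneg_pCons)
qed

lemma good_shift_acts: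
  assumes f: "good k f" and len: "length as = k" "length us = k"
  shows "M.eqv k (f (map2 (dop actE DE) as us)) (shift_acts del actM (map (pneg del) as) (f us))"
proof -
  note T = M.additive_total_der
  note [trans] = cg_trans[OF T]
  \<comment> \<open>In \<open>?v n\<close> the operators sit in the first \<open>n\<close> slots
    only. They are moved out one slot at a time, in the order of the fold that defines
    \<open>shift_acts\<close>.\<close>
  let ?v = "\<lambda>n. map (\<lambda>i. if i < n then dop actE DE (as ! i) (us ! i) else us ! i) [0..<k]"
  have "M.eqv k (f (?v n)) (fold (\<lambda>i. shift_act del actM i (map (pneg del) as ! i)) [0..<n] (f us))" if "n \<le> k" for n
    using that
  proof (induction n)
    case 0
    have "?v 0 = us" using len by (intro nth_equalityI) auto
    then show ?case by simp
  next
    case (Suc n)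
    have 1: "?v (Suc n) = (?v n)[n := dop actE DE (as ! n) (us ! n)]" and 2: "?v n = (?v n)[n := us ! n]"
      using Suc.prems len by (auto intro!: nth_equalityI simp: nth_list_update less_Suc_eq)
    have "M.eqv k (f (?v (Suc n))) (shift_act del actM n (pneg del (as ! n)) (f (?v n)))"
      unfolding 1 by (subst (2) 2, rule good_dop[OF f]) (use Suc.prems in simp_all)
    also have "M.eqv k \<dots> (shift_act del actM n (pneg del (as ! n))
        (fold (\<lambda>i. shift_act del actM i (map (pneg del) as ! i)) [0..<n] (f us)))"
      using Suc by (intro M.cg_shift_act) simp_all
    finally show ?case using Suc.prems len by simp
  qed
  from this[of k] have "M.eqv k (f (?v k)) (shift_acts del actM (map (pneg del) as) (f us))"
    using len by (simp add: shift_acts_def)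
  moreover have "?v k = map2 (dop actE DE) as us"
    using len by (intro nth_equalityI) auto
  ultimately show ?thesis by simp
qed

lemma fscale_map: "Poly_Mapping.map (fscale s actM c) p = M.S i (s c 1) p"
  by (simp add: M.S_const_coeff fscale_def[abs_def])

lemma lcad_cochainD:
  assumes "\<phi> \<in> lcad_cochains s del actE DE actM DM k"
  shows "\<phi> \<in> extensional {us. length us = k}"
    and "length us = k \<Longrightarrow> \<phi> us \<in> mpols k // red_rel DM k"
  using assms by (auto simp: lcad_cochains_def multilinear_maps_def PiE_iff)

lemma good_rep:
  assumes "\<phi> \<in> lcad_cochains s del actE DE actM DM k"
  shows "good k (\<lambda>us. rep (\<phi> us))"
proof -
  note q = lcad_cochainD(2)[OF assms]
  have cgI: "M.eqv k (rep (\<phi> us)) p" if "length us = k" "p \<in> \<phi> us" for us p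
    using that M.mem_quotient[OF q] by simp
  have in_rep: "rep (\<phi> us) \<in> \<phi> us" if "length us = k" for us
    using M.rep_in[OF q[OF that]] .
  have slot: "shift_act del actM i (pneg del b) (rep (\<phi> (us[i := x]))) \<in> \<phi> (us[i := dop actE DE b x])"
    if "length us = k" "i < k" for us i b x
  proof -
    have "map2 (dop actE DE) ((replicate k [:1:])[i := b]) (us[i := x]) = us[i := dop actE DE b x]"
      using that by (intro nth_equalityI) (auto simp: nth_list_update)
    moreover have "shift_acts del actM (map (pneg del) ((replicate k [:1:])[i := b])) (rep (\<phi> (us[i := x])))
        \<in> \<phi> (map2 (dop actE DE) ((replicate k [:1:])[i := b]) (us[i := x]))"
    proof -
      have "\<forall>as us. length as = k \<and> length us = k \<longrightarrow>
           (\<forall>p \<in> \<phi> us. shift_acts del actM (map (pneg del) as) p \<in> \<phi> (map2 (dop actE DE) as us))"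
        using assms by (simp add: lcad_cochains_def)
      then show ?thesis using that in_rep[of "us[i := x]"] by simp
    qed
    ultimately show ?thesis using that by (simp add: M.shift_acts_single)
  qed
  show ?thesis
    unfolding good_def
  proof (intro conjI allI impI)
    fix us :: "'e list" assume us: "length us = k"
    then show "rep (\<phi> us) \<in> mpols k" by (intro M.rep_mem q)
    fix i assume i: "i < k"
    fix a x y
    show "M.eqv k (rep (\<phi> (us[i := x + y]))) (rep (\<phi> (us[i := x])) + rep (\<phi> (us[i := y])))"
    proof (rule cgI)
      show "rep (\<phi> (us[i := x])) + rep (\<phi> (us[i := y])) \<in> \<phi> (us[i := x + y])"
        using assms us i in_rep by (simp add: lcad_cochains_def multilinear_maps_def)
    qed (use us in simp)
    show "M.eqv k (rep (\<phi> (us[i := actE a x]))) (M.S i a (rep (\<phi> (us[i := x]))))"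
      using slot[OF us i, of "[:a:]" x] us by (intro cgI) simp_all
    show "M.eqv k (rep (\<phi> (us[i := DE x]))) (- var i (rep (\<phi> (us[i := x]))))"
      using slot[OF us i, of "[:0, 1:]" x] us
      by (intro cgI) (simp_all only: M.shift_act_pneg_X E.dop_X length_list_update)
  next
    show "M.skew k (\<lambda>us. rep (\<phi> us))"
      using assms M.skew_symmetric_iff[of k \<phi> "\<lambda>us. rep (\<phi> us)", OF q in_rep] by (simp add: lcad_cochains_def)
  qed
qed

text \<open>The cochain conditions speak about arbitrary members of classes; all operators involved
  respect the congruence, so the conditions on \<open>f\<close> carry over. With
  \<open>good_rep\<close>, cochains become interchangeable with such functions up to
  congruence.\<close>

lemma good_cochain:
  assumes f: "good k f"
  shows "(\<lambda>us\<in>{us. length us = k}. cls DM k (f us)) \<in> lcad_cochains s del actE DE actM DM k" (is "?\<phi> \<in> _")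
proof -
  note T = M.additive_total_der
  note tr = cg_trans[OF T] and sym = cg_sym[OF T]
  have \<phi>: "?\<phi> us = cls DM k (f us)" if "length us = k" for us
    using that by simp
  have memI: "p \<in> ?\<phi> us \<longleftrightarrow> p \<in> mpols k \<and> M.eqv k (f us) p" if "length us = k" for us p
    using that M.mem_cls[OF good_mem[OF f that]] by simp
  have q: "?\<phi> us \<in> mpols k // red_rel DM k" if "length us = k" for us
    using that good_mem[OF f that] by (auto simp: M.quotient_iff)
  show ?thesis
    unfolding lcad_cochains_def multilinear_maps_def mem_Collect_eq
  proof (intro conjI allI impI ballI; (elim conjE)?)
    show "?\<phi> \<in> {us. length us = k} \<rightarrow>\<^sub>E mpols k // red_rel DM k"
      using q by auto
  next
    fix us i x y p r
    assume us: "length us = k" "i < k" and p: "p \<in> ?\<phi> (us[i := x])" and r: "r \<in> ?\<phi> (us[i := y])"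
    have "M.eqv k (f (us[i := x]) + f (us[i := y])) (p + r)"
      using p r us by (intro cg_add T) (simp_all add: memI del: restrict_apply restrict_apply')
    with good_add[OF f us, of x y] have "M.eqv k (f (us[i := x + y])) (p + r)"
      by (rule tr)
    then show "p + r \<in> ?\<phi> (us[i := x + y])"
      using p r us by (simp add: memI mpols_add del: restrict_apply restrict_apply')
  next
    fix us i x p and c
    assume us: "length us = k" "i < k" and p: "p \<in> ?\<phi> (us[i := x])"
    have "M.eqv k (M.S i (s c 1) (f (us[i := x]))) (M.S i (s c 1) p)"
      using p us by (intro M.cg_shift_act) (simp_all add: memI del: restrict_apply restrict_apply')
    with good_act[OF f us, of "s c 1" x] have "M.eqv k (f (us[i := actE (s c 1) x])) (M.S i (s c 1) p)"
      by (rule tr)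
    then show "Poly_Mapping.map (fscale s actM c) p \<in> ?\<phi> (us[i := fscale s actE c x])"
      unfolding fscale_map[of c p i] using p us by (simp add: memI M.mpols_S fscale_def[of s actE] del: restrict_apply restrict_apply')
  next
    fix as :: "'v poly list" and us p
    assume len: "length as = k" "length us = k" and p: "p \<in> ?\<phi> us"
    have fold: "fold (\<lambda>i. shift_act del actM i (bs ! i)) xs p \<in> mpols k
        \<and> M.eqv k (fold (\<lambda>i. shift_act del actM i (bs ! i)) xs r) (fold (\<lambda>i. shift_act del actM i (bs ! i)) xs p)"
      if "set xs \<subseteq> {..<k}" "p \<in> mpols k" "M.eqv k r p" for bs xs p r
      using that
    proof (induction xs arbitrary: p r)
      case (Cons i xs)
      have "shift_act del actM i (bs ! i) p \<in> mpols k"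
        and "M.eqv k (shift_act del actM i (bs ! i) r) (shift_act del actM i (bs ! i) p)"
        using Cons.prems by (simp_all add: M.mpols_shift_act M.cg_shift_act)
      from Cons.IH[OF _ this] Cons.prems show ?case by simp
    qed simp
    have "shift_acts del actM (map (pneg del) as) p \<in> mpols k \<and>
       M.eqv k (shift_acts del actM (map (pneg del) as) (f us)) (shift_acts del actM (map (pneg del) as) p)"
      unfolding shift_acts_def using p len by (intro fold) (simp_all add: memI atLeast0LessThan del: restrict_apply restrict_apply')
    then show "shift_acts del actM (map (pneg del) as) p \<in> ?\<phi> (map2 (dop actE DE) as us)"
      using len tr[OF good_shift_acts[OF f len]] by (simp add: memI del: restrict_apply restrict_apply')
  next
    have "M.skew k f" using f by (simp add: good_def)
    then show "skew_symmetric k ?\<phi>"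
      using M.skew_symmetric_iff[of k ?\<phi> f, OF q] memI good_mem[OF f] by (simp del: restrict_apply restrict_apply')
  qed
qed

end

section \<open>The operators occurring in the differential\<close>

lemma lin_to_poly_additive: "lin_to_poly s s' f \<Longrightarrow> additive f"
  by (simp add: lin_to_poly_def additive_def Vector_Spaces.linear_def module_hom_def module_hom_axioms_def)

lemma psum_hom:
  assumes "additive X" "\<And>p. X (v p) = v (X p)"
  shows "X (psum v H P) = psum v (\<lambda>c. X (H c)) P"
  unfolding psum_def by (simp add: additive.sum[OF assms(1)] funpow_commute assms(2))

lemma psum_plus:
  assumes "additive v"
  shows "psum v (\<lambda>c. H c + H' c) P = psum v H P + psum v H' P"
  unfolding psum_def by (simp add: additive.add[OF additive_funpow[OF assms]] sum.distrib)

lemma psum_map_poly: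
  assumes "additive v" "H 0 = 0" "f 0 = 0"
  shows "psum v H (map_poly f P) = psum v (\<lambda>c. H (f c)) P"
proof -
  have "degree (map_poly f P) \<le> degree P" by (intro degree_le) (simp add: coeff_map_poly assms coeff_eq_0)
  then have "psum v H (map_poly f P) = (\<Sum>n\<le>degree P. (v ^^ n) (H (coeff (map_poly f P) n)))"
    by (intro psum_bound assms)
  then show ?thesis by (simp add: psum_def coeff_map_poly assms)
qed

text \<open>Mapping the coefficients may lower the degree; the terms lost from the sum are powers of
  \<open>v\<close> applied to \<open>H 0\<close>, hence congruent to 0.\<close>

lemma psum_map_poly_cg:
  assumes Q: "additive Q" and v: "additive v" "\<And>r. v (Q r) = Q (v r)"
    and H: "cg Q (H 0) 0" and f: "f 0 = 0"
  shows "cg Q (psum v (\<lambda>c. H (f c)) P) (psum v H (map_poly f P))"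
proof -
  have "degree (map_poly f P) \<le> degree P" by (intro degree_le) (simp add: coeff_map_poly assms coeff_eq_0)
  from psum_cg_bound[of Q v H, OF Q v H this] show ?thesis
    by (simp add: psum_def coeff_map_poly f)
qed

lemma psum_pCons_0: "additive v \<Longrightarrow> H 0 = 0 \<Longrightarrow> psum v H (pCons 0 P) = v (psum v H P)"
  by (simp add: psum_pCons)

lemma plug_map_poly:
  assumes "additive v" "f 0 = 0"
  shows "plug v (map_poly f P) = psum v (\<lambda>c. single 0 (f c)) P"
  unfolding plug_psum by (rule psum_map_poly) (simp_all add: assms)

lemma psum_in_mpols:
  assumes "\<And>c. H c \<in> mpols k" "i < k"
  shows "psum (var i) H P \<in> mpols k"
  unfolding psum_def by (intro mpols_sum mpols_funpow_var assms)

section \<open>The differential on lists of arguments tagged with variables\<close>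

definition ops :: "('u \<times> nat) list \<Rightarrow> ('u \<times> ('m mpol \<Rightarrow> 'm::ab_group_add mpol)) list" where
  "ops xs = map (\<lambda>(u, i). (u, var i)) xs"

lemma ops_simps [simp]:
  "ops [] = []" "ops (x # xs) = (fst x, var (snd x)) # ops xs" "ops (xs @ ys) = ops xs @ ops ys"
  "length (ops xs) = length xs" "map fst (ops xs) = map fst xs" "map snd (ops xs) = map var (map snd xs)"
  by (simp_all add: ops_def case_prod_beta comp_def)

text \<open>Each argument is paired with what is substituted for its variable, so rearranging the
  pairs rearranges both at once.\<close>

definition subval :: "('u list \<Rightarrow> 'm mpol) \<Rightarrow> ('u \<times> ('m mpol \<Rightarrow> 'm mpol)) list \<Rightarrow> 'm::ab_group_add mpol" where
  "subval f ps = msub (map snd ps) (f (map fst ps))"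

definition act_term :: "('u \<Rightarrow> 'm \<Rightarrow> 'm poly) \<Rightarrow> ('u list \<Rightarrow> 'm mpol) \<Rightarrow> 'u \<times> nat \<Rightarrow> ('u \<times> nat) list \<Rightarrow> 'm::ab_group_add mpol" where
  "act_term lam f x ys = mext (\<lambda>m. plug (var (snd x)) (lam (fst x) m)) (subval f (ops ys))"

definition br_term :: "('u::zero \<Rightarrow> 'u \<Rightarrow> 'u poly) \<Rightarrow> ('u list \<Rightarrow> 'm mpol) \<Rightarrow> 'u \<times> nat \<Rightarrow> 'u \<times> nat \<Rightarrow> ('u \<times> nat) list
    \<Rightarrow> 'm::ab_group_add mpol" where
  "br_term br f x y zs = psum (var (snd x))
     (\<lambda>w. subval f ((w, \<lambda>p. var (snd x) p + var (snd y) p) # ops zs)) (br (fst x) (fst y))"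

text \<open>The differential of a representative function. The arguments are tagged with variable
  numbers in any order, so that alternation and renaming of variables become statements about one
  list.\<close>

definition dsum :: "('u::zero \<Rightarrow> 'm \<Rightarrow> 'm poly) \<Rightarrow> ('u \<Rightarrow> 'u \<Rightarrow> 'u poly) \<Rightarrow> ('u list \<Rightarrow> 'm mpol) \<Rightarrow> ('u \<times> nat) list
    \<Rightarrow> 'm::ab_group_add mpol" where
  "dsum lam br f xs = asum (act_term lam f) xs + asum2 (br_term br f) xs"

lemma cochain_diff_dsum:
  assumes "length us = Suc k"
  shows "cochain_diff lam br D k \<phi> us = cls D (Suc k) (dsum lam br (\<lambda>us. rep (\<phi> us)) (zip us [0..<Suc k]))"
proof -
  let ?xs = "zip us [0..<Suc k]" and ?vs = "map var [0..<Suc k]"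
  have fst: "map fst ?xs = us" and snd: "map snd ?xs = [0..<Suc k]"
    using assms by simp_all
  have nth: "?xs ! i = (us ! i, i)" if "i < Suc k" for i
    using that assms by (simp del: upt_Suc)
  have len: "length ?xs = Suc k" using assms by simp
  have fst': "map fst (omit i ?xs) = omit i us" "map fst (omit i (omit j ?xs)) = omit i (omit j us)" for i j
    by (simp_all only: fst flip: omit_map)
  have snd': "map var (map snd (omit i ?xs)) = omit i ?vs" "map var (map snd (omit i (omit j ?xs))) = omit i (omit j ?vs)" for i j
    by (simp_all only: snd flip: omit_map)
  show ?thesis
    unfolding cochain_diff_def dsum_def asum_index asum2_index len
    using assms
    by (simp add: Let_def nth act_term_def br_term_def subval_def fst' snd' psum_def del: upt_Suc sum.lessThan_Suc map_map
        cong: sum.cong_simp)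
qed

section \<open>The action of one argument on polynomial values\<close>

context lcad_module
begin

sublocale cochain_modules s del actE DE actM DM ..

abbreviation DDM :: "'m mpol \<Rightarrow> 'm mpol" where "DDM \<equiv> Poly_Mapping.map DM"

definition Lop :: "nat \<Rightarrow> 'e \<Rightarrow> 'm mpol \<Rightarrow> 'm mpol" where
  "Lop i u = mext (\<lambda>m. plug (var i) (lam u m))"

lemma additive_anchor: "additive (anchor u)"
  using anchor_cder[of u] by (auto simp: conformal_derivation_def intro: lin_to_poly_additive)

lemma anchor_del: "anchor u (del a) = map_poly del (anchor u a) + pCons 0 (anchor u a)"
  using anchor_cder[of u] by (simp add: conformal_derivation_def)

lemma anchor_one: "anchor u 1 = 0"
proof -
  have "anchor u (1 * 1) = smult 1 (anchor u 1) + smult 1 (anchor u 1)"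
    using anchor_cder[of u] unfolding conformal_derivation_def by blast
  then show ?thesis by simp
qed

lemma additive_lam_right: "additive (lam u)"
  using lam_linear_right[of u] by (rule lin_to_poly_additive)

lemma additive_lam_left: "additive (\<lambda>u. lam u m)"
  using lam_linear_left[of m] by (rule lin_to_poly_additive)

lemma additive_br_right: "additive (br u)"
  using lca.br_linear_right[of u] by (rule lin_to_poly_additive)

lemma lam_act_right: "lam u (actM a m) = map_poly (actM a) (lam u m) + map_poly (\<lambda>f. actM f m) (anchor u a)"
  using lam_dop_right[of u "[:a:]" m] by (simp add: leibniz_dop_def)

lemma br_act_right: "br u (actE a v) = map_poly (actE a) (br u v) + map_poly (\<lambda>f. actE f v) (anchor u a)"
  using br_dop[of u "[:a:]" v] by (simp add: leibniz_dop_def)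

text \<open>The Leibniz rule at the symbol of \<open>\<partial>\<close>; the anchor contributes its
  value at 1, which vanishes as for any derivation.\<close>

lemma lam_D_right: "lam u (DM m) = map_poly DM (lam u m) + pCons 0 (lam u m)"
proof -
  have 0: "map_poly (actM 0) p = 0" for p by (simp add: poly_eq_iff coeff_map_poly)
  have 1: "map_poly (actM 1) p = p" for p by (simp add: poly_eq_iff coeff_map_poly)
  show ?thesis
    using lam_dop_right[of u "[:0, 1:]" m]
    by (simp add: leibniz_dop_def M.dop_X anchor_one additive.zero[OF additive_anchor] 0 1 add.commute)
qed

lemma plug_var_lift:
  fixes P :: "'m poly"
  shows "msub [var i] (plug (var 0) P) = plug (var i) P"
  by (induction P) (simp_all add: plug_pCons additive_var additive.add[OF additive_msub] additive.zero[OF additive_msub]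
      lin_var msub_var)

end

context diff_module
begin

text \<open>Models a substituend without the variable \<open>j\<close>; \<open>shifts j\<close>
  models one that contains it exactly once and so obeys the commutation rule of
  \<open>var j\<close>.\<close>

definition frees :: "nat \<Rightarrow> ('m mpol \<Rightarrow> 'm mpol) \<Rightarrow> bool" where
  "frees j L \<longleftrightarrow> (\<forall>c q. S j c (L q) = L (S j c q))"

definition shifts :: "nat \<Rightarrow> ('m mpol \<Rightarrow> 'm mpol) \<Rightarrow> bool" where
  "shifts j L \<longleftrightarrow> (\<forall>c q. S j c (L q) = L (S j c q) + S j (del c) q)"

lemma frees_var: "i \<noteq> j \<Longrightarrow> frees j (var i)"
  by (simp add: frees_def S_var_other)

lemma shifts_var: "shifts j (var j)"
  by (simp add: shifts_def S_var_same)

lemma shifts_add: "i \<noteq> j \<Longrightarrow> shifts j (\<lambda>p. var i p + var j p)"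
  by (simp add: shifts_def S_var_same S_var_other S_padd)

text \<open>As no substituend except that of slot \<open>l\<close> involves the variable
  \<open>j\<close>, every commutator with \<open>S j\<close> comes from slot \<open>l\<close>, where
  it matches the commutator of \<open>S l\<close> with \<open>var l\<close>.\<close>

lemma msub_S:
  assumes p: "p \<in> mpols (length Ls)" and Ls: "set Ls \<subseteq> lin" and l: "l < length Ls" "shifts j (Ls ! l)"
    and fr: "\<And>l'. l' < length Ls \<Longrightarrow> l' \<noteq> l \<Longrightarrow> frees j (Ls ! l')"
  shows "msub Ls (S l c p) = S j c (msub Ls p)"
  using p
proof (induction arbitrary: c rule: mpols_induct)
  case (const a)
  then show ?case using Ls by simp
next
  case (var i p)
  have add: "(Ls ! i) (p + q) = (Ls ! i) p + (Ls ! i) q" for p q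
    using Ls var(1) by (intro additive.add additive_lin) auto
  show ?case
  proof (cases "i = l")
    case True
    then show ?thesis
      using l var by (simp add: S_var_same msub_var[OF Ls] additive.add[OF additive_msub[OF Ls]] shifts_def)
  next
    case False
    then show ?thesis
      using fr[OF var(1)] var by (simp add: S_var_other msub_var[OF Ls] frees_def)
  qed
next
  case (add p q)
  then show ?case by (simp add: S_padd additive.add[OF additive_msub[OF Ls]])
qed

lemma S_plug:
  assumes "i \<noteq> j"
  shows "S j b (plug (var i) P) = plug (var i) (map_poly (act b) P)"
  by (induction P) (simp_all add: plug_pCons additive_var S_padd S_pzero S_var_other assms[symmetric] map_poly_pCons)

lemma DD_plug: "DD (plug (var i) P) = plug (var i) (map_poly D P)"
  by (induction P) (simp_all add: plug_pCons additive_var additive.add[OF additive_DD] additive.zero[OF additive_DD]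
     DD_const DD_var map_poly_pCons additive.zero[OF additive_D])

end

context lcad_module
begin

lemma additive_plug_lam: "additive (\<lambda>m. plug (var i) (lam u m))"
  by (rule additive_comp[OF additive_plug[OF additive_var] additive_lam_right])

lemma additive_Lop: "additive (Lop i u)"
  unfolding Lop_def by (rule additive_mext[OF additive_plug_lam])

lemma Lop_const: "Lop i u (single 0 m) = plug (var i) (lam u m)"
  unfolding Lop_def by (rule mext_const[OF additive_plug_lam])

lemma Lop_var: "Lop i u (var j p) = var j (Lop i u p)"
  unfolding Lop_def by (rule mext_var[OF additive_plug_lam])

lemmas Lop_padd = additive.add[OF additive_Lop]

lemma Lop_lin: "L \<in> lin \<Longrightarrow> Lop i u (L p) = L (Lop i u p)"
  by (induction rule: lin.induct) (simp_all add: Lop_var Lop_padd)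

lemma Lop_DD: "Lop i u (DDM p) = DDM (Lop i u p) + var i (Lop i u p)"
proof (induction p rule: mpol_induct)
  case (const a)
  show ?case
    by (simp add: M.DD_const Lop_const lam_D_right additive.add[OF additive_plug] additive_var plug_pCons M.DD_plug)
qed (simp_all add: M.DD_var Lop_var Lop_padd var_add var_commute[of _ i] additive.add[OF M.additive_DD] algebra_simps)

text \<open>Sesquilinearity turns \<open>DM\<close> into \<open>DM\<close> plus
  \<open>var i\<close>, so the action supplies the variable missing from the remaining arguments,
  and action terms are well defined in the larger quotient.\<close>

lemma Lop_QL: "set Ls \<subseteq> lin \<Longrightarrow> Lop i u (M.QL Ls p) = M.QL (var i # Ls) (Lop i u p)"
proof (induction Ls)
  case Nil
  then show ?case by (simp add: M.QL_def Lop_DD)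
next
  case (Cons L Ls)
  then show ?case by (simp add: M.QL_Cons Lop_padd Lop_lin[of L])
qed

lemma cg_Lop: "set Ls \<subseteq> lin \<Longrightarrow> cg (M.QL Ls) p q \<Longrightarrow> cg (M.QL (var i # Ls)) (Lop i u p) (Lop i u q)"
  by (rule cg_apply[of "Lop i u" "M.QL Ls" "M.QL (var i # Ls)", OF additive_Lop Lop_QL])

lemma Lop_add: "Lop i (u + v) p = Lop i u p + Lop i v p"
proof (induction p rule: mpol_induct)
  case (const a)
  show ?case by (simp add: Lop_const additive.add[OF additive_lam_left] additive.add[OF additive_plug] additive_var)
qed (simp_all add: Lop_var Lop_padd var_add)

text \<open>The axiom is stated in variable 0 and is renamed to variable \<open>i\<close> by a
  substitution, which carries \<open>S 0\<close> to \<open>S i\<close> on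
  \<open>mpols 1\<close>.\<close>

lemma plug_lam_dop_left:
  "plug (var i) (lam (dop actE DE b u) m) = shift_act del actM i (pneg del b) (plug (var i) (lam u m))"
proof -
  have S: "msub [var i] (M.S 0 a p) = M.S i a (msub [var i] p)" if "p \<in> mpols 1" for a p
    using M.msub_S[of p "[var i]" 0 i a] that by (simp add: lin_var M.shifts_var)
  have *: "msub [var i] (shift_act del actM 0 b p) = shift_act del actM i b (msub [var i] p)" if "p \<in> mpols 1" for b p
  proof (induction b)
    case (pCons a b)
    then show ?case
      using that by (simp add: M.shift_act_pCons[of _ a b] additive.add[OF additive_msub] S lin_var msub_var)
  qed (simp add: additive.zero[OF additive_msub] lin_var)
  have "plug (var i) (lam (dop actE DE b u) m) = msub [var i] (plug (var 0) (lam (dop actE DE b u) m))"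
    by (simp add: plug_var_lift)
  then show ?thesis
    by (simp add: lam_dop_left * mpols_plug_var plug_var_lift)
qed

lemma Lop_D: "Lop i (DE u) p = - var i (Lop i u p)"
proof (induction p rule: mpol_induct)
  case (const a)
  show ?case
    using plug_lam_dop_left[of i "[:0, 1:]" u a] by (simp add: Lop_const dop_X M.shift_act_pneg_X)
qed (simp_all add: Lop_var Lop_padd var_add var_commute[of _ i] var_uminus)

text \<open>Freshness of \<open>i\<close> ensures that \<open>S i a\<close> sees only the powers of
  \<open>var i\<close> produced by the action of \<open>u\<close>.\<close>

lemma Lop_act:
  assumes "p \<in> mpols (length js)" "i \<notin> set js"
  shows "Lop i (actE a u) (msub (map var js) p) = M.S i a (Lop i u (msub (map var js) p))"
  using assms(1)
proof (induction rule: mpols_induct)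
  case (const m)
  then show ?case
    using plug_lam_dop_left[of i "[:a:]" u m] by (simp add: Lop_const)
next
  case (var l p)
  moreover have "js ! l \<noteq> i" using var assms(2) by auto
  ultimately show ?case by (simp add: msub_var Lop_var M.S_var_other)
next
  case (add p q)
  then show ?case by (simp add: additive.add[OF additive_msub] Lop_padd M.S_padd)
qed

text \<open>Passing a coefficient \<open>b\<close> of the argument in position \<open>j\<close> through the action of \<open>u\<close> in position \<open>i\<close>
  produces, besides the action itself, a term in which \<open>\<lambda>\<^sub>j\<close> is replaced by \<open>\<lambda>\<^sub>i + \<lambda>\<^sub>j\<close>.
  It is this term that the anchor part of the Leibniz rule for the bracket cancels.\<close>

lemma Lop_S:
  assumes "p \<in> mpols (Suc (length js))" "i \<noteq> j" "j \<notin> set js"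
  defines "Ls \<equiv> map var js @ [var j]" and "Ls' \<equiv> map var js @ [\<lambda>p. var i p + var j p]"
  shows "Lop i u (msub Ls (M.S (length js) b p)) = M.S j b (Lop i u (msub Ls p))
     + psum (var i) (\<lambda>c. msub Ls' (M.S (length js) c p)) (anchor u b)"
proof -
  have Ls: "set Ls \<subseteq> lin" "length Ls = Suc (length js)" and Ls': "set Ls' \<subseteq> lin" "length Ls' = Suc (length js)"
    by (auto simp: Ls_def Ls'_def intro: lin_add lin_var)
  let ?m = "length js"
  note simps = msub_var[OF Ls(1)] msub_var[OF Ls'(1)] additive.add[OF additive_msub[OF Ls(1)]]
    additive.add[OF additive_msub[OF Ls'(1)]] Ls(2) Ls'(2)
  show ?thesis
    using assms(1)
  proof (induction arbitrary: b rule: mpols_induct)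
    case (const m)
    have "psum (var i) (\<lambda>c. single 0 (actM c m)) (anchor u b) = plug (var i) (map_poly (\<lambda>f. actM f m) (anchor u b))"
      by (simp add: plug_map_poly additive_var)
    then show ?case
      using Ls Ls' assms(2)
      by (simp add: Lop_const lam_act_right additive.add[OF additive_plug] additive_var M.S_plug)
  next
    case (var l p)
    show ?case
    proof (cases "l = ?m")
      case False
      then have l: "l < ?m" using var by simp
      then have nth: "Ls ! l = var (js ! l)" "Ls' ! l = var (js ! l)" "j \<noteq> js ! l"
        using assms(3) by (auto simp: Ls_def Ls'_def nth_append)
      have "psum (var i) (\<lambda>c. msub Ls' (M.S ?m c (var l p))) (anchor u b)
          = var (js ! l) (psum (var i) (\<lambda>c. msub Ls' (M.S ?m c p)) (anchor u b))"
        using l by (subst psum_hom) (simp_all add: additive_var var_commute M.S_var_other simps nth)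
      then show ?thesis
        using l var by (simp add: M.S_var_other simps nth Lop_var var_add)
    next
      case True
      have nth: "Ls ! ?m = var j" "Ls' ! ?m = (\<lambda>p. var i p + var j p)"
        by (simp_all add: Ls_def Ls'_def nth_append)
      let ?R = "\<lambda>b. psum (var i) (\<lambda>c. msub Ls' (M.S ?m c p)) (anchor u b)"
      have add: "additive (\<lambda>c. msub Ls' (M.S ?m c p))"
        by (rule additive_comp[OF additive_msub[OF Ls'(1)] M.additive_S_coeff])
      \<comment> \<open>The anchor commutes with \<open>\<partial>\<close> up to
        \<open>var i\<close>, so the derivative of \<open>b\<close> yields an extra
        \<open>var i\<close>; together with \<open>var j\<close> it forms the substituend of the
        last slot in \<open>Ls'\<close>.\<close>
      have "?R (del b) = psum (var i) (\<lambda>c. msub Ls' (M.S ?m (del c) p)) (anchor u b) + var i (?R b)"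
        unfolding anchor_del
        by (simp add: additive.add[OF additive_psum[OF additive_var add]] psum_pCons_0[OF additive_var]
            psum_map_poly[OF additive_var] additive.zero[OF add] additive.zero[OF additive_msub[OF Ls'(1)]])
      moreover have "psum (var i) (\<lambda>c. msub Ls' (M.S ?m c (var ?m p))) (anchor u b)
          = (var i (?R b) + var j (?R b)) + psum (var i) (\<lambda>c. msub Ls' (M.S ?m (del c) p)) (anchor u b)"
      proof -
        have "(\<lambda>c. msub Ls' (M.S ?m c (var ?m p)))
            = (\<lambda>c. (var i (msub Ls' (M.S ?m c p)) + var j (msub Ls' (M.S ?m c p))) + msub Ls' (M.S ?m (del c) p))"
          by (simp add: M.S_var_same simps nth)
        then show ?thesis
          by (simp only: psum_plus[OF additive_var] psum_hom[of "var i" "var i", OF additive_var var_commute]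
              psum_hom[of "var j" "var i", OF additive_var var_commute])
      qed
      ultimately show ?thesis
        using True var by (simp add: M.S_var_same simps nth Lop_var Lop_padd var_add algebra_simps)
    qed
  next
    case (add p q)
    have "psum (var i) (\<lambda>c. msub Ls' (M.S ?m c (p + q))) (anchor u b)
       = psum (var i) (\<lambda>c. msub Ls' (M.S ?m c p)) (anchor u b) + psum (var i) (\<lambda>c. msub Ls' (M.S ?m c q)) (anchor u b)"
      by (simp add: M.S_padd simps psum_plus[OF additive_var])
    then show ?case using add by (simp add: M.S_padd Lop_padd simps)
  qed
qed

end

section \<open>The differential of an LCAd cochain\<close>

lemma psum_cg_zero:
  fixes H :: "'a::ab_group_add \<Rightarrow> 'b::ab_group_add"
  assumes Q: "additive Q" and H: "\<And>a b. cg Q (H (a + b)) (H a + H b)"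
  shows "cg Q (H 0) 0"
proof -
  have "cg Q (H 0 - H 0) (H 0 + H 0 - H 0)"
    using H[of 0 0] by (intro cg_diff Q cg_refl) simp
  then have "cg Q 0 (H 0)" by simp
  then show ?thesis by (rule cg_sym[OF Q])
qed

lemma psum_cg_uminus:
  fixes H :: "'a::ab_group_add \<Rightarrow> 'b::ab_group_add"
  assumes Q: "additive Q" and v: "additive v" "\<And>r. v (Q r) = Q (v r)"
    and H: "\<And>a b. cg Q (H (a + b)) (H a + H b)"
  shows "cg Q (psum v H (- P)) (- psum v H P)"
proof -
  note [trans] = cg_trans[OF Q]
  have "cg Q (psum v H P + psum v H (- P)) (psum v H (P + - P))"
    by (rule cg_sym[OF Q psum_cg_add[of Q v H, OF Q v H]])
  also have "psum v H (P + - P) = H 0" by simp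
  also have "cg Q (H 0) 0" by (rule psum_cg_zero[of Q H, OF Q H])
  finally have "cg Q (psum v H P + psum v H (- P) - psum v H P) (0 - psum v H P)"
    by (intro cg_diff Q cg_refl)
  then show ?thesis by simp
qed

text \<open>Since \<open>D\<close> under \<open>H\<close> acts as \<open>- (v' + v)\<close>, the
  operator \<open>- \<lambda> - \<partial>\<close> becomes \<open>- v + (v' + v) = v'\<close>. This
  is how the skew-symmetry of the bracket exchanges two variables.\<close>

lemma psum_pneg:
  assumes Q: "additive Q" and D: "additive D"
    and v: "additive v" "\<And>r. v (Q r) = Q (v r)" and v': "additive v'" "\<And>r. v' (Q r) = Q (v' r)"
    and vv': "\<And>p. v (v' p) = v' (v p)"
    and H: "\<And>a b. cg Q (H (a + b)) (H a + H b)"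
    and HD: "\<And>w. cg Q (H (D w)) (- (v' (H w) + v (H w)))"
  shows "cg Q (psum v H (pneg D P)) (psum v' H P)"
proof -
  note [trans] = cg_trans[OF Q]
  have H0: "cg Q (H 0) 0" by (rule psum_cg_zero[of Q H, OF Q H])
  note add = psum_cg_add[of Q v H, OF Q v H] and um = psum_cg_uminus[of Q v H, OF Q v H]
  have step: "cg Q (psum v H (- pCons 0 R - map_poly D R)) (v' (psum v H R))" for R
  proof -
    have "cg Q (psum v H (- pCons 0 R + - map_poly D R)) (psum v H (- pCons 0 R) + psum v H (- map_poly D R))"
      by (rule add)
    also have "cg Q \<dots> (- psum v H (pCons 0 R) + - psum v H (map_poly D R))"
      by (intro cg_add[OF Q] um)
    also have "cg Q \<dots> (- (H 0 + v (psum v H R)) + - psum v (\<lambda>w. H (D w)) R)"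
      by (intro cg_add[OF Q] cg_uminus[OF Q] psum_cg_pCons[of Q v H, OF Q v H0]
          cg_sym[OF Q psum_map_poly_cg[of Q v H D, OF Q v H0]] additive.zero[OF D])
    also have "cg Q \<dots> (- (0 + v (psum v H R)) + - psum v (\<lambda>w. - (v' (H w) + v (H w))) R)"
      by (intro cg_add[OF Q] cg_uminus[OF Q] psum_cong_cg[of Q v, OF Q v] HD H0 cg_refl[OF Q])
    also have "psum v (\<lambda>w. - (v' (H w) + v (H w))) R = - (v' (psum v H R) + v (psum v H R))"
      using v v' vv'
      by (intro psum_hom[of "\<lambda>p. - (v' p + v p)" v, symmetric] additive_uminus additive_plus)
        (simp_all add: additive.minus additive.diff)
    finally show ?thesis by simp
  qed
  show ?thesis
  proof (induction P)
    case 0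
    have "pneg D 0 = 0" by (simp add: pneg_def)
    then show ?case using Q by simp
  next
    case (pCons a P)
    have "cg Q (psum v H (pneg D (pCons a P))) (psum v H [:a:] + psum v H (- pCons 0 (pneg D P) - map_poly D (pneg D P)))"
      unfolding pneg_pCons[OF D] by (rule add)
    also have "cg Q \<dots> (H a + v' (psum v H (pneg D P)))"
      by (intro cg_add[OF Q] step) (simp add: Q)
    also have "cg Q \<dots> (H a + v' (psum v' H P))"
      by (intro cg_add[OF Q cg_refl[OF Q]] cg_apply[of v' Q Q, OF v' pCons.IH])
    also have "cg Q \<dots> (psum v' H (pCons a P))"
      by (rule cg_sym[OF Q psum_cg_pCons[of Q v' H, OF Q v' H0]])
    finally show ?case .
  qed
qed

lemma asum_closed:
  assumes "\<And>x ys. mset (x # ys) = mset xs \<Longrightarrow> T x ys \<in> A" "0 \<in> A" "\<And>a b. a \<in> A \<Longrightarrow> b \<in> A \<Longrightarrow> a - b \<in> A"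
  shows "asum T xs \<in> A"
  using assms(1)
proof (induction xs arbitrary: T)
  case (Cons x xs)
  show ?case
    unfolding asum.simps by (intro assms(3) Cons.IH Cons.prems) simp_all
qed (use assms in simp)

lemma asum2_closed:
  assumes "\<And>x y ys. mset (x # y # ys) = mset xs \<Longrightarrow> B x y ys \<in> A" "0 \<in> A" "\<And>a b. a \<in> A \<Longrightarrow> b \<in> A \<Longrightarrow> a - b \<in> A"
  shows "asum2 B xs \<in> A"
  using assms(1)
proof (induction xs arbitrary: B)
  case (Cons x xs)
  show ?case
    unfolding asum2.simps
    by (intro assms(2,3) Cons.IH asum_closed Cons.prems) (simp_all add: add_mset_commute)
qed (use assms in simp)

lemma map_transpose_append:
  "n = Suc (Suc (length As + length Bs)) \<Longrightarrow>
    map (\<lambda>i. (As @ L # L' # Bs) ! transpose (length As) (Suc (length As)) i) [0..<n] = As @ L' # L # Bs"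
  by (intro nth_equalityI) (auto simp: nth_append nth_Cons' transpose_def simp del: upt_Suc)

section \<open>Values of a cochain at substituted variables\<close>

context cochain_modules
begin

context
  fixes k f
  assumes f: "good k f"
begin

lemma subval_add:
  assumes "length ps + length ps' + 1 = k" "set (map snd ps) \<subseteq> lin" "set (map snd ps') \<subseteq> lin" "L \<in> lin"
  shows "cg (M.QL (map snd ps @ L # map snd ps')) (subval f (ps @ (x + y, L) # ps'))
    (subval f (ps @ (x, L) # ps') + subval f (ps @ (y, L) # ps'))"
proof -
  let ?Ls = "map snd ps @ L # map snd ps'" and ?us = "map fst ps @ x # map fst ps'"
  have Ls: "set ?Ls \<subseteq> lin" "length ?Ls = k" using assms by auto
  have "cg (M.QL ?Ls) (msub ?Ls (f (?us[length ps := x + y])))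
      (msub ?Ls (f (?us[length ps := x]) + f (?us[length ps := y])))"
    using Ls assms good_add[OF f, of ?us "length ps" x y] by (intro M.msub_cg) simp_all
  then show ?thesis
    by (simp add: subval_def additive.add[OF additive_msub[OF Ls(1)]] list_update_append)
qed

lemma subval_D:
  assumes "length ps + length ps' + 1 = k" "set (map snd ps) \<subseteq> lin" "set (map snd ps') \<subseteq> lin" "L \<in> lin"
  shows "cg (M.QL (map snd ps @ L # map snd ps')) (subval f (ps @ (DE x, L) # ps')) (- L (subval f (ps @ (x, L) # ps')))"
proof -
  let ?Ls = "map snd ps @ L # map snd ps'" and ?us = "map fst ps @ x # map fst ps'"
  have Ls: "set ?Ls \<subseteq> lin" "length ?Ls = k" using assms by auto
  have "cg (M.QL ?Ls) (msub ?Ls (f (?us[length ps := DE x]))) (msub ?Ls (- var (length ps) (f (?us[length ps := x]))))"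
    using Ls assms good_D[OF f, of ?us "length ps" x] by (intro M.msub_cg) simp_all
  then show ?thesis
    using msub_var[OF Ls(1), of "length ps"] assms
    by (simp add: subval_def additive.minus[OF additive_msub[OF Ls(1)]] list_update_append nth_append)
qed

text \<open>The shifted multiplication remains inside the substitution, as \<open>L\<close> may mix
  several variables; \<open>subval_act_S\<close> pulls it out when only \<open>L\<close> involves
  the variable in question.\<close>

lemma subval_act:
  assumes "length ps + length ps' + 1 = k" "set (map snd ps) \<subseteq> lin" "set (map snd ps') \<subseteq> lin" "L \<in> lin"
  shows "cg (M.QL (map snd ps @ L # map snd ps')) (subval f (ps @ (actE a x, L) # ps'))
    (msub (map snd ps @ L # map snd ps') (M.S (length ps) a (f (map fst ps @ x # map fst ps'))))"
proof -
  let ?Ls = "map snd ps @ L # map snd ps'" and ?us = "map fst ps @ x # map fst ps'"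
  have Ls: "set ?Ls \<subseteq> lin" "length ?Ls = k" using assms by auto
  have "cg (M.QL ?Ls) (msub ?Ls (f (?us[length ps := actE a x]))) (msub ?Ls (M.S (length ps) a (f (?us[length ps := x]))))"
    using Ls assms good_act[OF f, of ?us "length ps" a x] by (intro M.msub_cg) simp_all
  then show ?thesis by (simp add: subval_def list_update_append)
qed

lemma subval_act_S:
  assumes len: "length ps + length ps' + 1 = k" and lin: "set (map snd ps) \<subseteq> lin" "set (map snd ps') \<subseteq> lin" "L \<in> lin"
    and j: "M.shifts j L" "\<And>L'. L' \<in> set (map snd ps) \<union> set (map snd ps') \<Longrightarrow> M.frees j L'"
  shows "cg (M.QL (map snd ps @ L # map snd ps')) (subval f (ps @ (actE a x, L) # ps')) (M.S j a (subval f (ps @ (x, L) # ps')))"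
proof -
  let ?Ls = "map snd ps @ L # map snd ps'"
  have "msub ?Ls (M.S (length ps) a (f (map fst ps @ x # map fst ps'))) = M.S j a (msub ?Ls (f (map fst ps @ x # map fst ps')))"
  proof (rule M.msub_S)
    show "f (map fst ps @ x # map fst ps') \<in> mpols (length ?Ls)"
      using good_mem[OF f, of "map fst ps @ x # map fst ps'"] len by simp
    show "M.shifts j (?Ls ! length ps)" using j by (simp add: nth_append)
    fix l assume l: "l < length ?Ls" "l \<noteq> length ps"
    then have "?Ls ! l \<in> set (map snd ps) \<union> set (map snd ps')"
      by (auto simp: nth_append nth_Cons')
    then show "M.frees j (?Ls ! l)" by (rule j)
  qed (use lin in auto)
  then show ?thesis using subval_act[OF len lin, of a x] by (simp add: subval_def)
qed

text \<open>Skew-symmetry of \<open>f\<close> for an adjacent transposition exchanges the arguments,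
  and permuting the variables before the substitution exchanges the substituends.\<close>

lemma subval_alternating:
  assumes "length ps = k" "set (map snd ps) \<subseteq> lin"
  shows "alternating (M.QL (map snd ps)) (mset ps) (subval f)"
  unfolding alternating_def
proof (intro allI impI)
  fix As a b Bs assume ps: "mset (As @ a # b # Bs) = mset ps"
  let ?r = "length As" and ?\<pi> = "transpose (length As) (Suc (length As))"
  let ?Ls = "map snd (As @ a # b # Bs)" and ?us = "map fst (As @ a # b # Bs)"
  let ?Ls' = "map snd (As @ b # a # Bs)" and ?us' = "map fst (As @ b # a # Bs)"
  have len: "length (As @ a # b # Bs) = k" using ps assms(1) by (metis size_mset)
  have "set (As @ a # b # Bs) = set ps" using ps by (rule mset_eq_setD)
  then have lin: "set ?Ls \<subseteq> lin" "set ?Ls' \<subseteq> lin" using assms(2) by auto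
  have QL: "M.QL (map snd ps) = M.QL ?Ls"
    using ps by (intro M.QL_mset) (simp only: mset_map)
  have \<pi>: "?\<pi> permutes {..<k}" using len by (intro permutes_swap_id) auto
  have us': "permute_list ?\<pi> ?us = ?us'"
    using map_transpose_append[of _ "map fst As" "map fst Bs" "fst a" "fst b"] by (simp add: permute_list_def del: upt_Suc)
  have "M.eqv k (f ?us) (- msub (map (\<lambda>i. var (?\<pi> i)) [0..<k]) (f (permute_list ?\<pi> ?us)))"
    using good_skew[OF f, of ?us ?\<pi>] len \<pi> by (simp add: evenperm_swap)
  then have "cg (M.QL ?Ls) (msub ?Ls (f ?us)) (msub ?Ls (- msub (map (\<lambda>i. var (?\<pi> i)) [0..<k]) (f ?us')))"
    using lin len unfolding us' by (intro M.msub_cg) simp_all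
  also have "msub ?Ls (- msub (map (\<lambda>i. var (?\<pi> i)) [0..<k]) (f ?us')) = - msub (map (\<lambda>i. ?Ls ! ?\<pi> i) [0..<k]) (f ?us')"
    using lin len good_mem[OF f, of ?us'] permutes_image[OF \<pi>]
    by (subst additive.minus[OF additive_msub[OF lin(1)]], subst msub_msub[of _ k]) simp_all
  also have "map (\<lambda>i. ?Ls ! ?\<pi> i) [0..<k] = ?Ls'"
    using map_transpose_append[of k "map snd As" "map snd Bs" "snd a" "snd b"] len by (simp del: upt_Suc)
  finally show "cg (M.QL (map snd ps)) (subval f (As @ a # b # Bs)) (- subval f (As @ b # a # Bs))"
    unfolding QL subval_def .
qed

lemma subval_mem:
  assumes "length ps = k" "set (map snd ps) \<subseteq> lin" "\<And>L p. L \<in> set (map snd ps) \<Longrightarrow> p \<in> mpols l \<Longrightarrow> L p \<in> mpols l"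
  shows "subval f ps \<in> mpols l"
  unfolding subval_def using assms by (intro mpols_msub_all)

end

end

section \<open>Alternation of the differential\<close>

context lcad_module
begin

lemma act_term_Lop: "act_term lam f x ys = Lop (snd x) (fst x) (subval f (ops ys))"
  by (simp add: act_term_def Lop_def)

context
  fixes k f
  assumes f: "good k f"
begin

abbreviation (input) "QQ \<equiv> total_der DM (Suc k)"
abbreviation (input) "idx xs \<equiv> mset (map snd xs) = mset [0..<Suc k]"

lemma idx_QL: "idx xs \<Longrightarrow> M.QL (map var (map snd xs)) = QQ"
  unfolding M.total_der_QL by (intro M.QL_mset) (simp only: mset_map)

lemma idx_length: "idx xs \<Longrightarrow> length xs = Suc k"
  using arg_cong[of _ _ size] by (metis length_map length_upt minus_nat.diff_0 size_mset)

lemma idx_distinct: "idx xs \<Longrightarrow> distinct (map snd xs) \<and> set (map snd xs) = {..<Suc k}"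
  by (metis atLeast0LessThan atLeast_upt distinct_upt mset_eq_imp_distinct_iff mset_eq_setD set_upt)

lemma QQ_Cons: "idx (x # ys) \<Longrightarrow> M.QL (var (snd x) # map var (map snd ys)) = QQ"
  using idx_QL[of "x # ys"] by simp

text \<open>The two variables of the bracket enter as a sum, so the substituends of a bracket term
  still add up to all \<open>k + 1\<close> variables.\<close>

lemma QQ_head: "idx (x # y # zs) \<Longrightarrow> M.QL ((\<lambda>p. var (snd x) p + var (snd y) p) # map var (map snd zs)) = QQ"
  using idx_QL[of "x # y # zs"] by (simp add: fun_eq_iff M.QL_Cons add.assoc)

lemma QQ_var: "var i (QQ p) = QQ (var i p)"
  by (simp add: M.total_der_var)

abbreviation (input) "bh x y zs w \<equiv> subval f ((w, \<lambda>p. var (snd x) p + var (snd y) p) # ops zs)"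

lemma bh_add:
  assumes "idx (x # y # zs)"
  shows "cg QQ (bh x y zs (v + w)) (bh x y zs v + bh x y zs w)"
  using subval_add[OF f, of "[]" "ops zs" "\<lambda>p. var (snd x) p + var (snd y) p" v w] idx_length[OF assms] QQ_head[OF assms]
  by (simp add: lin_add lin_var)

lemma bh_zero: "idx (x # y # zs) \<Longrightarrow> cg QQ (bh x y zs 0) 0"
  by (rule psum_cg_zero[of QQ "bh x y zs", OF M.additive_total_der bh_add])

lemma bh_D:
  assumes "idx (x # y # zs)"
  shows "cg QQ (bh x y zs (DE w)) (- (var (snd x) (bh x y zs w) + var (snd y) (bh x y zs w)))"
  using subval_D[OF f, of "[]" "ops zs" "\<lambda>p. var (snd x) p + var (snd y) p" w] idx_length[OF assms] QQ_head[OF assms]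
  by (simp add: lin_add lin_var)

text \<open>In the slot of the bracket \<open>DE\<close> acts as minus the sum of the two variables,
  so \<open>- \<lambda> - \<partial>\<close> in the skew-symmetry of the bracket replaces the
  variable of \<open>y\<close> by that of \<open>x\<close>.\<close>

lemma br_term_skew:
  assumes "idx (x # y # zs)"
  shows "cg QQ (br_term br f x y zs) (- br_term br f y x zs)"
proof -
  note T = M.additive_total_der
  note [trans] = cg_trans[OF T]
  have idx': "idx (y # x # zs)" using assms by (simp add: add_mset_commute)
  have eq: "bh y x zs = bh x y zs" by (simp add: add.commute)
  have pneg: "cg QQ (psum (var (snd y)) (bh x y zs) (pneg DE P)) (psum (var (snd x)) (bh x y zs) P)" for P
    by (rule psum_pneg[of QQ DE "var (snd y)" "var (snd x)" "bh x y zs", OF T additive_D additive_var QQ_var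
          additive_var QQ_var var_commute bh_add[OF assms] bh_D[OF assms]])
  have "cg QQ (br_term br f y x zs) (- psum (var (snd y)) (bh x y zs) (pneg DE (br (fst x) (fst y))))"
    unfolding br_term_def eq lca.br_skew[of "fst y" "fst x"]
    by (rule psum_cg_uminus[of QQ "var (snd y)" "bh x y zs", OF T additive_var QQ_var bh_add[OF assms]])
  also have "cg QQ \<dots> (- br_term br f x y zs)"
    unfolding br_term_def by (rule cg_uminus[OF T pneg])
  finally have "cg QQ (br_term br f y x zs) (- br_term br f x y zs)" .
  from cg_uminus[OF T cg_sym[OF T this]] show ?thesis by simp
qed

lemma br_term_swap:
  assumes "idx (x # y # As @ a # b # Bs)"
  shows "cg QQ (br_term br f x y (As @ a # b # Bs)) (- br_term br f x y (As @ b # a # Bs))"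
proof -
  note T = M.additive_total_der
  let ?h = "\<lambda>p. var (snd x) p + var (snd y) p"
  have "cg QQ (subval f ((w, ?h) # ops (As @ a # b # Bs))) (- subval f ((w, ?h) # ops (As @ b # a # Bs)))" for w
  proof -
    have "alternating (M.QL (map snd ((w, ?h) # ops (As @ a # b # Bs)))) (mset ((w, ?h) # ops (As @ a # b # Bs))) (subval f)"
      using idx_length[OF assms] by (intro subval_alternating[OF f]) (auto intro: lin_add lin_var)
    from alternatingD[OF this, of "(w, ?h) # ops As" "(fst a, var (snd a))" "(fst b, var (snd b))" "ops Bs"]
    show ?thesis using QQ_head[OF assms] by simp
  qed
  then have "cg QQ (br_term br f x y (As @ a # b # Bs))
      (psum (var (snd x)) (\<lambda>w. - subval f ((w, ?h) # ops (As @ b # a # Bs))) (br (fst x) (fst y)))"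
    unfolding br_term_def by (intro psum_cong_cg T additive_var QQ_var)
  also have "\<dots> = - br_term br f x y (As @ b # a # Bs)"
    unfolding br_term_def
    by (intro psum_hom[of uminus "var (snd x)", symmetric]) (simp_all add: additive_def var_uminus)
  finally show ?thesis .
qed

lemma act_term_swap:
  assumes "idx (x # As @ a # b # Bs)"
  shows "cg QQ (act_term lam f x (As @ a # b # Bs)) (- act_term lam f x (As @ b # a # Bs))"
proof -
  have "alternating (M.QL (map snd (ops (As @ a # b # Bs)))) (mset (ops (As @ a # b # Bs))) (subval f)"
    using idx_length[OF assms] by (intro subval_alternating[OF f]) (auto intro: lin_var)
  from alternatingD[OF this, of "ops As" "(fst a, var (snd a))" "(fst b, var (snd b))" "ops Bs"]
  have "cg (M.QL (map var (map snd (As @ a # b # Bs)))) (subval f (ops (As @ a # b # Bs))) (- subval f (ops (As @ b # a # Bs)))"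
    by simp
  then have "cg (M.QL (var (snd x) # map var (map snd (As @ a # b # Bs))))
      (Lop (snd x) (fst x) (subval f (ops (As @ a # b # Bs)))) (Lop (snd x) (fst x) (- subval f (ops (As @ b # a # Bs))))"
    by (intro cg_Lop) (auto intro: lin_var)
  then show ?thesis
    unfolding QQ_Cons[OF assms] by (simp add: act_term_Lop additive.minus[OF additive_Lop])
qed

lemma dsum_alternating:
  assumes "image_mset snd N = mset [0..<Suc k]"
  shows "alternating QQ N (dsum lam br f)"
  unfolding alternating_def
proof (intro allI impI)
  fix ys a b zs assume N: "mset (ys @ a # b # zs) = N"
  have idx: "idx xs" if "mset xs = N" for xs :: "('e \<times> nat) list" using assms that by simp
  note T = M.additive_total_der
  have "cg QQ (asum (act_term lam f) (ys @ a # b # zs)) (- asum (act_term lam f) (ys @ b # a # zs))"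
    by (rule asum_swap[OF T _ N]) (intro act_term_swap idx)
  moreover have "cg QQ (asum2 (br_term br f) (ys @ a # b # zs)) (- asum2 (br_term br f) (ys @ b # a # zs))"
    by (rule asum2_swap[OF T _ _ N]) (intro br_term_swap br_term_skew idx; assumption)+
  ultimately have "cg QQ (dsum lam br f (ys @ a # b # zs))
      (- asum (act_term lam f) (ys @ b # a # zs) + - asum2 (br_term br f) (ys @ b # a # zs))"
    unfolding dsum_def by (intro cg_add[OF T])
  then show "cg QQ (dsum lam br f (ys @ a # b # zs)) (- dsum lam br f (ys @ b # a # zs))"
    by (simp add: dsum_def)
qed

lemma dsum_append1:
  "dsum lam br f (xs @ [z]) =
     (asum (\<lambda>y ys. act_term lam f y (ys @ [z])) xs + alt (length xs) (act_term lam f z xs))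
     + (asum2 (\<lambda>x y ws. br_term br f x y (ws @ [z])) xs + alt (length xs) (asum (\<lambda>y ys. br_term br f y z ys) xs))"
  by (simp add: dsum_def asum_append1 asum2_append1)

text \<open>Here \<open>w'\<close> is \<open>D w\<close> or \<open>a w\<close> and \<open>R\<close> collects the anchor terms, which occur with opposite signs in the two
  halves of the differential because moving the last argument to the front costs a sign.\<close>

lemma dsum_last:
  assumes X: "additive X"
    and T1: "\<And>y ys. mset (y # ys) = mset xs \<Longrightarrow>
      cg QQ (act_term lam f y (ys @ [(w', j)])) (X (act_term lam f y (ys @ [(w, j)])) + R y ys)"
    and T2: "cg QQ (act_term lam f (w', j) xs) (X (act_term lam f (w, j) xs))"
    and T3: "\<And>x y ws. mset (x # y # ws) = mset xs \<Longrightarrow>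
      cg QQ (br_term br f x y (ws @ [(w', j)])) (X (br_term br f x y (ws @ [(w, j)])))"
    and T4: "\<And>y ys. mset (y # ys) = mset xs \<Longrightarrow>
      cg QQ (br_term br f y (w', j) ys) (X (br_term br f y (w, j) ys) + alt (length ys) (R y ys))"
  shows "cg QQ (dsum lam br f (xs @ [(w', j)])) (X (dsum lam br f (xs @ [(w, j)])))"
proof -
  note T = M.additive_total_der
  let ?n = "length xs"
  let ?t1 = "\<lambda>y ys. act_term lam f y (ys @ [(w, j)])" and ?t2 = "act_term lam f (w, j) xs"
    and ?t3 = "\<lambda>x y ws. br_term br f x y (ws @ [(w, j)])" and ?t4 = "\<lambda>y ys. br_term br f y (w, j) ys"
  have "cg QQ (dsum lam br f (xs @ [(w', j)]))
      ((asum (\<lambda>y ys. X (?t1 y ys) + R y ys) xs + alt ?n (X ?t2))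
        + (asum2 (\<lambda>x y ws. X (?t3 x y ws)) xs + alt ?n (asum (\<lambda>y ys. X (?t4 y ys) + alt (length ys) (R y ys)) xs)))"
    unfolding dsum_append1 by (intro cg_add[OF T] cg_alt[OF T] asum_cong_cg[OF T] asum2_cong_cg[OF T] T1 T2 T3 T4)
  \<comment> \<open>One entry has been removed from \<open>xs\<close>, so
    \<open>alt (length ys)\<close> and \<open>alt ?n\<close> are opposite; this sign makes the two
    occurrences of \<open>R\<close> cancel.\<close>
  also have "asum (\<lambda>y ys. alt (length ys) (R y ys)) xs = asum (\<lambda>y ys. - alt ?n (R y ys)) xs"
  proof (rule asum_cong)
    fix y ys assume "mset (y # ys) = mset xs"
    then have "length (y # ys) = length xs" by (rule mset_eq_length)
    then have "?n = Suc (length ys)" by simp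
    then show "alt (length ys) (R y ys) = - alt ?n (R y ys)" by (simp only: alt_Suc minus_minus)
  qed
  then have "asum (\<lambda>y ys. X (?t4 y ys) + alt (length ys) (R y ys)) xs = X (asum ?t4 xs) - alt ?n (asum R xs)"
    by (simp add: asum_add asum_hom[OF X] asum_hom[OF additive_alt] asum_uminus)
  then have "alt ?n (asum (\<lambda>y ys. X (?t4 y ys) + alt (length ys) (R y ys)) xs) = X (alt ?n (asum ?t4 xs)) - asum R xs"
    by (simp add: additive.diff[OF additive_alt] alt_alt additive_commute_alt[OF X]) (simp add: alt_def)
  also have "(asum (\<lambda>y ys. X (?t1 y ys) + R y ys) xs + alt ?n (X ?t2))
        + (asum2 (\<lambda>x y ws. X (?t3 x y ws)) xs + (X (alt ?n (asum ?t4 xs)) - asum R xs))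
      = X (dsum lam br f (xs @ [(w, j)]))"
    unfolding dsum_append1
    by (simp add: asum_add asum_hom[OF X] asum2_hom[OF X] additive.add[OF X] additive_commute_alt[OF X])
  finally show ?thesis .
qed

section \<open>Linearity of the differential in the last argument\<close>

context
  fixes xs :: "('e \<times> nat) list" and z :: 'e and j
  assumes idx: "idx (xs @ [(z, j)])"
begin

lemma idx_last: "mset ys = mset xs \<Longrightarrow> idx (ys @ [(w :: 'e, j)])"
  using idx by (simp del: mset_map flip: mset_map) (metis mset_map)

lemma idx_last1: "mset (y # ys) = mset xs \<Longrightarrow> idx (y # ys @ [(w :: 'e, j)])"
  using idx_last[of "y # ys" w] by (simp only: append_Cons)

lemma idx_last2: "mset (x # y # ys) = mset xs \<Longrightarrow> idx (x # y # ys @ [(w :: 'e, j)])"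
  using idx_last[of "x # y # ys" w] by (simp only: append_Cons)

lemma idx_lastB: "mset (y # ys) = mset xs \<Longrightarrow> idx (y # (w :: 'e, j) # ys)"
  using idx_last1[of y ys w] by (simp add: add_mset_commute)

lemma length_xs: "length xs = k"
  using idx_length[OF idx] by simp

lemma last_notin: "j \<notin> set (map snd xs)"
  using idx_distinct[OF idx] by auto

lemma act_term_last:
  fixes X :: "'m mpol \<Rightarrow> 'm mpol"
  assumes "mset (y # ys) = mset xs" "subval f (ops (ys @ [(w', j)])) = q"
    and "cg (M.QL (map var (map snd ys) @ [var j])) q p"
  shows "cg QQ (act_term lam f y (ys @ [(w', j)])) (Lop (snd y) (fst y) p)"
proof -
  have "M.QL (var (snd y) # map var (map snd ys) @ [var j]) = QQ"
    using QQ_Cons[OF idx_last1[OF assms(1)]] by simp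
  moreover have "cg (M.QL (var (snd y) # map var (map snd ys) @ [var j]))
      (Lop (snd y) (fst y) q) (Lop (snd y) (fst y) p)"
    using assms(3) by (intro cg_Lop) (auto intro: lin_var)
  ultimately show ?thesis using assms(2) by (simp add: act_term_Lop)
qed

text \<open>No anchor terms occur, so \<open>R\<close> is 0. In a bracket with the last argument,
  sesquilinearity adds \<open>var (snd y)\<close>, while \<open>DE\<close> in the new slot acts as
  minus \<open>var (snd y) + var j\<close>; only \<open>- var j\<close> remains.\<close>

lemma dsum_last_D: "cg QQ (dsum lam br f (xs @ [(DE w, j)])) (- var j (dsum lam br f (xs @ [(w, j)])))"
proof (rule dsum_last[where R = "\<lambda>_ _. 0" and X = "\<lambda>p. - var j p"])
  note T = M.additive_total_der
  note [trans] = cg_trans[OF T]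
  show "additive (\<lambda>p. - var j p)" by (intro additive_uminus additive_var)
  show "cg QQ (act_term lam f (DE w, j) xs) (- var j (act_term lam f (w, j) xs))"
    by (simp add: act_term_Lop Lop_D)
  {
    fix y ys assume y: "mset (y # ys) = mset xs"
    then have len: "Suc (length ys) = k" using length_xs mset_eq_length by fastforce
    have "cg QQ (act_term lam f y (ys @ [(DE w, j)])) (Lop (snd y) (fst y) (- var j (subval f (ops ys @ [(w, var j)]))))"
      using subval_D[OF f, of "ops ys" "[]" "var j" w] len
      by (intro act_term_last[OF y refl]) (simp add: lin_var)
    then show "cg QQ (act_term lam f y (ys @ [(DE w, j)])) (- var j (act_term lam f y (ys @ [(w, j)])) + 0)"
      by (simp add: act_term_Lop additive.minus[OF additive_Lop] Lop_var)
    let ?H = "bh y (w, j) ys" and ?i = "snd y"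
    have I: "idx (y # (w, j) # ys)" by (rule idx_lastB[OF y])
    have 1: "cg QQ (psum (var ?i) ?H (map_poly DE P)) (- (var ?i (psum (var ?i) ?H P) + var j (psum (var ?i) ?H P)))" for P
    proof -
      have "cg QQ (psum (var ?i) ?H (map_poly DE P)) (psum (var ?i) (\<lambda>w. ?H (DE w)) P)"
        by (rule cg_sym[OF T psum_map_poly_cg[of QQ "var ?i" ?H DE, OF T additive_var QQ_var bh_zero[OF I]]])
          (rule additive.zero[OF additive_D])
      also have "cg QQ \<dots> (psum (var ?i) (\<lambda>w. - (var ?i (?H w) + var j (?H w))) P)"
        using bh_D[OF I] by (intro psum_cong_cg T additive_var QQ_var) simp
      also have "\<dots> = - (var ?i (psum (var ?i) ?H P) + var j (psum (var ?i) ?H P))"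
        by (rule psum_hom[of "\<lambda>p. - (var ?i p + var j p)" "var ?i", symmetric])
          (simp_all add: additive_minus additive_uminus additive_var var_commute[of j] var_diff var_uminus)
      finally show ?thesis .
    qed
    have "cg QQ (psum (var ?i) ?H (map_poly DE P + pCons 0 P)) (- var j (psum (var ?i) ?H P))" for P
    proof -
      have "cg QQ (psum (var ?i) ?H (map_poly DE P + pCons 0 P)) (psum (var ?i) ?H (map_poly DE P) + psum (var ?i) ?H (pCons 0 P))"
        by (rule psum_cg_add[of QQ "var ?i" ?H, OF T additive_var QQ_var bh_add[OF I]])
      also have "cg QQ \<dots> (- (var ?i (psum (var ?i) ?H P) + var j (psum (var ?i) ?H P)) + (?H 0 + var ?i (psum (var ?i) ?H P)))"
        by (intro cg_add[OF T] 1 psum_cg_pCons[of QQ "var ?i" ?H, OF T additive_var QQ_var bh_zero[OF I]])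
      also have "cg QQ \<dots> (- (var ?i (psum (var ?i) ?H P) + var j (psum (var ?i) ?H P)) + (0 + var ?i (psum (var ?i) ?H P)))"
        by (intro cg_add[OF T] cg_refl[OF T] bh_zero[OF I])
      finally show ?thesis by simp
    qed
    then show "cg QQ (br_term br f y (DE w, j) ys) (- var j (br_term br f y (w, j) ys) + alt (length ys) 0)"
      by (simp add: br_term_def lca.br_D_right additive.zero[OF additive_alt])
  }
  fix x y ws assume xy: "mset (x # y # ws) = mset xs"
  then have len: "Suc (Suc (length ws)) = k" using length_xs mset_eq_length by fastforce
  let ?h = "\<lambda>p. var (snd x) p + var (snd y) p"
  have "M.QL (?h # map var (map snd ws) @ [var j]) = QQ"
    using QQ_head[OF idx_last2[OF xy]] by simp
  then have "cg QQ (subval f ((v, ?h) # ops ws @ [(DE w, var j)])) (- var j (subval f ((v, ?h) # ops ws @ [(w, var j)])))" for v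
    using subval_D[OF f, of "(v, ?h) # ops ws" "[]" "var j" w] len by (simp add: lin_add lin_var)
  then have "cg QQ (br_term br f x y (ws @ [(DE w, j)]))
      (psum (var (snd x)) (\<lambda>v. - var j (subval f ((v, ?h) # ops ws @ [(w, var j)]))) (br (fst x) (fst y)))"
    unfolding br_term_def by (intro psum_cong_cg T additive_var QQ_var) simp
  also have "\<dots> = - var j (br_term br f x y (ws @ [(w, j)]))"
    unfolding br_term_def
    by (subst psum_hom[of "\<lambda>p. - var j p" "var (snd x)"]) (simp_all add: additive_uminus additive_var var_commute[of j] var_uminus)
  finally show "cg QQ (br_term br f x y (ws @ [(DE w, j)])) (- var j (br_term br f x y (ws @ [(w, j)])))" .
qed

text \<open>\<open>dsum_last\<close> transports a single operator from one argument; additivity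
  involves two arguments and is checked term by term.\<close>

lemma dsum_last_add:
  "cg QQ (dsum lam br f (xs @ [(w + w', j)])) (dsum lam br f (xs @ [(w, j)]) + dsum lam br f (xs @ [(w', j)]))"
proof -
  note T = M.additive_total_der
  note [trans] = cg_trans[OF T]
  let ?n = "length xs"
  let ?t1 = "\<lambda>w y ys. act_term lam f y (ys @ [(w, j)])" and ?t2 = "\<lambda>w. act_term lam f (w, j) xs"
    and ?t3 = "\<lambda>w x y ws. br_term br f x y (ws @ [(w, j)])" and ?t4 = "\<lambda>w y ys. br_term br f y (w, j) ys"
  have "?t2 (w + w') = ?t2 w + ?t2 w'"
    by (simp add: act_term_Lop Lop_add)
  then have t2: "cg QQ (?t2 (w + w')) (?t2 w + ?t2 w')" using T by simp
  {
    fix y ys assume y: "mset (y # ys) = mset xs"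
    then have len: "Suc (length ys) = k" using length_xs mset_eq_length by fastforce
    have "cg QQ (act_term lam f y (ys @ [(w + w', j)]))
        (Lop (snd y) (fst y) (subval f (ops ys @ [(w, var j)]) + subval f (ops ys @ [(w', var j)])))"
      using subval_add[OF f, of "ops ys" "[]" "var j" w w'] len
      by (intro act_term_last[OF y refl]) (simp add: lin_var)
    then have "cg QQ (?t1 (w + w') y ys) (?t1 w y ys + ?t1 w' y ys)"
      by (simp add: act_term_Lop Lop_padd)
    moreover have "cg QQ (?t4 (w + w') y ys) (?t4 w y ys + ?t4 w' y ys)"
      unfolding br_term_def fst_conv additive.add[OF additive_br_right] snd_conv
      by (rule psum_cg_add[of QQ "var (snd y)" "bh y (w, j) ys" for w, simplified snd_conv, OF T additive_var QQ_var bh_add[OF idx_lastB[OF y], simplified snd_conv]])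
    moreover note calculation
  }
  note t14 = this
  have t3: "cg QQ (?t3 (w + w') x y ws) (?t3 w x y ws + ?t3 w' x y ws)" if xy: "mset (x # y # ws) = mset xs" for x y ws
  proof -
    have len: "Suc (Suc (length ws)) = k" using xy length_xs mset_eq_length by fastforce
    let ?h = "\<lambda>p. var (snd x) p + var (snd y) p"
    have "M.QL (?h # map var (map snd ws) @ [var j]) = QQ"
      using QQ_head[OF idx_last2[OF xy]] by simp
    then have "cg QQ (subval f ((v, ?h) # ops ws @ [(w + w', var j)]))
        (subval f ((v, ?h) # ops ws @ [(w, var j)]) + subval f ((v, ?h) # ops ws @ [(w', var j)]))" for v
      using subval_add[OF f, of "(v, ?h) # ops ws" "[]" "var j" w w'] len by (simp add: lin_add lin_var)
    then have "cg QQ (?t3 (w + w') x y ws)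
        (psum (var (snd x)) (\<lambda>v. subval f ((v, ?h) # ops ws @ [(w, var j)]) + subval f ((v, ?h) # ops ws @ [(w', var j)])) (br (fst x) (fst y)))"
      unfolding br_term_def by (intro psum_cong_cg T additive_var QQ_var) simp
    then show ?thesis by (simp add: br_term_def psum_plus[OF additive_var])
  qed
  have "cg QQ (dsum lam br f (xs @ [(w + w', j)]))
      ((asum (\<lambda>y ys. ?t1 w y ys + ?t1 w' y ys) xs + alt ?n (?t2 w + ?t2 w'))
        + (asum2 (\<lambda>x y ws. ?t3 w x y ws + ?t3 w' x y ws) xs + alt ?n (asum (\<lambda>y ys. ?t4 w y ys + ?t4 w' y ys) xs)))"
    unfolding dsum_append1 by (intro cg_add[OF T] cg_alt[OF T] asum_cong_cg[OF T] asum2_cong_cg[OF T] t14 t2 t3)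
  then show ?thesis
    unfolding dsum_append1 by (simp add: asum_add asum2_add additive.add[OF additive_alt] algebra_simps)
qed

text \<open>The anchor enters twice: through \<open>Lop_S\<close> when the coefficient leaves the
  value on which \<open>y\<close> acts, and through \<open>br_act_right\<close> inside the bracket.
  Both are brought to the common form \<open>R\<close>.\<close>

lemma dsum_last_act:
  "cg QQ (dsum lam br f (xs @ [(actE c w, j)])) (M.S j c (dsum lam br f (xs @ [(w, j)])))"
proof -
  note T = M.additive_total_der
  note [trans] = cg_trans[OF T]
  define Ls' :: "'e \<times> nat \<Rightarrow> ('e \<times> nat) list \<Rightarrow> ('m mpol \<Rightarrow> 'm mpol) list"
    where "Ls' = (\<lambda>y ys. map var (map snd ys) @ [\<lambda>p. var (snd y) p + var j p])"
  define R where "R = (\<lambda>(y :: 'e \<times> nat) (ys :: ('e \<times> nat) list). psum (var (snd y)) (\<lambda>g. msub (Ls' y ys) (M.S (length ys) g (f (map fst ys @ [w])))) (anchor (fst y) c))"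
  show ?thesis
  proof (rule dsum_last[where R = R])
    show "additive (M.S j c)" by (rule M.additive_shift_act)
    have "f (map fst xs) \<in> mpols (length (map snd xs))"
      using good_mem[OF f, of "map fst xs"] length_xs by simp
    then have "act_term lam f (actE c w, j) xs = M.S j c (act_term lam f (w, j) xs)"
      using Lop_act[of "f (map fst xs)" "map snd xs" j c w] last_notin
      by (simp add: act_term_Lop subval_def)
    then show "cg QQ (act_term lam f (actE c w, j) xs) (M.S j c (act_term lam f (w, j) xs))" using T by simp
  next
    fix y ys assume y: "mset (y # ys) = mset xs"
    then have len: "Suc (length ys) = k" using length_xs mset_eq_length by fastforce
    have I: "idx (y # (w, j) # ys)" by (rule idx_lastB[OF y])
    have ij: "snd y \<noteq> j" "j \<notin> set (map snd ys)" using idx_distinct[OF I] by auto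
    let ?i = "snd y" and ?Ls = "map var (map snd ys) @ [var j]"
    have mem: "f (map fst ys @ [w]) \<in> mpols (Suc (length (map snd ys)))"
      using good_mem[OF f, of "map fst ys @ [w]"] len by simp
    have "cg QQ (act_term lam f y (ys @ [(actE c w, j)])) (Lop ?i (fst y) (msub ?Ls (M.S (length ys) c (f (map fst ys @ [w])))))"
      using subval_act[OF f, of "ops ys" "[]" "var j" c w] len
      by (intro act_term_last[OF y refl]) (simp add: lin_var)
    then show "cg QQ (act_term lam f y (ys @ [(actE c w, j)])) (M.S j c (act_term lam f y (ys @ [(w, j)])) + R y ys)"
      using Lop_S[OF mem ij, of "fst y" c]
      by (simp add: act_term_Lop subval_def R_def Ls'_def)
    let ?H = "bh y (w, j) ys" and ?h = "\<lambda>p. var ?i p + var j p"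
    have add: "cg QQ (?H (u + v)) (?H u + ?H v)" for u v by (rule bh_add[OF I])
    have H0: "cg QQ (?H 0) 0" by (rule bh_zero[OF I])
    have QL: "M.QL (?h # map var (map snd ys)) = QQ" using QQ_head[OF I] by simp
    have HS: "cg QQ (?H (actE c v)) (M.S j c (?H v))" for v
      using subval_act_S[OF f, of "[]" "ops ys" ?h j c v] len QL ij
      by (auto simp: lin_add lin_var M.shifts_add intro!: M.frees_var)
    \<comment> \<open>The bracket sits in the first slot, whereas \<open>R\<close> has
      \<open>w\<close> in the last one; moving it there costs the sign
      \<open>alt (length ys)\<close> that \<open>dsum_last\<close> expects.\<close>
    have HR: "cg QQ (?H (actE g w)) (alt (length ys) (msub (Ls' y ys) (M.S (length ys) g (f (map fst ys @ [w])))))" for g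
    proof -
      let ?ps = "(actE g w, ?h) # ops ys"
      have "alternating (M.QL (map snd ?ps)) (mset ?ps) (subval f)"
        using len by (intro subval_alternating[OF f]) (auto intro: lin_add lin_var)
      then have al: "alternating QQ (mset ?ps) (subval f)" using QL by simp
      have "cg QQ (?H (actE g w)) (alt (length ys) (subval f (ops ys @ [(actE g w, ?h)])))"
        using alternating_move[OF T al, of "[]" "(actE g w, ?h)" "ops ys" "[]"] by simp
      also have "cg QQ \<dots> (alt (length ys) (msub (Ls' y ys) (M.S (length ys) g (f (map fst ys @ [w])))))"
      proof (rule cg_alt[OF T])
        have "M.QL (map var (map snd ys) @ [?h]) = QQ"
          using QL M.QL_mset[of "map var (map snd ys) @ [?h]" "?h # map var (map snd ys)"] by simp
        then show "cg QQ (subval f (ops ys @ [(actE g w, ?h)])) (msub (Ls' y ys) (M.S (length ys) g (f (map fst ys @ [w]))))"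
          using subval_act[OF f, of "ops ys" "[]" ?h g w] len by (simp add: lin_add lin_var Ls'_def)
      qed
      finally show ?thesis .
    qed
    let ?P = "br (fst y) w"
    have "cg QQ (psum (var ?i) ?H (map_poly (actE c) ?P + map_poly (\<lambda>g. actE g w) (anchor (fst y) c)))
        (psum (var ?i) ?H (map_poly (actE c) ?P) + psum (var ?i) ?H (map_poly (\<lambda>g. actE g w) (anchor (fst y) c)))"
      by (rule psum_cg_add[of QQ "var ?i" ?H, OF T additive_var QQ_var add])
    also have "cg QQ \<dots> (psum (var ?i) (\<lambda>v. ?H (actE c v)) ?P + psum (var ?i) (\<lambda>g. ?H (actE g w)) (anchor (fst y) c))"
      by (intro cg_add[OF T] cg_sym[OF T psum_map_poly_cg[of QQ "var ?i" ?H, OF T additive_var QQ_var H0]]) simp_all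
    also have "cg QQ \<dots> (psum (var ?i) (\<lambda>v. M.S j c (?H v)) ?P
        + psum (var ?i) (\<lambda>g. alt (length ys) (msub (Ls' y ys) (M.S (length ys) g (f (map fst ys @ [w]))))) (anchor (fst y) c))"
      by (intro cg_add[OF T] psum_cong_cg T additive_var QQ_var HS HR)
    also have "psum (var ?i) (\<lambda>v. M.S j c (?H v)) ?P = M.S j c (psum (var ?i) ?H ?P)"
      using ij by (intro psum_hom[symmetric] M.additive_shift_act) (simp add: M.S_var_other)
    also have "psum (var ?i) (\<lambda>g. alt (length ys) (msub (Ls' y ys) (M.S (length ys) g (f (map fst ys @ [w]))))) (anchor (fst y) c)
        = alt (length ys) (R y ys)"
      unfolding R_def by (intro psum_hom[symmetric] additive_alt) (simp add: alt_def var_uminus)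
    finally show "cg QQ (br_term br f y (actE c w, j) ys) (M.S j c (br_term br f y (w, j) ys) + alt (length ys) (R y ys))"
      by (simp add: br_term_def br_act_right)
  next
    fix x y ws assume xy: "mset (x # y # ws) = mset xs"
    then have len: "Suc (Suc (length ws)) = k" using length_xs mset_eq_length by fastforce
    have I: "idx (x # y # ws @ [(w, j)])" by (rule idx_last2[OF xy])
    have ij: "snd x \<noteq> j" "snd y \<noteq> j" "j \<notin> set (map snd ws)" using idx_distinct[OF I] by auto
    let ?h = "\<lambda>p. var (snd x) p + var (snd y) p"
    \<comment> \<open>The bracket of two other arguments carries no \<open>var j\<close>, so
      \<open>S j c\<close> passes through it without correction terms.\<close>
    have fr: "M.frees j ?h" using ij by (simp add: M.frees_def M.S_padd M.S_var_other)
    have "M.QL (?h # map var (map snd ws) @ [var j]) = QQ"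
      using QQ_head[OF I] by simp
    moreover have "M.frees j L" if "L \<in> set (map snd ((v, ?h) # ops ws)) \<union> set (map snd [])" for v :: 'e and L
      using that ij fr by (auto intro!: M.frees_var)
    ultimately have "cg QQ (subval f ((v, ?h) # ops ws @ [(actE c w, var j)])) (M.S j c (subval f ((v, ?h) # ops ws @ [(w, var j)])))" for v
      using subval_act_S[OF f, of "(v, ?h) # ops ws" "[]" "var j" j c w] len
      by (simp add: lin_add lin_var M.shifts_var)
    then have "cg QQ (br_term br f x y (ws @ [(actE c w, j)]))
        (psum (var (snd x)) (\<lambda>v. M.S j c (subval f ((v, ?h) # ops ws @ [(w, var j)]))) (br (fst x) (fst y)))"
      unfolding br_term_def by (intro psum_cong_cg T additive_var QQ_var) simp
    also have "\<dots> = M.S j c (br_term br f x y (ws @ [(w, j)]))"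
      unfolding br_term_def using ij
      by (subst psum_hom[of "M.S j c" "var (snd x)"]) (simp_all add: M.additive_shift_act M.S_var_other)
    finally show "cg QQ (br_term br f x y (ws @ [(actE c w, j)])) (M.S j c (br_term br f x y (ws @ [(w, j)])))" .
  qed
qed

end

end

end

lemma mpols_dsum:
  assumes lam: "\<And>u. additive (lam u)" and idx: "mset (map snd xs) = mset [0..<k]"
  shows "dsum lam br f xs \<in> mpols k"
proof -
  have bd: "set (map snd ys) \<subseteq> {..<k}" if "mset ys = mset xs" for ys :: "('a \<times> nat) list"
  proof -
    have "mset (map snd ys) = mset [0..<k]" using that idx by simp
    then have "set (map snd ys) = set [0..<k]" by (rule mset_eq_setD)
    then show ?thesis by auto
  qed
  have subval: "subval f ps \<in> mpols k"
    if "set (map snd ps) \<subseteq> lin" "\<And>L p. L \<in> set (map snd ps) \<Longrightarrow> p \<in> mpols k \<Longrightarrow> L p \<in> mpols k" for ps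
    unfolding subval_def using that by (rule mpols_msub_all)
  have "act_term lam f x ys \<in> mpols k" if "mset (x # ys) = mset xs" for x ys
    unfolding act_term_def using bd[OF that]
    by (intro mpols_mext additive_comp[OF additive_plug[OF additive_var] lam] mpols_plug_var subval)
      (auto intro: lin_var mpols_var)
  moreover have "br_term br f x y ys \<in> mpols k" if "mset (x # y # ys) = mset xs" for x y ys
    unfolding br_term_def using bd[OF that]
    by (intro psum_in_mpols subval) (auto intro: lin_var lin_add mpols_var mpols_add)
  ultimately show ?thesis
    unfolding dsum_def by (intro mpols_add asum_closed asum2_closed mpols_diff[of _ k] mpols_zero)
qed

section \<open>From the last argument to all arguments, and skew-symmetry of the
  differential\<close>

context lcad_module
begin

lemma zip_slot:
  assumes "length us = n" "i < n"
  shows "zip (us[i := x]) [0..<n] = take i (zip us [0..<n]) @ (x, i) # drop (Suc i) (zip us [0..<n])"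
proof -
  have "zip (us[i := x]) [0..<n] = (zip us [0..<n])[i := (x, i)]"
    using assms zip_update[of us i x "[0..<n]" i] by (metis list_update_id nth_upt add_0 diff_zero length_upt)
  then show ?thesis using assms by (simp add: upd_conv_take_nth_drop)
qed

lemma idx_zip: "length us = n \<Longrightarrow> mset (map snd (zip us [0..<n])) = mset [0..<n]"
  by (simp del: mset_map)

text \<open>\<open>xs\<close> and \<open>n\<close> are independent of the inserted argument, so an
  identity between values in the last slot becomes one for slot \<open>i\<close> with a common
  sign.\<close>

lemma dsum_move_last:
  assumes f: "good k f" and us: "length us = Suc k" "i < Suc k"
  obtains xs n where
    "\<And>x. mset (map snd (xs @ [(x, i)])) = mset [0..<Suc k]"
    "\<And>x. M.eqv (Suc k) (dsum lam br f (zip (us[i := x]) [0..<Suc k])) (alt n (dsum lam br f (xs @ [(x, i)])))"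
proof
  let ?A = "take i (zip us [0..<Suc k])" and ?B = "drop (Suc i) (zip us [0..<Suc k])"
  have idx: "mset (map snd (?A @ (x, i) # ?B)) = mset [0..<Suc k]" for x
    using idx_zip[of "us[i := x]" "Suc k"] us by (simp only: zip_slot length_list_update)
  show "mset (map snd ((?A @ ?B) @ [(x, i)])) = mset [0..<Suc k]" for x
    using idx[of x] by simp
  show "M.eqv (Suc k) (dsum lam br f (zip (us[i := x]) [0..<Suc k]))
      (alt (length ?B) (dsum lam br f ((?A @ ?B) @ [(x, i)])))" for x
    using alternating_move[OF M.additive_total_der dsum_alternating[OF f, of "mset (?A @ (x, i) # ?B)"], of ?A "(x, i)" ?B "[]"]
      idx[of x] us
    by (simp only: mset_map append_Nil2 append_assoc zip_slot)
qed

lemma dsum_slot: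
  assumes f: "good k f" and us: "length us = Suc k" "i < Suc k"
    and X: "additive X" "\<And>p. X (total_der DM (Suc k) p) = total_der DM (Suc k) (X p)"
    and last: "\<And>xs. mset (map snd (xs @ [(x, i)])) = mset [0..<Suc k] \<Longrightarrow>
      M.eqv (Suc k) (dsum lam br f (xs @ [(x', i)])) (X (dsum lam br f (xs @ [(x, i)])))"
  shows "M.eqv (Suc k) (dsum lam br f (zip (us[i := x']) [0..<Suc k])) (X (dsum lam br f (zip (us[i := x]) [0..<Suc k])))"
proof -
  note T = M.additive_total_der
  note [trans] = cg_trans[OF T]
  obtain xs n where idx: "\<And>x. mset (map snd (xs @ [(x, i)])) = mset [0..<Suc k]"
    and move: "\<And>x. M.eqv (Suc k) (dsum lam br f (zip (us[i := x]) [0..<Suc k])) (alt n (dsum lam br f (xs @ [(x, i)])))"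
    using dsum_move_last[OF f us] by blast
  have "M.eqv (Suc k) (dsum lam br f (zip (us[i := x']) [0..<Suc k])) (alt n (dsum lam br f (xs @ [(x', i)])))"
    by (rule move)
  also have "M.eqv (Suc k) \<dots> (alt n (X (dsum lam br f (xs @ [(x, i)]))))"
    by (intro cg_alt[OF T] last idx)
  also have "\<dots> = X (alt n (dsum lam br f (xs @ [(x, i)])))"
    by (simp only: additive_commute_alt[OF X(1)])
  also have "M.eqv (Suc k) \<dots> (X (dsum lam br f (zip (us[i := x]) [0..<Suc k])))"
    by (rule cg_apply[of X "total_der DM (Suc k)" "total_der DM (Suc k)", OF X cg_sym[OF T move]])
  finally show ?thesis .
qed

lemma dsum_slot_add:
  assumes f: "good k f" and us: "length us = Suc k" "i < Suc k"
  shows "M.eqv (Suc k) (dsum lam br f (zip (us[i := x + y]) [0..<Suc k]))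
    (dsum lam br f (zip (us[i := x]) [0..<Suc k]) + dsum lam br f (zip (us[i := y]) [0..<Suc k]))"
proof -
  note T = M.additive_total_der
  note [trans] = cg_trans[OF T]
  obtain xs n where idx: "\<And>x. mset (map snd (xs @ [(x, i)])) = mset [0..<Suc k]"
    and move: "\<And>x. M.eqv (Suc k) (dsum lam br f (zip (us[i := x]) [0..<Suc k])) (alt n (dsum lam br f (xs @ [(x, i)])))"
    using dsum_move_last[OF f us] by blast
  have "M.eqv (Suc k) (dsum lam br f (zip (us[i := x + y]) [0..<Suc k])) (alt n (dsum lam br f (xs @ [(x + y, i)])))"
    by (rule move)
  also have "M.eqv (Suc k) \<dots> (alt n (dsum lam br f (xs @ [(x, i)]) + dsum lam br f (xs @ [(y, i)])))"
    by (intro cg_alt[OF T] dsum_last_add[OF f idx])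
  also have "\<dots> = alt n (dsum lam br f (xs @ [(x, i)])) + alt n (dsum lam br f (xs @ [(y, i)]))"
    by (simp only: additive.add[OF additive_alt])
  also have "M.eqv (Suc k) \<dots>
      (dsum lam br f (zip (us[i := x]) [0..<Suc k]) + dsum lam br f (zip (us[i := y]) [0..<Suc k]))"
    by (intro cg_add[OF T] cg_sym[OF T move])
  finally show ?thesis .
qed

lemma msub_Lop:
  assumes "p \<in> mpols n" "\<And>i. i < n \<Longrightarrow> \<pi> i < n" "i < n"
  shows "msub (map (\<lambda>i. var (\<pi> i)) [0..<n]) (Lop i u p) = Lop (\<pi> i) u (msub (map (\<lambda>i. var (\<pi> i)) [0..<n]) p)"
proof -
  let ?R = "msub (map (\<lambda>i. var (\<pi> i)) [0..<n]) :: 'm mpol \<Rightarrow> 'm mpol"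
  have R: "set (map (\<lambda>i. var (\<pi> i)) [0..<n]) \<subseteq> lin" by simp
  note add = additive.add[OF additive_msub[OF R]]
  have var: "?R (var l q) = var (\<pi> l) (?R q)" if "l < n" for l q
    using that by (simp add: msub_var)
  have plug: "?R (plug (var i) P) = plug (var (\<pi> i)) P" for P :: "'m poly"
    by (induction P) (simp_all add: plug_pCons additive_var add var assms additive.zero[OF additive_msub[OF R]])
  show ?thesis
    using assms(1)
    by (induction rule: mpols_induct) (simp_all add: Lop_const plug var Lop_var add Lop_padd)
qed

lemma msub_subval:
  assumes f: "f (map fst ps) \<in> mpols (length ps)" and ps: "set (map snd ps) \<subseteq> lin" "set (map snd ps') \<subseteq> lin"
    and len: "map fst ps' = map fst ps"
    and eq: "\<And>l q. l < length ps \<Longrightarrow> msub Rs (snd (ps ! l) q) = snd (ps' ! l) (msub Rs q)"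
    and R: "set Rs \<subseteq> lin"
  shows "msub Rs (subval f ps) = subval f ps'"
proof -
  have "length ps' = length ps" using len by (metis length_map)
  then show ?thesis unfolding subval_def using assms by (intro trans[OF msub_comp]) auto
qed

text \<open>Renaming variables is relabelling of tags, because all substituends and all actions in
  the differential are expressed through the tags.\<close>

lemma msub_dsum:
  assumes f: "good k f" and idx: "mset (map snd xs) = mset [0..<Suc k]" and \<pi>: "\<pi> permutes {..<Suc k}"
  shows "msub (map (\<lambda>i. var (\<pi> i)) [0..<Suc k]) (dsum lam br f xs) = dsum lam br f (map (\<lambda>(u, i). (u, \<pi> i)) xs)"
    (is "msub ?Rs _ = dsum lam br f (map ?\<sigma> xs)")
proof -
  have R: "set ?Rs \<subseteq> lin" by (simp del: upt_Suc)
  have \<pi>k: "\<pi> i < Suc k" if "i < Suc k" for i using permutes_in_image[OF \<pi>, of i] that by simp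
  have var: "msub ?Rs (var l q) = var (\<pi> l) (msub ?Rs q)" if "l < Suc k" for l q
    using that R by (subst msub_var) (simp_all del: upt_Suc)
  note add = additive_msub[OF R]
  have bd: "set (map snd ys) \<subseteq> {..<Suc k} \<and> length ys = Suc k" if "mset ys = mset xs" for ys :: "('e \<times> nat) list"
  proof -
    have "mset (map snd ys) = mset [0..<Suc k]" using that idx by simp
    then show ?thesis
      using idx_distinct[OF f] idx_length[OF f] by blast
  qed
  have fm: "f us \<in> mpols k" if "length us = k" for us using good_mem[OF f that] .
  have fst\<sigma>: "map fst (map ?\<sigma> ys) = map fst ys" for ys by (simp add: case_prod_beta comp_def)
  have act: "msub ?Rs (act_term lam f x ys) = act_term lam f (?\<sigma> x) (map ?\<sigma> ys)" if "mset (x # ys) = mset xs" for x ys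
  proof -
    note b = bd[OF that]
    have "msub ?Rs (subval f (ops ys)) = subval f (ops (map ?\<sigma> ys))"
    proof (rule msub_subval[OF _ _ _ _ _ R])
      fix l q assume "l < length (ops ys)"
      then have l: "l < length ys" by simp
      with b have "snd (ys ! l) < Suc k" by (force simp: set_conv_nth)
      with l show "msub ?Rs (snd (ops ys ! l) q) = snd (ops (map ?\<sigma> ys) ! l) (msub ?Rs q)"
        by (simp add: ops_def case_prod_beta var del: upt_Suc)
    qed (use b in \<open>simp_all add: fm fst\<sigma> case_prod_beta comp_def del: upt_Suc\<close>)
    moreover have "subval f (ops ys) \<in> mpols (Suc k)"
      using b by (intro subval_mem[OF f]) (auto intro: lin_var mpols_var)
    ultimately show ?thesis
      using b by (simp add: act_term_Lop msub_Lop \<pi>k case_prod_beta del: upt_Suc)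
  qed
  have brt: "msub ?Rs (br_term br f x y ys) = br_term br f (?\<sigma> x) (?\<sigma> y) (map ?\<sigma> ys)"
    if "mset (x # y # ys) = mset xs" for x y ys
  proof -
    note b = bd[OF that]
    let ?h = "\<lambda>x y p. var (snd x) p + var (snd y) p"
    have "msub ?Rs (subval f ((w, ?h x y) # ops ys)) = subval f ((w, ?h (?\<sigma> x) (?\<sigma> y)) # ops (map ?\<sigma> ys))" for w
    proof (rule msub_subval[OF _ _ _ _ _ R])
      fix l q assume l: "l < length ((w, ?h x y) # ops ys)"
      show "msub ?Rs (snd (((w, ?h x y) # ops ys) ! l) q) = snd (((w, ?h (?\<sigma> x) (?\<sigma> y)) # ops (map ?\<sigma> ys)) ! l) (msub ?Rs q)"
      proof (cases l)
        case 0
        then show ?thesis using b by (simp add: additive.add[OF add] var case_prod_beta del: upt_Suc)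
      next
        case (Suc l')
        then have l': "l' < length ys" using l by simp
        with b have "snd (ys ! l') < Suc k" by (force simp: set_conv_nth)
        with l' Suc show ?thesis
          by (simp add: ops_def case_prod_beta var del: upt_Suc)
      qed
    qed (use b in \<open>simp_all add: fm fst\<sigma> case_prod_beta comp_def lin_add lin_var del: upt_Suc\<close>)
    then have 1: "(\<lambda>w. msub ?Rs (subval f ((w, ?h x y) # ops ys))) = (\<lambda>w. subval f ((w, ?h (?\<sigma> x) (?\<sigma> y)) # ops (map ?\<sigma> ys)))"
      by (rule ext)
    have hom: "msub ?Rs (psum (var (snd x)) H P) = psum (var (\<pi> (snd x))) (\<lambda>w. msub ?Rs (H w)) P" for H and P :: "'e poly"
    proof -
      have "msub ?Rs ((var (snd x) ^^ n) q) = (var (\<pi> (snd x)) ^^ n) (msub ?Rs q)" for n q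
        using b by (induction n) (simp_all add: var del: upt_Suc)
      then show ?thesis by (simp only: psum_def additive.sum[OF add])
    qed
    show ?thesis
      unfolding br_term_def hom 1 by (simp add: case_prod_beta)
  qed
  show ?thesis
    unfolding dsum_def additive.add[OF add] asum_hom[OF add] asum2_hom[OF add] asum_map asum2_map
    by (intro arg_cong2[where f = "(+)"] asum_cong asum2_cong act brt)
qed

text \<open>Permuting the arguments and renaming the variables by the same permutation permutes the
  list of tagged arguments, so \<open>alternating_permute\<close> applies.\<close>

lemma skew_dsum:
  assumes f: "good k f"
  shows "M.skew (Suc k) (\<lambda>us. dsum lam br f (zip us [0..<Suc k]))"
  unfolding M.skew_def
proof (intro allI impI)
  fix \<pi> and us :: "'e list" assume \<pi>: "\<pi> permutes {..<Suc k}" and us: "length us = Suc k"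
  let ?xs = "zip us [0..<Suc k]" and ?Q = "total_der DM (Suc k)"
  have idx: "mset (map snd (zip us [0..<Suc k])) = mset [0..<Suc k]" if "length us = Suc k" for us :: "'e list"
    using that by (rule idx_zip)
  have "map (\<lambda>(u, i). (u, \<pi> i)) (zip (permute_list \<pi> us) [0..<Suc k]) = permute_list \<pi> ?xs"
    using us permutes_in_image[OF \<pi>]
    by (intro nth_equalityI) (auto simp: permute_list_def simp del: upt_Suc)
  then have eq: "msub (map (\<lambda>i. var (\<pi> i)) [0..<Suc k]) (dsum lam br f (zip (permute_list \<pi> us) [0..<Suc k]))
      = dsum lam br f (permute_list \<pi> ?xs)"
    using msub_dsum[OF f idx \<pi>, of "permute_list \<pi> us"] us by (simp del: upt_Suc)
  have "image_mset snd (mset ?xs) = mset [0..<Suc k]"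
    using idx[OF us] by (simp only: mset_map)
  then have "cg ?Q (dsum lam br f ?xs) (if evenperm \<pi> then dsum lam br f (permute_list \<pi> ?xs) else - dsum lam br f (permute_list \<pi> ?xs))"
    using us \<pi> by (intro alternating_permute[OF M.additive_total_der dsum_alternating[OF f]]) simp_all
  then show "cg ?Q (dsum lam br f ?xs) (let q = msub (map (\<lambda>i. var (\<pi> i)) [0..<Suc k]) (dsum lam br f (zip (permute_list \<pi> us) [0..<Suc k]))
      in if evenperm \<pi> then q else - q)"
    unfolding Let_def eq .
qed

lemma good_dsum:
  assumes f: "good k f"
  shows "good (Suc k) (\<lambda>us. dsum lam br f (zip us [0..<Suc k]))"
  unfolding good_def
proof (intro conjI allI impI)
  fix us :: "'e list" assume us: "length us = Suc k"
  show "dsum lam br f (zip us [0..<Suc k]) \<in> mpols (Suc k)"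
    by (intro mpols_dsum additive_lam_right idx_zip us)
  fix i x y a assume i: "i < Suc k"
  show "M.eqv (Suc k) (dsum lam br f (zip (us[i := x + y]) [0..<Suc k]))
    (dsum lam br f (zip (us[i := x]) [0..<Suc k]) + dsum lam br f (zip (us[i := y]) [0..<Suc k]))"
    by (rule dsum_slot_add[OF f us i])
  show "M.eqv (Suc k) (dsum lam br f (zip (us[i := actE a x]) [0..<Suc k]))
     (M.S i a (dsum lam br f (zip (us[i := x]) [0..<Suc k])))"
    by (intro dsum_slot[OF f us i] M.additive_shift_act dsum_last_act[OF f]) (simp_all add: M.total_der_S i)
  show "M.eqv (Suc k) (dsum lam br f (zip (us[i := DE x]) [0..<Suc k]))
     (- var i (dsum lam br f (zip (us[i := x]) [0..<Suc k])))"
    by (intro dsum_slot[OF f us i] additive_uminus additive_var dsum_last_D[OF f])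
      (simp_all add: M.total_der_var additive.minus[OF M.additive_total_der])
qed (rule skew_dsum[OF f])

lemma cochain_diff_closed:
  assumes "\<phi> \<in> lcad_cochains s del actE DE actM DM k"
  shows "cochain_diff lam br DM k \<phi> \<in> lcad_cochains s del actE DE actM DM (Suc k)"
proof -
  have "cochain_diff lam br DM k \<phi>
      = (\<lambda>us\<in>{us. length us = Suc k}. cls DM (Suc k) (dsum lam br (\<lambda>us. rep (\<phi> us)) (zip us [0..<Suc k])))"
  proof
    fix us :: "'e list"
    show "cochain_diff lam br DM k \<phi> us
      = (\<lambda>us\<in>{us. length us = Suc k}. cls DM (Suc k) (dsum lam br (\<lambda>us. rep (\<phi> us)) (zip us [0..<Suc k]))) us"
      by (cases "length us = Suc k") (simp_all add: cochain_diff_dsum del: upt_Suc, simp add: cochain_diff_def)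
  qed
  then show ?thesis using good_cochain[OF good_dsum[OF good_rep[OF assms]]] by simp
qed

end

section \<open>Extending derivations to Kaehler differentials\<close>

context cochain_modules
begin

text \<open>Weaker than \<open>good\<close>, yet enough for uniqueness: over Kaehler differentials
  two such functions that are congruent on exact differentials are congruent everywhere. It is
  preserved by permuting arguments and variables, so it applies to both sides of the skew-symmetry
  identity.\<close>

definition linear_slots :: "nat \<Rightarrow> ('e list \<Rightarrow> 'm mpol) \<Rightarrow> bool" where
  "linear_slots k F \<longleftrightarrow> (\<forall>A B x y a. length A + length B + 1 = k \<longrightarrow>
     M.eqv k (F (A @ (x + y) # B)) (F (A @ x # B) + F (A @ y # B)) \<and>
     M.eqv k (F (A @ actE a x # B)) (M.S (length A) a (F (A @ x # B))))"

lemma good_linear_slots: "good k f \<Longrightarrow> linear_slots k f"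
  unfolding linear_slots_def
proof (intro allI impI conjI)
  fix A B :: "'e list" and x y a assume f: "good k f" and k: "length A + length B + 1 = k"
  show "M.eqv k (f (A @ (x + y) # B)) (f (A @ x # B) + f (A @ y # B))"
    using good_add[OF f, of "A @ x # B" "length A" x y] k by simp
  show "M.eqv k (f (A @ actE a x # B)) (M.S (length A) a (f (A @ x # B)))"
    using good_act[OF f, of "A @ x # B" "length A" a x] k by simp
qed

lemma linear_slots_update:
  assumes "linear_slots k F" "length ws = k" "i < k"
  shows "M.eqv k (F (ws[i := x + y])) (F (ws[i := x]) + F (ws[i := y]))"
    and "M.eqv k (F (ws[i := actE a x])) (M.S i a (F (ws[i := x])))"
  using assms(1)[unfolded linear_slots_def, rule_format, of "take i ws" "drop (Suc i) ws" x y a] assms(2,3)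
  by (simp_all add: upd_conv_take_nth_drop)

text \<open>The argument in position \<open>length A\<close> is fed to slot \<open>l\<close>, and
  renaming the variables sends \<open>l\<close> back to \<open>length A\<close>; so
  \<open>S l\<close> inside becomes \<open>S (length A)\<close> outside.\<close>

lemma linear_slots_permute:
  assumes F: "linear_slots k F" and mem: "\<And>ws. length ws = k \<Longrightarrow> F ws \<in> mpols k" and \<pi>: "\<pi> permutes {..<k}"
  shows "linear_slots k (\<lambda>ws. let q = msub (map (\<lambda>i. var (\<pi> i)) [0..<k]) (F (permute_list \<pi> ws)) in if evenperm \<pi> then q else - q)"
    (is "linear_slots k ?G")
  unfolding linear_slots_def
proof (intro allI impI)
  fix A B :: "'e list" and x y a assume k: "length A + length B + 1 = k"
  note T = M.additive_total_der
  define l where "l = inv \<pi> (length A)"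
  have \<pi>l: "\<pi> l = length A" unfolding l_def by (rule permutes_inverses[OF \<pi>])
  have l: "l < k" using \<pi>l k permutes_in_image[OF \<pi>, of l] by simp
  have inj: "\<pi> l' \<noteq> length A" if "l' \<noteq> l" for l'
    using that \<pi>l permutes_inj[OF \<pi>] by (metis injD)
  define ws where "ws = permute_list \<pi> (A @ x # B)"
  have len: "length ws = k" using k by (simp add: ws_def)
  have upd: "permute_list \<pi> (A @ z # B) = ws[l := z]" for z
    unfolding ws_def
  proof (rule nth_equalityI)
    fix l' assume "l' < length (permute_list \<pi> (A @ z # B))"
    then have l': "l' < k" using k by simp
    have "\<pi> l' < k" using permutes_in_image[OF \<pi>, of l'] l' by simp
    then show "permute_list \<pi> (A @ z # B) ! l' = (permute_list \<pi> (A @ x # B))[l := z] ! l'"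
      using l' k inj[of l'] \<pi>l by (cases "l' = l") (auto simp: permute_list_def nth_append nth_Cons')
  qed (use k in simp)
  let ?Ls = "map (\<lambda>i. var (\<pi> i)) [0..<k] :: ('m mpol \<Rightarrow> 'm mpol) list"
  have Ls: "set ?Ls \<subseteq> lin" by simp
  have S: "msub ?Ls (M.S l a p) = M.S (length A) a (msub ?Ls p)" if "p \<in> mpols k" for p
  proof (rule M.msub_S)
    show "M.shifts (length A) (?Ls ! l)" using l \<pi>l by (simp add: M.shifts_var)
    show "M.frees (length A) (?Ls ! l')" if "l' < length ?Ls" "l' \<noteq> l" for l'
      using that inj by (simp add: M.frees_var)
  qed (use that l in simp_all)
  let ?\<epsilon> = "\<lambda>q :: 'm mpol. if evenperm \<pi> then q else - q"
  have \<epsilon>: "M.eqv k (?\<epsilon> p) (?\<epsilon> q)" if "M.eqv k p q" for p q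
    using that cg_uminus[OF T] by simp
  have "M.eqv k (?\<epsilon> (msub ?Ls (F (ws[l := x + y])))) (?\<epsilon> (msub ?Ls (F (ws[l := x]) + F (ws[l := y]))))"
    by (intro \<epsilon> M.cg_msub_permutes[OF \<pi>] linear_slots_update[OF F len l])
  then have add: "M.eqv k (?G (A @ (x + y) # B)) (?G (A @ x # B) + ?G (A @ y # B))"
    by (cases "evenperm \<pi>") (simp_all add: upd additive.add[OF additive_msub[OF Ls]] Let_def)
  have "M.eqv k (?\<epsilon> (msub ?Ls (F (ws[l := actE a x])))) (?\<epsilon> (msub ?Ls (M.S l a (F (ws[l := x])))))"
    by (intro \<epsilon> M.cg_msub_permutes[OF \<pi>] linear_slots_update[OF F len l])
  then have "M.eqv k (?G (A @ actE a x # B)) (M.S (length A) a (?G (A @ x # B)))"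
    using len by (cases "evenperm \<pi>") (simp_all add: upd S mem M.S_puminus Let_def)
  with add show "M.eqv k (?G (A @ (x + y) # B)) (?G (A @ x # B) + ?G (A @ y # B))
    \<and> M.eqv k (?G (A @ actE a x # B)) (M.S (length A) a (?G (A @ x # B)))" ..
qed

end

section \<open>Kaehler differentials through their presentation\<close>

locale kaehler_module = kaehler_differentials s del actW DW d + M: diff_module s del actM DM
  for s :: "'f::field_char_0 \<Rightarrow> 'v::comm_ring_1 \<Rightarrow> 'v"
    and del :: "'v \<Rightarrow> 'v"
    and actW :: "'v \<Rightarrow> 'w::ab_group_add \<Rightarrow> 'w"
    and DW :: "'w \<Rightarrow> 'w"
    and d :: "'v \<Rightarrow> 'w"
    and actM :: "'v \<Rightarrow> 'm::ab_group_add \<Rightarrow> 'm"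
    and DM :: "'m \<Rightarrow> 'm"
begin

sublocale cochain_modules s del actW DW actM DM ..

lemma module_free: "module (\<lambda>a. Poly_Mapping.map ((*) a) :: ('v \<Rightarrow>\<^sub>0 'v) \<Rightarrow> _)"
proof -
  have "lookup (Poly_Mapping.map ((*) a) x) f = a * lookup x f" for a and x :: "'v \<Rightarrow>\<^sub>0 'v" and f
    by (simp add: Poly_Mapping.map.rep_eq when_def)
  then show ?thesis
    by unfold_locales (simp_all add: poly_mapping_eq_iff fun_eq_iff lookup_add algebra_simps)
qed

interpretation free: module "\<lambda>a. Poly_Mapping.map ((*) a) :: ('v \<Rightarrow>\<^sub>0 'v) \<Rightarrow> _"
  by (rule module_free)

lemma free_comb_lsum: "free_comb actW d = lsum (\<lambda>f a. actW a (d f))"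
  by (simp add: fun_eq_iff free_comb_def lsum_def)

lemma additive_act_left: "additive (\<lambda>a. actW a w)"
  by (simp add: additive_def mdl.scale_left_distrib)

lemma additive_free_comb: "additive (free_comb actW d)"
  unfolding free_comb_lsum by (intro additive_lsum additive_act_left)

lemma free_comb_single: "free_comb actW d (single f a) = actW a (d f)"
  by (simp add: free_comb_lsum lsum_single)

lemma free_comb_rel: "x \<in> kaehler_rels s \<Longrightarrow> free_comb actW d x = 0"
  using relations free.span_superset[of "kaehler_rels s"] by blast

lemma d_add: "d (f + g) = d f + d g"
proof -
  have "single (f + g) 1 - single f 1 - single g 1 \<in> kaehler_rels s"
    unfolding kaehler_rels_def by blast
  from free_comb_rel[OF this] show ?thesis
    by (simp add: additive.diff[OF additive_free_comb] free_comb_single diff_eq_eq add.commute)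
qed

lemma d_scale: "d (s c f) = actW (s c 1) (d f)"
proof -
  have "single (s c f) 1 - single f (s c 1) \<in> kaehler_rels s"
    unfolding kaehler_rels_def by blast
  from free_comb_rel[OF this] show ?thesis
    by (simp add: additive.diff[OF additive_free_comb] free_comb_single)
qed

lemma d_mult: "d (f * g) = actW f (d g) + actW g (d f)"
proof -
  have "single (f * g) 1 - single g f - single f g \<in> kaehler_rels s"
    unfolding kaehler_rels_def by blast
  from free_comb_rel[OF this] show ?thesis
    by (simp add: additive.diff[OF additive_free_comb] free_comb_single diff_eq_eq add.commute)
qed

lemma D_d_one: "DW (d g) = d (del g)"
  using D_d[of 1 g] by simp

lemma additive_d: "additive d"
  by (simp add: additive_def d_add)

text \<open>General arguments are introduced from left to right: the last of them is a combination
  of terms \<open>a df\<close>, and linearity of both functions leads back to one more exact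
  differential.\<close>

lemma linear_slots_eq:
  assumes F: "linear_slots k F" and G: "linear_slots k G"
    and eq: "\<And>vs. length vs = k \<Longrightarrow> M.eqv k (F (map d vs)) (G (map d vs))"
  shows "length ws = k \<Longrightarrow> M.eqv k (F ws) (G ws)"
proof -
  note T = M.additive_total_der
  note tr = cg_trans[OF T] and sym = cg_sym[OF T]
  have "M.eqv k (F (A @ map d vs)) (G (A @ map d vs))" if "length A + length vs = k" for A vs
    using that
  proof (induction A arbitrary: vs rule: rev_induct)
    case Nil
    then show ?case using eq by simp
  next
    case (snoc w A)
    have len: "length A + length (map d vs) + 1 = k" using snoc.prems by simp
    obtain x where x: "w = free_comb actW d x" using generators by (metis surjD)
    have "M.eqv k (F (A @ free_comb actW d x # map d vs)) (G (A @ free_comb actW d x # map d vs))"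
    proof (induction x rule: poly_mapping_additive_induct)
      case (single f a)
      have "M.eqv k (F (A @ actW a (d f) # map d vs)) (M.S (length A) a (F (A @ map d (f # vs))))"
        "M.eqv k (G (A @ actW a (d f) # map d vs)) (M.S (length A) a (G (A @ map d (f # vs))))"
        using F G len by (simp_all add: linear_slots_def)
      moreover have "M.eqv k (M.S (length A) a (F (A @ map d (f # vs)))) (M.S (length A) a (G (A @ map d (f # vs))))"
        using snoc len by (intro M.cg_shift_act snoc.IH) simp_all
      ultimately show ?case unfolding free_comb_single by (metis tr sym)
    next
      case (add x y)
      have "M.eqv k (F (A @ (free_comb actW d x + free_comb actW d y) # map d vs))
          (F (A @ free_comb actW d x # map d vs) + F (A @ free_comb actW d y # map d vs))"
        "M.eqv k (G (A @ (free_comb actW d x + free_comb actW d y) # map d vs))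
          (G (A @ free_comb actW d x # map d vs) + G (A @ free_comb actW d y # map d vs))"
        using F G len by (simp_all add: linear_slots_def)
      then show ?case
        unfolding additive.add[OF additive_free_comb] using cg_add[OF T add.IH] by (metis tr sym)
    qed
    then show ?case by (simp add: x)
  qed
  from this[of ws "[]"] show "length ws = k \<Longrightarrow> M.eqv k (F ws) (G ws)" by simp
qed

section \<open>Extending a derivation in a single slot\<close>

definition deriv_slot :: "nat \<Rightarrow> nat \<Rightarrow> ('v \<Rightarrow> 'm mpol) \<Rightarrow> bool" where
  "deriv_slot k i h \<longleftrightarrow>
     (\<forall>f g. M.eqv k (h (f + g)) (h f + h g)) \<and>
     (\<forall>c f. M.eqv k (h (s c f)) (M.S i (s c 1) (h f))) \<and>
     (\<forall>f g. M.eqv k (h (f * g)) (M.S i f (h g) + M.S i g (h f))) \<and>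
     (\<forall>f. M.eqv k (h (del f)) (- var i (h f)))"

definition comb :: "nat \<Rightarrow> ('v \<Rightarrow> 'm mpol) \<Rightarrow> ('v \<Rightarrow>\<^sub>0 'v) \<Rightarrow> 'm mpol" where
  "comb i h = lsum (\<lambda>f a. M.S i a (h f))"

text \<open>A preimage under \<open>free_comb\<close> is chosen by \<open>SOME\<close>; for a
  derivation other preimages give congruent values by \<open>comb_rel\<close>. The choice depends on
  \<open>w\<close> alone, not on \<open>h\<close>.\<close>

definition ext :: "nat \<Rightarrow> ('v \<Rightarrow> 'm mpol) \<Rightarrow> 'w \<Rightarrow> 'm mpol" where
  "ext i h w = comb i h (SOME x. free_comb actW d x = w)"

lemma additive_comb: "additive (comb i h)"
  unfolding comb_def by (intro additive_lsum M.additive_S_coeff)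

lemma comb_single: "comb i h (single f a) = M.S i a (h f)"
  by (simp add: comb_def lsum_single)

lemma comb_scale: "comb i h (Poly_Mapping.map ((*) a) x) = M.S i a (comb i h x)"
proof -
  have a: "additive (Poly_Mapping.map ((*) a) :: ('v \<Rightarrow>\<^sub>0 'v) \<Rightarrow> _)"
    by (intro additive_map_poly_mapping) (simp add: additive_def distrib_left)
  show ?thesis
    by (induction x rule: poly_mapping_additive_induct)
      (simp_all add: map_single comb_single M.S_mult additive.add[OF additive_comb] additive.add[OF a] M.S_padd)
qed

lemma comb_cong_cg:
  assumes "i < k" "\<And>f. M.eqv k (h f) (h' f)"
  shows "M.eqv k (comb i h x) (comb i h' x)"
  unfolding comb_def lsum_def using assms by (intro cg_sum M.additive_total_der M.cg_shift_act)

lemma comb_hom: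
  assumes "additive X" "\<And>a p. X (M.S i a p) = M.S i a (X p)"
  shows "X (comb i h x) = comb i (\<lambda>f. X (h f)) x"
  by (simp add: comb_def lsum_def additive.sum[OF assms(1)] assms(2))

text \<open>An equality and not merely a congruence, as the same preimage of \<open>w\<close> is
  used for \<open>h\<close> and for its composition with \<open>X\<close>.\<close>

lemma ext_hom:
  "additive X \<Longrightarrow> (\<And>a p. X (M.S i a p) = M.S i a (X p)) \<Longrightarrow> X (ext i h w) = ext i (\<lambda>f. X (h f)) w"
  unfolding ext_def by (rule comb_hom)

lemma ext_plus: "ext i (\<lambda>f. h f + h' f) w = ext i h w + ext i h' w"
  by (simp add: ext_def comb_def lsum_def M.S_padd sum.distrib)

lemma ext_cong_cg:
  "i < k \<Longrightarrow> (\<And>f. M.eqv k (h f) (h' f)) \<Longrightarrow> M.eqv k (ext i h w) (ext i h' w)"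
  unfolding ext_def by (rule comb_cong_cg)

lemma ext_mem: "(\<And>f. h f \<in> mpols k) \<Longrightarrow> ext i h w \<in> mpols k"
  unfolding ext_def comb_def lsum_def by (intro mpols_sum M.mpols_S)

context
  fixes k i h
  assumes i: "i < k" and h: "deriv_slot k i h"
begin

text \<open>The three kinds of relations are additivity, scalars and the product rule, each a
  condition in \<open>deriv_slot\<close>; passing to the span uses that \<open>comb\<close> turns
  multiplication by \<open>a\<close> into \<open>S i a\<close>.\<close>

lemma comb_rel:
  assumes "x \<in> free.span (kaehler_rels s)"
  shows "M.eqv k (comb i h x) 0"
proof -
  note T = M.additive_total_der
  have rel: "M.eqv k (comb i h x) 0" if "x \<in> kaehler_rels s" for x
  proof -
    have z: "M.eqv k (p - q) 0" if "M.eqv k p q" for p q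
      using cg_diff[OF T that cg_refl[OF T, where p = q]] by simp
    from that consider
        f g where "x = single (f + g) 1 - single f 1 - single g 1"
      | c f where "x = single (s c f) 1 - single f (s c 1)"
      | f g where "x = single (f * g) 1 - single g f - single f g"
      unfolding kaehler_rels_def by blast
    then show ?thesis
    proof cases
      case 1
      then show ?thesis
        using z[of "h (f + g)" "h f + h g"] h
        by (simp add: additive.diff[OF additive_comb] comb_single deriv_slot_def flip: diff_diff_eq)
    next
      case 2
      then show ?thesis
        using z[of "h (s c f)" "M.S i (s c 1) (h f)"] h
        by (simp add: additive.diff[OF additive_comb] comb_single deriv_slot_def)
    next
      case 3
      then show ?thesis
        using z[of "h (f * g)" "M.S i f (h g) + M.S i g (h f)"] h
        by (simp add: additive.diff[OF additive_comb] comb_single deriv_slot_def flip: diff_diff_eq)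
    qed
  qed
  show ?thesis
    using assms
  proof (induction rule: free.span_induct_alt)
    case base
    then show ?case using T by (simp add: additive.zero[OF additive_comb])
  next
    case (step a x y)
    have "M.eqv k (M.S i a (comb i h x) + comb i h y) (M.S i a 0 + 0)"
      using i step by (intro cg_add[OF T] M.cg_shift_act rel[OF step(1)]) simp_all
    then show ?case
      by (simp add: additive.add[OF additive_comb] comb_scale M.S_pzero)
  qed
qed

text \<open>The chosen preimage and \<open>x\<close> differ by an element of the span of the
  relations.\<close>

lemma ext_free_comb: "M.eqv k (ext i h (free_comb actW d x)) (comb i h x)"
proof -
  note T = M.additive_total_der
  define y where "y = (SOME y. free_comb actW d y = free_comb actW d x)"
  have "free_comb actW d y = free_comb actW d x" unfolding y_def by (rule someI) simp
  then have "free_comb actW d (y - x) = 0" by (simp add: additive.diff[OF additive_free_comb])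
  then have "M.eqv k (comb i h (y - x)) 0" using relations comb_rel by blast
  from cg_add[OF T this cg_refl[OF T, where p = "comb i h x"]] show ?thesis
    by (simp add: ext_def additive.diff[OF additive_comb] flip: y_def)
qed

lemma ext_single: "M.eqv k (ext i h (actW a (d f))) (M.S i a (h f))"
  using ext_free_comb[of "single f a"] by (simp add: free_comb_single comb_single)

lemma ext_d: "M.eqv k (ext i h (d f)) (h f)"
  using ext_single[of 1 f] by simp

lemma ext_add: "M.eqv k (ext i h (w + w')) (ext i h w + ext i h w')"
proof -
  note T = M.additive_total_der
  obtain x y where "w = free_comb actW d x" "w' = free_comb actW d y" using generators by (metis surjD)
  moreover have "M.eqv k (ext i h (free_comb actW d (x + y)))
      (ext i h (free_comb actW d x) + ext i h (free_comb actW d y))"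
    by (rule cg_trans[OF T ext_free_comb[of "x + y"], unfolded additive.add[OF additive_comb],
          OF cg_sym[OF T cg_add[OF T ext_free_comb[of x] ext_free_comb[of y]]]])
  ultimately show ?thesis by (simp add: additive.add[OF additive_free_comb])
qed

lemma ext_act: "M.eqv k (ext i h (actW a w)) (M.S i a (ext i h w))"
proof -
  note T = M.additive_total_der
  obtain x where x: "w = free_comb actW d x" using generators by (metis surjD)
  have m: "additive (Poly_Mapping.map ((*) a) :: ('v \<Rightarrow>\<^sub>0 'v) \<Rightarrow> _)"
    by (intro additive_map_poly_mapping) (simp add: additive_def distrib_left)
  have "free_comb actW d (Poly_Mapping.map ((*) a) x) = actW a (free_comb actW d x)"
    by (induction x rule: poly_mapping_additive_induct)
      (simp_all add: map_single free_comb_single additive.add[OF additive_free_comb] additive.add[OF m]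
        mdl.scale_right_distrib)
  then have "M.eqv k (ext i h (actW a w)) (M.S i a (comb i h x))"
    using ext_free_comb[of "Poly_Mapping.map ((*) a) x"] by (simp add: x comb_scale)
  moreover have "M.eqv k (M.S i a (ext i h w)) (M.S i a (comb i h x))"
    unfolding x by (intro M.cg_shift_act i ext_free_comb)
  ultimately show ?thesis using cg_trans[OF T] cg_sym[OF T] by blast
qed

text \<open>On \<open>a df\<close> the two terms of \<open>D_d\<close> combine by the commutation of
  \<open>S i a\<close> with \<open>var i\<close>; the general case follows by additivity.\<close>

lemma ext_D: "M.eqv k (ext i h (DW w)) (- var i (ext i h w))"
proof -
  note T = M.additive_total_der
  note [trans] = cg_trans[OF T]
  obtain x where x: "w = free_comb actW d x" using generators by (metis surjD)
  have "M.eqv k (ext i h (DW (free_comb actW d x))) (- var i (ext i h (free_comb actW d x)))"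
  proof (induction x rule: poly_mapping_additive_induct)
    case (single f a)
    have "M.eqv k (ext i h (actW (del a) (d f) + actW a (d (del f))))
        (ext i h (actW (del a) (d f)) + ext i h (actW a (d (del f))))"
      by (rule ext_add)
    also have "M.eqv k \<dots> (M.S i (del a) (h f) + M.S i a (h (del f)))"
      by (intro cg_add[OF T] ext_single)
    also have "M.eqv k \<dots> (M.S i (del a) (h f) + M.S i a (- var i (h f)))"
      using h i by (intro cg_add[OF T] cg_refl[OF T] M.cg_shift_act) (simp_all add: deriv_slot_def)
    also have "\<dots> = - var i (M.S i a (h f))"
      by (simp add: M.S_puminus M.S_var_same)
    also have "M.eqv k \<dots> (- var i (ext i h (actW a (d f))))"
      by (intro cg_uminus[OF T] M.cg_var cg_sym[OF T ext_single])
    finally show ?case by (simp add: free_comb_single D_d)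
  next
    case (add x y)
    let ?x = "free_comb actW d x" and ?y = "free_comb actW d y"
    have "M.eqv k (ext i h (DW ?x + DW ?y)) (ext i h (DW ?x) + ext i h (DW ?y))"
      by (rule ext_add)
    also have "M.eqv k \<dots> (- var i (ext i h ?x) + - var i (ext i h ?y))"
      by (intro cg_add[OF T] add)
    also have "\<dots> = - var i (ext i h ?x + ext i h ?y)" by (simp add: var_add)
    also have "M.eqv k \<dots> (- var i (ext i h (?x + ?y)))"
      by (intro cg_uminus[OF T] M.cg_var cg_sym[OF T ext_add])
    finally show ?case by (simp add: additive.add[OF additive_free_comb] D_add)
  qed
  then show ?thesis by (simp add: x)
qed

end

text \<open>\<open>us\<close> fills the places already passed with elements of the algebra, hence
  the next argument belongs to slot \<open>length us\<close>. The innermost extension is that of the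
  last argument.\<close>

fun ext_list :: "('v list \<Rightarrow> 'm mpol) \<Rightarrow> 'w list \<Rightarrow> 'v list \<Rightarrow> 'm mpol" where
  "ext_list g [] us = g us"
| "ext_list g (w # ws) us = ext (length us) (\<lambda>f. ext_list g ws (us @ [f])) w"

definition derivations :: "nat \<Rightarrow> ('v list \<Rightarrow> 'm mpol) \<Rightarrow> bool" where
  "derivations k g \<longleftrightarrow> (\<forall>us. length us = k \<longrightarrow> g us \<in> mpols k) \<and>
     (\<forall>us i. length us = k \<longrightarrow> i < k \<longrightarrow> deriv_slot k i (\<lambda>f. g (us[i := f])))"

context
  fixes k g
  assumes g: "derivations k g"
begin

lemma ext_list_mem: "length ws + length us = k \<Longrightarrow> ext_list g ws us \<in> mpols k"
  using g by (induction ws arbitrary: us) (auto simp: derivations_def intro!: ext_mem)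

text \<open>Slot \<open>i\<close> differs from the slot being extended, so \<open>S i\<close> and
  \<open>var i\<close> can be moved inside \<open>ext\<close>, and the claim reduces to the inner
  function.\<close>

lemma ext_list_deriv_slot:
  "length ws + length us = k \<Longrightarrow> i < length us \<Longrightarrow> deriv_slot k i (\<lambda>f. ext_list g ws (us[i := f]))"
proof (induction ws arbitrary: us)
  case Nil
  then show ?case using g by (simp add: derivations_def)
next
  case (Cons w ws)
  note T = M.additive_total_der
  let ?n = "length us" and ?H = "\<lambda>f f'. ext_list g ws (us[i := f] @ [f'])"
  have n: "?n < k" "?n \<noteq> i" using Cons.prems by auto
  have IH: "deriv_slot k i (\<lambda>f. ?H f f')" for f'
    using Cons.IH[of "us @ [f']"] Cons.prems by (simp add: list_update_append)
  have S: "M.S i a (ext ?n h w) = ext ?n (\<lambda>f. M.S i a (h f)) w" for a h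
    by (intro ext_hom M.additive_shift_act M.S_S)
  have v: "- var i (ext ?n h w) = ext ?n (\<lambda>f. - var i (h f)) w" for h
    using n by (intro ext_hom[of "\<lambda>p. - var i p"] additive_uminus additive_var) (simp add: M.S_var_other M.S_puminus)
  show ?case
    unfolding deriv_slot_def ext_list.simps length_list_update S v ext_plus[symmetric]
    using IH n by (intro conjI allI ext_cong_cg) (simp_all add: deriv_slot_def)
qed

lemma ext_list_slot:
  assumes "length A + length B + 1 + length us = k"
  shows "M.eqv k (ext_list g (A @ (x + y) # B) us) (ext_list g (A @ x # B) us + ext_list g (A @ y # B) us)
    \<and> M.eqv k (ext_list g (A @ actW a x # B) us) (M.S (length us + length A) a (ext_list g (A @ x # B) us))
    \<and> M.eqv k (ext_list g (A @ DW x # B) us) (- var (length us + length A) (ext_list g (A @ x # B) us))"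
  using assms
proof (induction A arbitrary: us)
  case Nil
  have n: "length us < k" using Nil by simp
  have "deriv_slot k (length us) (\<lambda>f. ext_list g B ((us @ [0])[length us := f]))"
    using Nil by (intro ext_list_deriv_slot) simp_all
  then have h: "deriv_slot k (length us) (\<lambda>f. ext_list g B (us @ [f]))" by simp
  show ?case using ext_add[OF n h] ext_act[OF n h] ext_D[OF n h] by simp
next
  case (Cons w A)
  let ?n = "length us"
  let ?l = "?n + length (w # A)"
  have n: "?n < k" "?n \<noteq> ?l" using Cons.prems by auto
  have S: "M.S ?l a (ext ?n h w) = ext ?n (\<lambda>f. M.S ?l a (h f)) w" for h
    by (intro ext_hom M.additive_shift_act M.S_S)
  have v: "- var ?l (ext ?n h w) = ext ?n (\<lambda>f. - var ?l (h f)) w" for h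
    using n by (intro ext_hom[of "\<lambda>p. - var ?l p"] additive_uminus additive_var) (simp add: M.S_var_other M.S_puminus)
  have IH: "M.eqv k (ext_list g (A @ (x + y) # B) (us @ [f])) (ext_list g (A @ x # B) (us @ [f]) + ext_list g (A @ y # B) (us @ [f]))
    \<and> M.eqv k (ext_list g (A @ actW a x # B) (us @ [f])) (M.S ?l a (ext_list g (A @ x # B) (us @ [f])))
    \<and> M.eqv k (ext_list g (A @ DW x # B) (us @ [f])) (- var ?l (ext_list g (A @ x # B) (us @ [f])))" for f
    using Cons.IH[of "us @ [f]"] Cons.prems by simp
  show ?case
    unfolding append_Cons ext_list.simps ext_plus[symmetric] S v
    by (intro conjI ext_cong_cg n) (simp_all only: IH)
qed

lemma ext_list_d:
  "length vs + length us = k \<Longrightarrow> M.eqv k (ext_list g (map d vs) us) (g (us @ vs))"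
proof (induction vs arbitrary: us)
  case Nil
  then show ?case by simp
next
  case (Cons v vs)
  have n: "length us < k" using Cons.prems by simp
  have "deriv_slot k (length us) (\<lambda>f. ext_list g (map d vs) ((us @ [0])[length us := f]))"
    using Cons.prems by (intro ext_list_deriv_slot) simp_all
  then have h: "deriv_slot k (length us) (\<lambda>f. ext_list g (map d vs) (us @ [f]))" by simp
  have "M.eqv k (ext_list g (map d vs) (us @ [v])) (g ((us @ [v]) @ vs))"
    using Cons.prems by (intro Cons.IH) simp
  from cg_trans[OF M.additive_total_der ext_d[OF n h] this] show ?case by simp
qed

text \<open>Skew-symmetry is not visible in the recursive construction. Both sides of the identity
  are linear in every slot, and on exact differentials the extension is congruent to
  \<open>g\<close>, so \<open>linear_slots_eq\<close> applies.\<close>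

lemma good_ext_list:
  assumes skew: "M.skew k g"
  shows "good k (\<lambda>ws. ext_list g ws [])"
proof -
  note T = M.additive_total_der
  note [trans] = cg_trans[OF T]
  let ?F = "\<lambda>ws. ext_list g ws []"
  have lin: "linear_slots k ?F"
    unfolding linear_slots_def using ext_list_slot[of _ _ "[]"] by auto
  have mem: "?F ws \<in> mpols k" if "length ws = k" for ws
    using that by (intro ext_list_mem) simp
  have "M.skew k ?F"
    unfolding M.skew_def
  proof (intro allI impI)
    fix \<pi> and us :: "'w list" assume \<pi>: "\<pi> permutes {..<k}" and us: "length us = k"
    let ?s = "\<lambda>p. let q = msub (map (\<lambda>i. var (\<pi> i)) [0..<k]) p in if evenperm \<pi> then q else - q"
    have s: "M.eqv k (?s p) (?s q)" if "M.eqv k p q" for p q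
      using M.cg_msub_permutes[OF \<pi> that] cg_uminus[OF T] by (auto simp: Let_def)
    show "M.eqv k (?F us) (?s (?F (permute_list \<pi> us)))"
    proof (rule linear_slots_eq[OF lin _ _ us])
      show "linear_slots k (\<lambda>us. ?s (?F (permute_list \<pi> us)))"
        by (rule linear_slots_permute[OF lin mem \<pi>])
      fix vs :: "'v list" assume vs: "length vs = k"
      have "M.eqv k (?F (map d vs)) (g vs)"
        using ext_list_d[of vs "[]"] vs by simp
      also have "M.eqv k (g vs) (?s (g (permute_list \<pi> vs)))"
        using skew \<pi> vs unfolding M.skew_def by blast
      also have "M.eqv k (?s (g (permute_list \<pi> vs))) (?s (?F (map d (permute_list \<pi> vs))))"
        using ext_list_d[of "permute_list \<pi> vs" "[]"] vs by - (rule s, rule cg_sym[OF T], simp)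
      also have "map d (permute_list \<pi> vs) = permute_list \<pi> (map d vs)"
        using \<pi> vs by (intro permute_list_map[symmetric]) simp
      finally show "M.eqv k (?F (map d vs)) (?s (?F (permute_list \<pi> (map d vs))))" .
    qed
  qed
  moreover have "M.eqv k (?F (us[i := DW x])) (- var i (?F (us[i := x])))" if "length us = k" "i < k" for us i x
    using ext_list_slot[of "take i us" "drop (Suc i) us" "[]" x] that by (simp add: upd_conv_take_nth_drop)
  ultimately show ?thesis
    unfolding good_def using linear_slots_update[OF lin] mem by blast
qed

end

end

section \<open>Restriction of LCAd cochains to exact differentials\<close>

text \<open>Action terms agree exactly. Bracket terms agree only up to congruence, since
  \<open>d\<close> may kill the leading coefficient of a bracket and so shorten the sum.\<close>

lemma (in lcad_module) dsum_restrict: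
  fixes d :: "'u::ab_group_add \<Rightarrow> 'e"
  assumes f: "good k f" and d: "d 0 = 0"
    and lam': "\<And>u. lam (d u) = lam' u" and br': "\<And>u v. br (d u) (d v) = map_poly d (br' u v)"
    and g: "\<And>us. length us = k \<Longrightarrow> g us = f (map d us)" and us: "length us = Suc k"
  shows "M.eqv (Suc k) (dsum lam br f (zip (map d us) [0..<Suc k])) (dsum lam' br' g (zip us [0..<Suc k]))"
proof -
  note T = M.additive_total_der
  let ?\<sigma> = "\<lambda>(u, i). (d u, i)" and ?xs = "zip us [0..<Suc k]"
  have xs: "zip (map d us) [0..<Suc k] = map ?\<sigma> ?xs"
    by (simp add: zip_map1 del: upt_Suc)
  have fst: "map fst (map ?\<sigma> ys) = map d (map fst ys)" and snd: "map snd (map ?\<sigma> ys) = map snd ys" for ys :: "('u \<times> nat) list"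
    by (simp_all add: case_prod_beta comp_def)
  have bd: "mset (map snd ys) = mset [0..<Suc k]" "length ys = Suc k" if "mset ys = mset ?xs" for ys :: "('u \<times> nat) list"
    using that us idx_zip[OF us] by (metis mset_map, metis length_upt length_zip min.idem minus_nat.diff_0 mset_eq_length)
  have act: "act_term lam f (?\<sigma> x) (map ?\<sigma> ys) = act_term lam' g x ys" if "mset (x # ys) = mset ?xs" for x ys
    using bd(2)[OF that] by (simp add: act_term_def subval_def fst snd g lam' case_prod_beta del: map_map)
  have brt: "M.eqv (Suc k) (br_term br f (?\<sigma> x) (?\<sigma> y) (map ?\<sigma> ys)) (br_term br' g x y ys)"
    if "mset (x # y # ys) = mset ?xs" for x y ys
  proof -
    let ?h = "\<lambda>p. var (snd x) p + var (snd y) p"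
    have "mset (map snd (?\<sigma> x # ?\<sigma> y # map ?\<sigma> ys)) = mset [0..<Suc k]"
      using bd(1)[OF that] snd[of "x # y # ys"] by (simp only: list.map)
    from bh_zero[OF f this] have H0: "M.eqv (Suc k) (subval f ((0, ?h) # ops (map ?\<sigma> ys))) 0"
      by (simp add: case_prod_beta)
    have "br_term br' g x y ys = psum (var (snd x)) (\<lambda>w. subval f ((d w, ?h) # ops (map ?\<sigma> ys))) (br' (fst x) (fst y))"
      using bd(2)[OF that] by (simp add: br_term_def subval_def fst snd g del: map_map)
    moreover have "br_term br f (?\<sigma> x) (?\<sigma> y) (map ?\<sigma> ys)
        = psum (var (snd x)) (\<lambda>w. subval f ((w, ?h) # ops (map ?\<sigma> ys))) (map_poly d (br' (fst x) (fst y)))"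
      by (simp add: br_term_def br' case_prod_beta)
    ultimately show ?thesis
      using psum_map_poly_cg[of "total_der DM (Suc k)" "var (snd x)" "\<lambda>w. subval f ((w, ?h) # ops (map ?\<sigma> ys))" d,
          OF T additive_var _ H0 d] cg_sym[OF T]
      by (simp add: M.total_der_var)
  qed
  show ?thesis
    unfolding xs dsum_def asum_map asum2_map
  proof (intro cg_add T asum2_cong_cg brt)
    have "asum (\<lambda>x ys. act_term lam f (?\<sigma> x) (map ?\<sigma> ys)) ?xs = asum (act_term lam' g) ?xs"
      by (intro asum_cong act)
    then show "M.eqv (Suc k) (asum (\<lambda>x ys. act_term lam f (?\<sigma> x) (map ?\<sigma> ys)) ?xs) (asum (act_term lam' g) ?xs)"
      using T by simp
  qed
qed

section \<open>Sums and scalar multiples of cochains\<close>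

context cochain_modules
begin

lemma good_plus:
  assumes f: "good k f" and f': "good k f'"
  shows "good k (\<lambda>us. f us + f' us)"
  unfolding good_def
proof (intro conjI allI impI)
  note T = M.additive_total_der
  fix us :: "'e list" assume us: "length us = k"
  show "f us + f' us \<in> mpols k" by (intro mpols_add good_mem[OF f us] good_mem[OF f' us])
  fix i x y a assume i: "i < k"
  show "M.eqv k (f (us[i := x + y]) + f' (us[i := x + y]))
     (f (us[i := x]) + f' (us[i := x]) + (f (us[i := y]) + f' (us[i := y])))"
    using cg_add[OF T good_add[OF f us i] good_add[OF f' us i], of x y x y] by (simp add: algebra_simps)
  show "M.eqv k (f (us[i := actE a x]) + f' (us[i := actE a x])) (M.S i a (f (us[i := x]) + f' (us[i := x])))"
    unfolding M.S_padd by (intro cg_add[OF T] good_act[OF f us i] good_act[OF f' us i])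
  show "M.eqv k (f (us[i := DE x]) + f' (us[i := DE x])) (- var i (f (us[i := x]) + f' (us[i := x])))"
    unfolding var_add minus_add_distrib by (intro cg_add[OF T] good_D[OF f us i] good_D[OF f' us i])
next
  note T = M.additive_total_der
  show "M.skew k (\<lambda>us. f us + f' us)"
    unfolding M.skew_def
  proof (intro allI impI)
    fix \<pi> and us :: "'e list" assume \<pi>: "\<pi> permutes {..<k}" and us: "length us = k"
    have "msub (map (\<lambda>i. var (\<pi> i)) [0..<k]) (p + q)
        = msub (map (\<lambda>i. var (\<pi> i)) [0..<k]) p + msub (map (\<lambda>i. var (\<pi> i)) [0..<k]) q" for p q :: "'m mpol"
      by (simp add: additive.add[OF additive_msub])
    then show "M.eqv k (f us + f' us)
        (let q = msub (map (\<lambda>i. var (\<pi> i)) [0..<k]) (f (permute_list \<pi> us) + f' (permute_list \<pi> us)) in if evenperm \<pi> then q else - q)"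
      using cg_add[OF T good_skew[OF f us \<pi>] good_skew[OF f' us \<pi>]]
      by (cases "evenperm \<pi>") (simp_all add: Let_def)
  qed
qed

lemma good_hom:
  assumes f: "good k f" and X: "additive X" "\<And>i p. X (var i p) = var i (X p)" "\<And>i a p. X (M.S i a p) = M.S i a (X p)"
    "\<And>p. X (total_der DM k p) = total_der DM k (X p)" "\<And>p. p \<in> mpols k \<Longrightarrow> X p \<in> mpols k"
    "\<And>Ls p. set Ls \<subseteq> lin \<Longrightarrow> X (msub Ls p) = msub Ls (X p)"
  shows "good k (\<lambda>us. X (f us))"
proof -
  have cgX: "M.eqv k (X p) (X q)" if "M.eqv k p q" for p q
    by (rule cg_apply[of X "total_der DM k" "total_der DM k", OF X(1,4) that])
  show ?thesis
    unfolding good_def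
  proof (intro conjI allI impI)
    fix us :: "'e list" assume us: "length us = k"
    show "X (f us) \<in> mpols k" by (intro X good_mem[OF f us])
    fix i x y a assume i: "i < k"
    show "M.eqv k (X (f (us[i := x + y]))) (X (f (us[i := x])) + X (f (us[i := y])))"
      using cgX[OF good_add[OF f us i]] by (simp add: additive.add[OF X(1)])
    show "M.eqv k (X (f (us[i := actE a x]))) (M.S i a (X (f (us[i := x]))))"
      using cgX[OF good_act[OF f us i]] by (simp add: X(3))
    show "M.eqv k (X (f (us[i := DE x]))) (- var i (X (f (us[i := x]))))"
      using cgX[OF good_D[OF f us i]] by (simp add: X(2) additive.minus[OF X(1)])
  next
    show "M.skew k (\<lambda>us. X (f us))"
      unfolding M.skew_def
    proof (intro allI impI)
      fix \<pi> and us :: "'e list" assume \<pi>: "\<pi> permutes {..<k}" and us: "length us = k"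
      have "msub (map (\<lambda>i. var (\<pi> i)) [0..<k]) (X p) = X (msub (map (\<lambda>i. var (\<pi> i)) [0..<k]) p)" for p
        by (simp add: X(6))
      then show "M.eqv k (X (f us))
          (let q = msub (map (\<lambda>i. var (\<pi> i)) [0..<k]) (X (f (permute_list \<pi> us))) in if evenperm \<pi> then q else - q)"
        using cgX[OF good_skew[OF f us \<pi>]]
        by (cases "evenperm \<pi>") (simp_all add: Let_def additive.minus[OF X(1)])
    qed
  qed
qed

lemma good_scale:
  assumes f: "good k f"
  shows "good k (\<lambda>us. Poly_Mapping.map (fscale s actM c) (f us))"
proof -
  \<comment> \<open>Slot 0 is used for every \<open>k\<close>, including \<open>k = 0\<close>, which
    \<open>total_der_S\<close> does not cover; a scalar is killed by \<open>del\<close>, so it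
    commutes with \<open>M.DD\<close> in any case.\<close>
  have DD: "M.DD (M.S 0 (s c 1) p) = M.S 0 (s c 1) (M.DD p)" for p
    by (simp add: M.DD_S)
  have a: "additive (fscale s actM c)"
    unfolding fscale_def[abs_def] by (rule M.additive_act)
  have var: "Poly_Mapping.map (fscale s actM c) (var i p) = var i (Poly_Mapping.map (fscale s actM c) p)" for i p
    by (rule map_var[OF a])
  show ?thesis
  proof (rule good_hom[OF f])
    show "Poly_Mapping.map (fscale s actM c) (total_der DM k p) = total_der DM k (Poly_Mapping.map (fscale s actM c) p)" for p
      unfolding total_der_def additive.add[OF additive_map_poly_mapping[OF a]] additive.sum[OF additive_map_poly_mapping[OF a]] var
      by (simp add: fscale_map[of c _ 0] DD)
    show "Poly_Mapping.map (fscale s actM c) (M.S i b p) = M.S i b (Poly_Mapping.map (fscale s actM c) p)" for i b p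
      by (simp add: fscale_map[of c _ 0] M.S_S)
    show "Poly_Mapping.map (fscale s actM c) p \<in> mpols k" if "p \<in> mpols k" for p
      using that by (simp add: fscale_map[of c _ 0] M.mpols_S)
    show "Poly_Mapping.map (fscale s actM c) (msub Ls p) = msub Ls (Poly_Mapping.map (fscale s actM c) p)" if "set Ls \<subseteq> lin" for Ls p
      by (rule msub_map[OF that a, symmetric])
  qed (intro additive_map_poly_mapping a var)+
qed

lemma cochain_add_closed:
  assumes "\<phi> \<in> lcad_cochains s del actE DE actM DM k" "\<psi> \<in> lcad_cochains s del actE DE actM DM k"
  shows "cochain_add DM k \<phi> \<psi> \<in> lcad_cochains s del actE DE actM DM k"
  unfolding cochain_add_def by (intro good_cochain good_plus good_rep assms)

lemma cochain_scale_closed: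
  assumes "\<phi> \<in> lcad_cochains s del actE DE actM DM k"
  shows "cochain_scale (fscale s actM) DM k c \<phi> \<in> lcad_cochains s del actE DE actM DM k"
  unfolding cochain_scale_def by (intro good_cochain good_scale good_rep assms)

end

section \<open>PVA cochains as derivations in each slot, and restriction on classes\<close>

context kaehler_module
begin

lemma pva_cochainD:
  assumes "\<gamma> \<in> pva_cochains s del actM DM k"
  shows "\<gamma> \<in> extensional {us. length us = k}"
    and "length us = k \<Longrightarrow> \<gamma> us \<in> mpols k // red_rel DM k"
  using assms by (auto simp: pva_cochains_def multilinear_maps_def PiE_iff)

lemma pva_cochain_rep:
  assumes \<gamma>: "\<gamma> \<in> pva_cochains s del actM DM k"
  shows "derivations k (\<lambda>us. rep (\<gamma> us))" "M.skew k (\<lambda>us. rep (\<gamma> us))"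
proof -
  note q = pva_cochainD(2)[OF \<gamma>]
  have cgI: "M.eqv k (rep (\<gamma> us)) p" if "length us = k" "p \<in> \<gamma> us" for us p
    using that M.mem_quotient[OF q] by simp
  have in_rep: "rep (\<gamma> us) \<in> \<gamma> us" if "length us = k" for us
    using M.rep_in[OF q[OF that]] .
  show "M.skew k (\<lambda>us. rep (\<gamma> us))"
    using \<gamma> M.skew_symmetric_iff[of k \<gamma> "\<lambda>us. rep (\<gamma> us)", OF q in_rep] by (simp add: pva_cochains_def)
  show "derivations k (\<lambda>us. rep (\<gamma> us))"
    unfolding derivations_def deriv_slot_def
  proof (intro conjI allI impI)
    fix us :: "'v list" assume us: "length us = k"
    show "rep (\<gamma> us) \<in> mpols k" by (intro M.rep_mem q us)
    fix i assume i: "i < k"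
    fix f g c
    have ml: "\<gamma> \<in> multilinear_maps s (fscale s actM) DM k" using \<gamma> by (simp add: pva_cochains_def)
    show "M.eqv k (rep (\<gamma> (us[i := f + g]))) (rep (\<gamma> (us[i := f])) + rep (\<gamma> (us[i := g])))"
    proof (rule cgI)
      show "rep (\<gamma> (us[i := f])) + rep (\<gamma> (us[i := g])) \<in> \<gamma> (us[i := f + g])"
        using ml us i in_rep by (simp add: multilinear_maps_def)
    qed (use us in simp)
    show "M.eqv k (rep (\<gamma> (us[i := s c f]))) (M.S i (s c 1) (rep (\<gamma> (us[i := f]))))"
    proof (rule cgI)
      have "Poly_Mapping.map (fscale s actM c) (rep (\<gamma> (us[i := f]))) \<in> \<gamma> (us[i := s c f])"
        using ml us i in_rep by (simp add: multilinear_maps_def)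
      then show "M.S i (s c 1) (rep (\<gamma> (us[i := f]))) \<in> \<gamma> (us[i := s c f])"
        by (simp add: fscale_map[of c _ i])
    qed (use us in simp)
    have c: "\<forall>us i. length us = k \<and> i < k \<longrightarrow>
           (\<forall>p \<in> \<gamma> us. - var i p \<in> \<gamma> (us[i := del (us ! i)])) \<and>
           (\<forall>b c. \<forall>p \<in> \<gamma> (us[i := c]). \<forall>q \<in> \<gamma> (us[i := b]). M.S i b p + M.S i c q \<in> \<gamma> (us[i := b * c]))"
      using \<gamma> by (simp add: pva_cochains_def)
    show "M.eqv k (rep (\<gamma> (us[i := f * g]))) (M.S i f (rep (\<gamma> (us[i := g]))) + M.S i g (rep (\<gamma> (us[i := f]))))"
      using c us i in_rep by (intro cgI) simp_all
    show "M.eqv k (rep (\<gamma> (us[i := del f]))) (- var i (rep (\<gamma> (us[i := f]))))"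
    proof (rule cgI)
      show "- var i (rep (\<gamma> (us[i := f]))) \<in> \<gamma> (us[i := del f])"
        using c[rule_format, of "us[i := f]" i] us i in_rep by simp
    qed (use us in simp)
  qed
qed

lemma derivations_cochain:
  assumes g: "derivations k g" and skew: "M.skew k g"
  shows "(\<lambda>us\<in>{us. length us = k}. cls DM k (g us)) \<in> pva_cochains s del actM DM k" (is "?\<gamma> \<in> _")
proof -
  note T = M.additive_total_der
  note tr = cg_trans[OF T]
  have mem: "g us \<in> mpols k" if "length us = k" for us
    using g that by (simp add: derivations_def)
  have der: "deriv_slot k i (\<lambda>f. g (us[i := f]))" if "length us = k" "i < k" for us i
    using g that by (simp add: derivations_def)
  have memI: "p \<in> ?\<gamma> us \<longleftrightarrow> p \<in> mpols k \<and> M.eqv k (g us) p" if "length us = k" for us p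
    using that M.mem_cls[OF mem[OF that]] by simp
  have q: "?\<gamma> us \<in> mpols k // red_rel DM k" if "length us = k" for us
    using that mem[OF that] by (auto simp: M.quotient_iff)
  note [simp del] = restrict_apply restrict_apply'
  show ?thesis
    unfolding pva_cochains_def multilinear_maps_def mem_Collect_eq
  proof (intro conjI allI impI ballI; (elim conjE)?)
    show "?\<gamma> \<in> {us. length us = k} \<rightarrow>\<^sub>E mpols k // red_rel DM k"
      using q by (intro PiE_I) (simp, simp add: restrict_def)
  next
    fix us i x y p r
    assume us: "length us = k" "i < k" and p: "p \<in> ?\<gamma> (us[i := x])" and r: "r \<in> ?\<gamma> (us[i := y])"
    have "M.eqv k (g (us[i := x + y])) (g (us[i := x]) + g (us[i := y]))"
      using der[OF us] by (simp add: deriv_slot_def)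
    moreover have "M.eqv k (g (us[i := x]) + g (us[i := y])) (p + r)"
      using p r us by (intro cg_add T) (simp_all add: memI)
    ultimately have "M.eqv k (g (us[i := x + y])) (p + r)" by (rule tr)
    then show "p + r \<in> ?\<gamma> (us[i := x + y])"
      using p r us by (simp add: memI mpols_add)
  next
    fix us i c x p
    assume us: "length us = k" "i < k" and p: "p \<in> ?\<gamma> (us[i := x])"
    have "M.eqv k (g (us[i := s c x])) (M.S i (s c 1) (g (us[i := x])))"
      using der[OF us] by (simp add: deriv_slot_def)
    moreover have "M.eqv k (M.S i (s c 1) (g (us[i := x]))) (M.S i (s c 1) p)"
      using p us by (intro M.cg_shift_act) (simp_all add: memI)
    ultimately have "M.eqv k (g (us[i := s c x])) (M.S i (s c 1) p)" by (rule tr)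
    then show "Poly_Mapping.map (fscale s actM c) p \<in> ?\<gamma> (us[i := s c x])"
      unfolding fscale_map[of c p i] using p us by (simp add: memI M.mpols_S)
  next
    fix us i p
    assume us: "length us = k" "i < k" and p: "p \<in> ?\<gamma> us"
    have "M.eqv k (g (us[i := del (us ! i)])) (- var i (g (us[i := us ! i])))"
      using der[OF us] unfolding deriv_slot_def by blast
    moreover have "M.eqv k (- var i (g (us[i := us ! i]))) (- var i p)"
      using p us by (intro cg_uminus[OF T] M.cg_var) (simp add: memI)
    ultimately have "M.eqv k (g (us[i := del (us ! i)])) (- var i p)" by (rule tr)
    then show "- var i p \<in> ?\<gamma> (us[i := del (us ! i)])"
      using p us by (simp add: memI mpols_uminus mpols_var)
  next
    fix us i b c p r
    assume us: "length us = k" "i < k" and p: "p \<in> ?\<gamma> (us[i := c])" and r: "r \<in> ?\<gamma> (us[i := b])"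
    have "M.eqv k (g (us[i := b * c])) (M.S i b (g (us[i := c])) + M.S i c (g (us[i := b])))"
      using der[OF us] by (simp add: deriv_slot_def)
    moreover have "M.eqv k (M.S i b (g (us[i := c])) + M.S i c (g (us[i := b]))) (M.S i b p + M.S i c r)"
      using p r us by (intro cg_add T M.cg_shift_act) (simp_all add: memI)
    ultimately have "M.eqv k (g (us[i := b * c])) (M.S i b p + M.S i c r)" by (rule tr)
    then show "M.S i b p + M.S i c r \<in> ?\<gamma> (us[i := b * c])"
      using p r us by (simp add: memI mpols_add M.mpols_S)
  next
    show "skew_symmetric k ?\<gamma>"
      using skew M.skew_symmetric_iff[of k ?\<gamma> g, OF q] memI mem by simp
  qed
qed

text \<open>Expanding \<open>d\<close> of a product by \<open>d_mult\<close> turns linearity in a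
  slot into the product rule.\<close>

lemma good_restrict:
  assumes f: "good k f"
  shows "derivations k (\<lambda>us. f (map d us))" "M.skew k (\<lambda>us. f (map d us))"
proof -
  note T = M.additive_total_der
  note [trans] = cg_trans[OF T]
  show "derivations k (\<lambda>us. f (map d us))"
    unfolding derivations_def deriv_slot_def map_update d_add d_scale d_mult
  proof (intro conjI allI impI)
    fix us :: "'v list" assume us: "length us = k"
    then have len: "length (map d us) = k" by simp
    show "f (map d us) \<in> mpols k" by (rule good_mem[OF f len])
    fix i assume i: "i < k"
    fix x y c
    show "M.eqv k (f ((map d us)[i := d x + d y])) (f ((map d us)[i := d x]) + f ((map d us)[i := d y]))"
      by (rule good_add[OF f len i])
    show "M.eqv k (f ((map d us)[i := actW (s c 1) (d x)])) (M.S i (s c 1) (f ((map d us)[i := d x])))"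
      by (rule good_act[OF f len i])
    have "M.eqv k (f ((map d us)[i := actW x (d y) + actW y (d x)]))
        (f ((map d us)[i := actW x (d y)]) + f ((map d us)[i := actW y (d x)]))"
      by (rule good_add[OF f len i])
    also have "M.eqv k \<dots> (M.S i x (f ((map d us)[i := d y])) + M.S i y (f ((map d us)[i := d x])))"
      by (intro cg_add[OF T] good_act[OF f len i])
    finally show "M.eqv k (f ((map d us)[i := actW x (d y) + actW y (d x)]))
        (M.S i x (f ((map d us)[i := d y])) + M.S i y (f ((map d us)[i := d x])))" .
    show "M.eqv k (f ((map d us)[i := d (del x)])) (- var i (f ((map d us)[i := d x])))"
      using good_D[OF f len i, of "d x"] by (simp add: D_d_one)
  qed
  show "M.skew k (\<lambda>us. f (map d us))"
    unfolding M.skew_def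
  proof (intro allI impI)
    fix \<pi> and us :: "'v list" assume \<pi>: "\<pi> permutes {..<k}" and us: "length us = k"
    have "map d (permute_list \<pi> us) = permute_list \<pi> (map d us)"
      using \<pi> us by (intro permute_list_map[symmetric]) simp
    then show "M.eqv k (f (map d us))
        (let q = msub (map (\<lambda>i. var (\<pi> i)) [0..<k]) (f (map d (permute_list \<pi> us))) in if evenperm \<pi> then q else - q)"
      using good_skew[OF f, of "map d us" \<pi>] us \<pi> by simp
  qed
qed

definition restrict_d :: "nat \<Rightarrow> ('w, 'm) cochain \<Rightarrow> ('v, 'm) cochain" where
  "restrict_d k \<phi> = (\<lambda>us\<in>{us. length us = k}. \<phi> (map d us))"

text \<open>Injectivity is \<open>linear_slots_eq\<close>; a preimage of a PVA cochain is the class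
  of the iterated extension of its representatives.\<close>

lemma restrict_d_bij:
  "bij_betw (restrict_d k) (lcad_cochains s del actW DW actM DM k) (pva_cochains s del actM DM k)"
proof (rule bij_betwI')
  note T = M.additive_total_der
  fix \<phi> \<psi>
  assume \<phi>: "\<phi> \<in> lcad_cochains s del actW DW actM DM k" and \<psi>: "\<psi> \<in> lcad_cochains s del actW DW actM DM k"
  note gd = good_rep[OF \<phi>] good_rep[OF \<psi>]
  have "\<phi> = \<psi>" if eq: "restrict_d k \<phi> = restrict_d k \<psi>"
  proof (rule extensionalityI[OF lcad_cochainD(1)[OF \<phi>] lcad_cochainD(1)[OF \<psi>]])
    fix us :: "'w list" assume "us \<in> {us. length us = k}"
    then have us: "length us = k" by simp
    have "M.eqv k (rep (\<phi> us)) (rep (\<psi> us))"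
    proof (rule linear_slots_eq[OF good_linear_slots[OF gd(1)] good_linear_slots[OF gd(2)] _ us])
      fix vs :: "'v list" assume "length vs = k"
      then have "\<phi> (map d vs) = \<psi> (map d vs)"
        using fun_cong[OF eq, of vs] by (simp add: restrict_d_def)
      then show "M.eqv k (rep (\<phi> (map d vs))) (rep (\<psi> (map d vs)))" using T by simp
    qed
    then have "cls DM k (rep (\<phi> us)) = cls DM k (rep (\<psi> us))"
      using good_mem[OF gd(1) us] good_mem[OF gd(2) us] by (simp add: M.cls_eq_iff)
    then show "\<phi> us = \<psi> us"
      using M.cls_rep[OF lcad_cochainD(2)[OF \<phi> us]] M.cls_rep[OF lcad_cochainD(2)[OF \<psi> us]] by simp
  qed
  then show "restrict_d k \<phi> = restrict_d k \<psi> \<longleftrightarrow> \<phi> = \<psi>" by auto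
next
  fix \<phi> assume \<phi>: "\<phi> \<in> lcad_cochains s del actW DW actM DM k"
  have "restrict_d k \<phi> = (\<lambda>us\<in>{us. length us = k}. cls DM k (rep (\<phi> (map d us))))"
    using M.cls_rep[OF lcad_cochainD(2)[OF \<phi>]] by (auto simp: restrict_d_def fun_eq_iff restrict_def)
  then show "restrict_d k \<phi> \<in> pva_cochains s del actM DM k"
    using derivations_cochain[OF good_restrict[OF good_rep[OF \<phi>]]] by simp
next
  fix \<gamma> assume \<gamma>: "\<gamma> \<in> pva_cochains s del actM DM k"
  let ?g = "\<lambda>us. rep (\<gamma> us)"
  note g = pva_cochain_rep[OF \<gamma>]
  let ?F = "\<lambda>ws. ext_list ?g ws []"
  let ?\<phi> = "\<lambda>ws\<in>{ws. length ws = k}. cls DM k (?F ws)"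
  have F: "good k ?F" by (rule good_ext_list[OF g])
  have "\<gamma> = restrict_d k ?\<phi>"
  proof (rule extensionalityI[OF pva_cochainD(1)[OF \<gamma>]])
    show "restrict_d k ?\<phi> \<in> extensional {us. length us = k}" by (simp add: restrict_d_def)
    fix us :: "'v list" assume "us \<in> {us. length us = k}"
    then have us: "length us = k" by simp
    have "M.eqv k (?F (map d us)) (?g us)"
      using ext_list_d[OF g(1), of us "[]"] us by simp
    then have "cls DM k (?F (map d us)) = cls DM k (?g us)"
      using good_mem[OF F, of "map d us"] us M.rep_mem[OF pva_cochainD(2)[OF \<gamma> us]] by (simp add: M.cls_eq_iff)
    then show "\<gamma> us = restrict_d k ?\<phi> us"
      using us M.cls_rep[OF pva_cochainD(2)[OF \<gamma> us]] by (simp add: restrict_d_def)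
  qed
  moreover have "?\<phi> \<in> lcad_cochains s del actW DW actM DM k" by (rule good_cochain[OF F])
  ultimately show "\<exists>\<phi>\<in>lcad_cochains s del actW DW actM DM k. \<gamma> = restrict_d k \<phi>" by blast
qed

lemma restrict_d_add:
  "restrict_d k (cochain_add DM k \<phi> \<psi>) = cochain_add DM k (restrict_d k \<phi>) (restrict_d k \<psi>)"
  by (auto simp: restrict_d_def cochain_add_def fun_eq_iff restrict_def)

lemma restrict_d_scale:
  "restrict_d k (cochain_scale sM DM k c \<phi>) = cochain_scale sM DM k c (restrict_d k \<phi>)"
  by (auto simp: restrict_d_def cochain_scale_def fun_eq_iff restrict_def)

end

theorem theorem5p2:
  fixes s :: "'f::field_char_0 \<Rightarrow> 'v::comm_ring_1 \<Rightarrow> 'v"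
    and del :: "'v \<Rightarrow> 'v"
    and br :: "'v \<Rightarrow> 'v \<Rightarrow> 'v poly"
    and actM :: "'v \<Rightarrow> 'm::ab_group_add \<Rightarrow> 'm"
    and DM :: "'m \<Rightarrow> 'm"
    and lam :: "'v \<Rightarrow> 'm \<Rightarrow> 'm poly"
    and act\<Omega> :: "'v \<Rightarrow> 'w::ab_group_add \<Rightarrow> 'w"
    and D\<Omega> :: "'w \<Rightarrow> 'w"
    and d :: "'v \<Rightarrow> 'w"
    and br\<Omega> :: "'w \<Rightarrow> 'w \<Rightarrow> 'w poly"
    and anchor :: "'w \<Rightarrow> 'v \<Rightarrow> 'v poly"
    and lam\<Omega> :: "'w \<Rightarrow> 'm \<Rightarrow> 'm poly"
  assumes pva: "poisson_vertex_algebra s del br"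
    and pva_mod: "pva_module s del br actM DM lam"
    and kaehler: "kaehler_differentials s del act\<Omega> D\<Omega> d"
    and lcad: "lie_conformal_algebroid s del act\<Omega> D\<Omega> br\<Omega> anchor"
    and anchor_d: "\<And>f g. anchor (d f) g = br f g"
    and br_d: "\<And>f g. br\<Omega> (d f) (d g) = map_poly d (br f g)"
    and lcad_mod: "lcad_module s del act\<Omega> D\<Omega> br\<Omega> anchor actM DM lam\<Omega>"
    and lam_d: "\<And>f g m. plug (var 0) (lam\<Omega> (act\<Omega> f (d g)) m)
                  = shift_act del actM 0 [:f:] (plug (var 0) (lam g m))"
  shows "\<exists>\<Phi>.
      complex_iso (fscale s actM) DM
        (pva_cochains s del actM DM) (cochain_diff lam br DM)
        (lcad_cochains s del act\<Omega> D\<Omega> actM DM) (cochain_diff lam\<Omega> br\<Omega> DM)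
        \<Phi> \<and>
      (\<forall>k. \<forall>\<gamma> \<in> pva_cochains s del actM DM k. \<forall>as us.
         length as = k \<and> length us = k \<longrightarrow>
         (\<forall>p \<in> \<gamma> us.
            shift_acts del actM (map (\<lambda>a. [:a:]) as) p
              \<in> \<Phi> k \<gamma> (map2 (\<lambda>a u. act\<Omega> a (d u)) as us)))"
proof -
  interpret L: lcad_module s del act\<Omega> D\<Omega> br\<Omega> anchor actM DM lam\<Omega> by (rule lcad_mod)
  interpret O: kaehler_differentials s del act\<Omega> D\<Omega> d by (rule kaehler)
  interpret K: kaehler_module s del act\<Omega> D\<Omega> d actM DM ..
  let ?A = "pva_cochains s del actM DM" and ?B = "lcad_cochains s del act\<Omega> D\<Omega> actM DM"
  let ?\<Psi> = K.restrict_d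
  \<comment> \<open>\<open>\<Phi>\<close> is the inverse of restriction, so identities for it are
    checked after restricting, by \<open>\<Phi>I\<close>; the explicit formula is derived at the end
    from linearity.\<close>
  define \<Phi> where "\<Phi> k = the_inv_into (?B k) (?\<Psi> k)" for k
  note bij = K.restrict_d_bij
  have \<Phi>B: "\<Phi> k \<gamma> \<in> ?B k" if "\<gamma> \<in> ?A k" for k \<gamma>
    using that bij_betw_the_inv_into[OF bij[of k]] unfolding \<Phi>_def by (rule bij_betwE[rule_format, rotated])
  have \<Psi>\<Phi>: "?\<Psi> k (\<Phi> k \<gamma>) = \<gamma>" if "\<gamma> \<in> ?A k" for k \<gamma>
    unfolding \<Phi>_def using that by (intro f_the_inv_into_f_bij_betw[OF bij[of k]])
  have \<Phi>I: "\<Phi> k \<gamma> = \<phi>" if "\<phi> \<in> ?B k" "?\<Psi> k \<phi> = \<gamma>" for k \<gamma> \<phi>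
    using that bij[of k] unfolding \<Phi>_def by (auto simp: bij_betw_def intro: the_inv_into_f_eq)
  have \<Psi>A: "?\<Psi> k \<phi> \<in> ?A k" if "\<phi> \<in> ?B k" for k \<phi>
    using that bij[of k] by (auto simp: bij_betw_def)
  \<comment> \<open>\<open>lam_d\<close> at the unit: acting by 1 and the shifted multiplication by
    1 are both the identity.\<close>
  have lam_d': "lam\<Omega> (d u) = lam u" for u
    using lam_d[of 1 u] by (intro ext plug_var_inject[of 0]) simp
  have diff: "?\<Psi> (Suc k) (cochain_diff lam\<Omega> br\<Omega> DM k \<phi>) = cochain_diff lam br DM k (?\<Psi> k \<phi>)" if \<phi>: "\<phi> \<in> ?B k" for k \<phi>
  proof (rule extensionalityI[where A = "{us. length us = Suc k}"])
    show "?\<Psi> (Suc k) (cochain_diff lam\<Omega> br\<Omega> DM k \<phi>) \<in> extensional {us. length us = Suc k}"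
      by (simp add: K.restrict_d_def)
    show "cochain_diff lam br DM k (?\<Psi> k \<phi>) \<in> extensional {us. length us = Suc k}"
      by (simp add: cochain_diff_def)
    fix us :: "'v list" assume "us \<in> {us. length us = Suc k}"
    then have us: "length us = Suc k" by simp
    note f = L.good_rep[OF \<phi>]
    let ?x = "dsum lam\<Omega> br\<Omega> (\<lambda>us. rep (\<phi> us)) (zip (map d us) [0..<Suc k])"
      and ?y = "dsum lam br (\<lambda>us. rep (?\<Psi> k \<phi> us)) (zip us [0..<Suc k])"
    have xy: "L.M.eqv (Suc k) ?x ?y"
      by (rule L.dsum_restrict[OF f additive.zero[OF K.additive_d] lam_d' br_d _ us]) (simp add: K.restrict_d_def)
    have "additive (lam u)" for u
      using pva_module.lam_linear_right[OF pva_mod] by (rule lin_to_poly_additive)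
    then have "cls DM (Suc k) ?x = cls DM (Suc k) ?y"
      using xy us by (subst L.M.cls_eq_iff) (auto intro!: mpols_dsum L.additive_lam_right simp del: upt_Suc mset_map)
    then show "?\<Psi> (Suc k) (cochain_diff lam\<Omega> br\<Omega> DM k \<phi>) us = cochain_diff lam br DM k (?\<Psi> k \<phi>) us"
      using us by (simp add: K.restrict_d_def cochain_diff_dsum del: upt_Suc)
  qed
  \<comment> \<open>\<open>\<gamma>\<close> is the restriction of \<open>\<Phi> k \<gamma>\<close>,
    whose differential is again a cochain, and restriction commutes with the differentials.\<close>
  have dA: "cochain_diff lam br DM k \<gamma> \<in> ?A (Suc k)" if "\<gamma> \<in> ?A k" for k \<gamma>
    using \<Psi>A[OF L.cochain_diff_closed[OF \<Phi>B[OF that]]] by (simp add: diff \<Phi>B \<Psi>\<Phi> that)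
  have "complex_iso (fscale s actM) DM ?A (cochain_diff lam br DM) ?B (cochain_diff lam\<Omega> br\<Omega> DM) \<Phi>"
    unfolding complex_iso_def
  proof (intro allI conjI ballI)
    fix k
    show "cochain_diff lam br DM k \<in> ?A k \<rightarrow> ?A (Suc k)" using dA by blast
    show "cochain_diff lam\<Omega> br\<Omega> DM k \<in> ?B k \<rightarrow> ?B (Suc k)" using L.cochain_diff_closed by blast
    show "bij_betw (\<Phi> k) (?A k) (?B k)" unfolding \<Phi>_def by (rule bij_betw_the_inv_into[OF bij])
  next
    fix k \<gamma> \<gamma>' assume "\<gamma> \<in> ?A k" "\<gamma>' \<in> ?A k"
    then show "\<Phi> k (cochain_add DM k \<gamma> \<gamma>') = cochain_add DM k (\<Phi> k \<gamma>) (\<Phi> k \<gamma>')"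
      by (intro \<Phi>I L.cochain_add_closed \<Phi>B) (simp_all add: K.restrict_d_add \<Psi>\<Phi>)
  next
    fix k c \<gamma> assume "\<gamma> \<in> ?A k"
    then show "\<Phi> k (cochain_scale (fscale s actM) DM k c \<gamma>) = cochain_scale (fscale s actM) DM k c (\<Phi> k \<gamma>)"
      by (intro \<Phi>I L.cochain_scale_closed \<Phi>B) (simp_all add: K.restrict_d_scale \<Psi>\<Phi>)
  next
    fix k \<gamma> assume "\<gamma> \<in> ?A k"
    then show "\<Phi> (Suc k) (cochain_diff lam br DM k \<gamma>) = cochain_diff lam\<Omega> br\<Omega> DM k (\<Phi> k \<gamma>)"
      by (intro \<Phi>I L.cochain_diff_closed \<Phi>B) (simp_all add: diff \<Phi>B \<Psi>\<Phi>)
  qed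
  moreover have "shift_acts del actM (map (\<lambda>a. [:a:]) as) p \<in> \<Phi> k \<gamma> (map2 (\<lambda>a u. act\<Omega> a (d u)) as us)"
    if \<gamma>: "\<gamma> \<in> ?A k" and len: "length as = k" "length us = k" and p: "p \<in> \<gamma> us" for k \<gamma> as us p
  proof -
    have p': "p \<in> \<Phi> k \<gamma> (map d us)"
      using p fun_cong[OF \<Psi>\<Phi>[OF \<gamma>], of us] len by (simp add: K.restrict_d_def)
    have "\<forall>as us. length as = k \<and> length us = k \<longrightarrow>
           (\<forall>p \<in> \<Phi> k \<gamma> us. shift_acts del actM (map (pneg del) as) p \<in> \<Phi> k \<gamma> (map2 (dop act\<Omega> D\<Omega>) as us))"
      using \<Phi>B[OF \<gamma>] by (simp add: lcad_cochains_def)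
    \<comment> \<open>The cochain condition for constant symbols, which are their own adjoints, at
      the exact differentials \<open>map d us\<close>.\<close>
    from this[rule_format, OF _ p', of "map (\<lambda>a. [:a:]) as"] len
    have "shift_acts del actM (map (pneg del) (map (\<lambda>a. [:a:]) as)) p
        \<in> \<Phi> k \<gamma> (map2 (dop act\<Omega> D\<Omega>) (map (\<lambda>a. [:a:]) as) (map d us))"
      by (simp del: map_map)
    moreover have "map2 (dop act\<Omega> D\<Omega>) (map (\<lambda>a. [:a:]) as) (map d us) = map2 (\<lambda>a u. act\<Omega> a (d u)) as us"
      by (simp add: zip_map_map comp_def case_prod_beta)
    ultimately show ?thesis by (simp add: comp_def)
  qed
  ultimately show ?thesis by blast
qed

end
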